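(* Let $n\ge 1$ and $l\ge 2$ be integers, let $K$ be a field, let $H$ be a transitive abelian subgroup of $\mathrm{Sym}_n$, and let $G$ be the group of fractions of $S=S_{n,l}(H)$. Then $J(K[G])\subseteq J(K[T(G)])K[G]$; in particular $J(K[G])$ is a nilpotent ideal. Furthermore, if $\mathrm{char}(K) = 0$, or $\mathrm{char}(K) = p>0$ and $p \nmid |H|$, then $J(K[S])=0$ and $J(K[G])=0$.
   Context: $\mathrm{Sym}_n$ is the symmetric group on $\{1,\dots,n\}$; a subgroup $H$ is transitive if it acts transitively on $\{1,\dots,n\}$. For a subgroup $H$ of $\mathrm{Sym}_n$ and an integer $l\ge 2$, $S_{n,l}(H)$ is the monoid given by the presentation $$S_{n,l}(H)=\langle x_1,\dots ,x_n\mid x_{i_1}x_{i_2}\cdots x_{i_l} =x_{\sigma (i_1)} x_{\sigma (i_2)} \cdots x_{\sigma (i_l)},\ \sigma \in H,\ i_1,\ldots ,i_l \in \{1,\ldots ,n\}\rangle.$$ When $H$ is transitive and abelian, $S=S_{n,l}(H)$ is cancellative, $x_1^l$ is central in $S$, and the central localization $G=S\langle x_1^l\rangle^{-1}$ is a group containing $S$, called the group of fractions of $S$. $T(G)=\{g\in G\mid g \text{ has finite order}\}$, which is a (finite, abelian, normal) subgroup of $G$. $K[S]$, $K[G]$, $K[T(G)]$ denote the monoid and group algebras over $K$, and $J(R)$ denotes the Jacobson radical of a ring $R$. *)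

theory Defs
  imports
    "HOL-Algebra.Algebra"
    "HOL-Library.Poly_Mapping"
    "HOL-Number_Theory.Cong"
begin

inductive_set presentation_cong :: "'a set \<Rightarrow> ('a list \<times> 'a list) set \<Rightarrow> ('a list \<times> 'a list) set"
  for E R where
    rel: "(u, v) \<in> R \<Longrightarrow> u \<in> lists E \<Longrightarrow> v \<in> lists E \<Longrightarrow> (u, v) \<in> presentation_cong E R"
  | refl: "u \<in> lists E \<Longrightarrow> (u, u) \<in> presentation_cong E R"
  | sym: "(u, v) \<in> presentation_cong E R \<Longrightarrow> (v, u) \<in> presentation_cong E R"
  | trans: "(u, v) \<in> presentation_cong E R \<Longrightarrow> (v, w) \<in> presentation_cong E R
      \<Longrightarrow> (u, w) \<in> presentation_cong E R"
  | append: "(u, v) \<in> presentation_cong E R \<Longrightarrow> (u', v') \<in> presentation_cong E R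
      \<Longrightarrow> (u @ u', v @ v') \<in> presentation_cong E R"

definition presented_monoid :: "'a set \<Rightarrow> ('a list \<times> 'a list) set \<Rightarrow> 'a list set monoid" where
  "presented_monoid E R =
    \<lparr>carrier = lists E // presentation_cong E R,
     monoid.mult = (\<lambda>A B. \<Union>a\<in>A. \<Union>b\<in>B. presentation_cong E R `` {a @ b}),
     one = presentation_cong E R `` {[]}\<rparr>"

definition presentation_gen :: "'a set \<Rightarrow> ('a list \<times> 'a list) set \<Rightarrow> 'a \<Rightarrow> 'a list set" where
  "presentation_gen E R i = presentation_cong E R `` {[i]}"

text \<open>The pair \<open>(s, z)\<close> stands for the fraction \<open>s z\<^sup>-\<^sup>1\<close>.\<close>

definition fraction_rel ::
  "('a, 'b) monoid_scheme \<Rightarrow> 'a set \<Rightarrow> (('a \<times> 'a) \<times> ('a \<times> 'a)) set" where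
  "fraction_rel M Z = {((s, z), (t, w)). s \<in> carrier M \<and> z \<in> Z \<and> t \<in> carrier M \<and> w \<in> Z \<and>
     (\<exists>u\<in>Z. s \<otimes>\<^bsub>M\<^esub> w \<otimes>\<^bsub>M\<^esub> u = t \<otimes>\<^bsub>M\<^esub> z \<otimes>\<^bsub>M\<^esub> u)}"

definition central_localization ::
  "('a, 'b) monoid_scheme \<Rightarrow> 'a set \<Rightarrow> ('a \<times> 'a) set monoid" where
  "central_localization M Z =
    \<lparr>carrier = (carrier M \<times> Z) // fraction_rel M Z,
     monoid.mult = (\<lambda>A B. \<Union>(s, z)\<in>A. \<Union>(t, w)\<in>B. fraction_rel M Z `` {(s \<otimes>\<^bsub>M\<^esub> t, z \<otimes>\<^bsub>M\<^esub> w)}),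
     one = fraction_rel M Z `` {(\<one>\<^bsub>M\<^esub>, \<one>\<^bsub>M\<^esub>)}\<rparr>"

definition transitive_on :: "'a set \<Rightarrow> ('a \<Rightarrow> 'a) set \<Rightarrow> bool" where
  "transitive_on E H \<longleftrightarrow> (\<forall>i\<in>E. \<forall>j\<in>E. \<exists>\<sigma>\<in>H. \<sigma> i = j)"

definition S_relations :: "nat \<Rightarrow> nat \<Rightarrow> (nat \<Rightarrow> nat) set \<Rightarrow> (nat list \<times> nat list) set" where
  "S_relations n l H = {(w, map \<sigma> w) |w \<sigma>. w \<in> lists {1..n} \<and> length w = l \<and> \<sigma> \<in> H}"

definition S_monoid :: "nat \<Rightarrow> nat \<Rightarrow> (nat \<Rightarrow> nat) set \<Rightarrow> nat list set monoid" where
  "S_monoid n l H = presented_monoid {1..n} (S_relations n l H)"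

definition S_gen :: "nat \<Rightarrow> nat \<Rightarrow> (nat \<Rightarrow> nat) set \<Rightarrow> nat \<Rightarrow> nat list set" where
  "S_gen n l H i = presentation_gen {1..n} (S_relations n l H) i"

definition fraction_group ::
  "nat \<Rightarrow> nat \<Rightarrow> (nat \<Rightarrow> nat) set \<Rightarrow> (nat list set \<times> nat list set) set monoid" where
  "fraction_group n l H =
     central_localization (S_monoid n l H)
       {(S_gen n l H 1 [^]\<^bsub>S_monoid n l H\<^esub> l) [^]\<^bsub>S_monoid n l H\<^esub> k |k::nat. True}"

definition torsion :: "('a, 'b) monoid_scheme \<Rightarrow> 'a set" where
  "torsion G = {g \<in> carrier G. \<exists>m::nat. m > 0 \<and> g [^]\<^bsub>G\<^esub> m = \<one>\<^bsub>G\<^esub>}"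

text \<open>
  The coefficient field enters only through its type. For a submonoid \<open>N\<close> of \<open>M\<close>, the carrier of
  the algebra of \<open>M\<lparr>carrier := N\<rparr>\<close> is literally a subset of the carrier of the algebra of \<open>M\<close>.
\<close>

definition monoid_algebra ::
  "'k::comm_ring_1 itself \<Rightarrow> ('a, 'b) monoid_scheme \<Rightarrow> ('a \<Rightarrow>\<^sub>0 'k) ring" where
  "monoid_algebra K M =
    \<lparr>carrier = {f. Poly_Mapping.keys f \<subseteq> carrier M},
     monoid.mult = (\<lambda>f g. \<Sum>a\<in>Poly_Mapping.keys f. \<Sum>b\<in>Poly_Mapping.keys g.
        Poly_Mapping.single (a \<otimes>\<^bsub>M\<^esub> b) (Poly_Mapping.lookup f a * Poly_Mapping.lookup g b)),
     one = Poly_Mapping.single \<one>\<^bsub>M\<^esub> 1,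
     ring.zero = 0,
     ring.add = (+)\<rparr>"

text \<open>
  The rings are noncommutative, so the radical is the intersection of the maximal left ideals; the
  library's \<open>maximalideal\<close> is two-sided. The \<open>carrier R\<close> conjunct covers rings without maximal
  left ideals.
\<close>

definition left_ideal :: "'a set \<Rightarrow> ('a, 'b) ring_scheme \<Rightarrow> bool" where
  "left_ideal I R \<longleftrightarrow>
     additive_subgroup I R \<and> (\<forall>r\<in>carrier R. \<forall>a\<in>I. r \<otimes>\<^bsub>R\<^esub> a \<in> I)"

definition maximal_left_ideal :: "'a set \<Rightarrow> ('a, 'b) ring_scheme \<Rightarrow> bool" where
  "maximal_left_ideal I R \<longleftrightarrow>
     left_ideal I R \<and> I \<noteq> carrier R \<and>
     (\<forall>L. left_ideal L R \<longrightarrow> I \<subseteq> L \<longrightarrow> L = I \<or> L = carrier R)"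

definition jacobson_radical :: "('a, 'b) ring_scheme \<Rightarrow> 'a set" where
  "jacobson_radical R = {a \<in> carrier R. \<forall>I. maximal_left_ideal I R \<longrightarrow> a \<in> I}"

text \<open>\<open>ideal_prod\<close> gives the finite sums of products, so the iteration below computes \<open>I\<^sup>m\<close>, with \<open>I\<^sup>0 = R\<close>.\<close>

definition nilpotent_ideal :: "'a set \<Rightarrow> ('a, 'b) ring_scheme \<Rightarrow> bool" where
  "nilpotent_ideal I R \<longleftrightarrow>
     ideal I R \<and> (\<exists>m::nat. ((\<lambda>L. L \<cdot>\<^bsub>R\<^esub> I) ^^ m) (carrier R) = {\<zero>\<^bsub>R\<^esub>})"

end

theory Submission
  imports Defs
begin

text \<open>
  A transitive abelian group \<open>H\<close> acts regularly, so the generators \<open>x\<^sub>i\<close> may be labelled by the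
  elements of \<open>H\<close>, with \<open>x\<^sub>1\<close> labelled by the identity. For each residue class modulo \<open>l\<close> multiply
  the labels of the letters of a word that stand in positions of that class. A defining relation
  multiplies all \<open>l\<close> products by the same \<open>\<sigma>\<close>, so the products modulo the diagonal, together with
  the length, are invariants of the word, and they turn out to determine it in \<open>S\<close> (\<open>cong_iff\<close>).
  Hence \<open>S\<close> embeds into \<open>(H\<^sup>l / diagonal) \<rtimes> \<int>\<close>, where \<open>\<int>\<close> shifts the \<open>l\<close> factors
  cyclically, and \<open>G\<close> becomes this group. The length extends to a degree \<open>G \<rightarrow> \<int>\<close> whose kernel
  \<open>T\<close> is the finite abelian torsion subgroup, the element \<open>\<zeta> = x\<^sub>1\<^sup>l\<close> is central of degree \<open>l\<close>, and
  \<open>S\<close> contains every element of \<open>G\<close> of degree at least \<open>l\<close> (\<open>high_degree_words\<close>).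

  Let \<open>N\<close> be the set of nilpotent elements of the commutative finite-dimensional algebra \<open>K[T]\<close>. The
  heart of the proof is that the Jacobson radicals of \<open>K[G]\<close> and of \<open>K[S]\<close> lie in the ideal
  \<open>N K[G]\<close> (\<open>quasi_radical_sub_nil_ideal\<close>). Suppose that \<open>x\<close> is in the radical and that a
  homogeneous component of \<open>x\<close>, the highest one possible, is not in \<open>N K[G]\<close>; up to a group element
  it is a non-nilpotent \<open>a \<in> K[T]\<close>. A suitable multiple \<open>c\<close> of \<open>a\<close>, still not nilpotent, behaves
  like a primitive idempotent: each conjugate of \<open>c\<close> either equals \<open>c\<close> or annihilates \<open>c\<close> modulo \<open>N\<close>
  (\<open>stable_factor\<close>). Multiplying \<open>x\<close> by \<open>c\<close> from both sides and by powers of \<open>\<zeta>\<close> gives an element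
  \<open>v\<close> of the radical, of positive degree, with leading coefficient \<open>c\<^sup>3\<close> and, modulo \<open>N K[G]\<close>,
  commuting with \<open>c\<close>. The radical property makes \<open>1 - v\<close> invertible. Comparing degrees, a polynomial
  \<open>1 - v\<close> can only have a polynomial inverse if its leading coefficient is nilpotent
  (\<open>leading_coefficient_nilpotent\<close>), which contradicts the choice of \<open>c\<close>.

  Nilpotent elements of \<open>K[T]\<close> are in \<open>J(K[T])\<close>, which gives the inclusion. A finite basis of \<open>N\<close>
  consists of commuting nilpotents, so \<open>N\<^sup>m = 0\<close> for some \<open>m\<close>, and \<open>N\<close> is stable under conjugation,
  so \<open>(N K[G])\<^sup>m = 0\<close>. Finally \<open>T\<close> has exponent dividing \<open>|H|\<close>; if the characteristic does not
  divide \<open>|H|\<close> then \<open>|T|\<close> is invertible in \<open>K\<close>, and Maschke's averaging argument yields \<open>N = 0\<close>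
  (\<open>nilpotent_eq_zero\<close>).

  The model group is a subset of a type of class \<open>group_add\<close>. Its group algebra is then a subring of
  a type of class \<open>ring_1\<close>, and the computations above take place there; only the beginning and the
  end of the proof speak about record structures.
\<close>

section \<open>The Jacobson radical through left inverses\<close>

lemma (in ring) left_ideal_principal:
  assumes "b \<in> carrier R"
  shows "left_ideal {r \<otimes> b | r. r \<in> carrier R} R"
proof -
  have "subgroup {r \<otimes> b | r. r \<in> carrier R} (add_monoid R)"
  proof (rule subgroup.intro)
    show "\<one>\<^bsub>add_monoid R\<^esub> \<in> {r \<otimes> b | r. r \<in> carrier R}"
      using assms by (auto intro!: exI[of _ \<zero>])
  next
    fix x y assume "x \<in> {r \<otimes> b | r. r \<in> carrier R}" "y \<in> {r \<otimes> b | r. r \<in> carrier R}"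
    then obtain r s where "r \<in> carrier R" "x = r \<otimes> b" "s \<in> carrier R" "y = s \<otimes> b" by auto
    then show "x \<otimes>\<^bsub>add_monoid R\<^esub> y \<in> {r \<otimes> b | r. r \<in> carrier R}"
      using assms by (auto intro!: exI[of _ "r \<oplus> s"] simp: l_distr)
  next
    fix x assume "x \<in> {r \<otimes> b | r. r \<in> carrier R}"
    then obtain r where r: "r \<in> carrier R" "x = r \<otimes> b" by auto
    have "inv\<^bsub>add_monoid R\<^esub> x = (\<ominus> r) \<otimes> b"
      using r assms by (simp add: a_inv_def[symmetric] l_minus)
    then show "inv\<^bsub>add_monoid R\<^esub> x \<in> {r \<otimes> b | r. r \<in> carrier R}"
      using r assms by auto
  qed (use assms in auto)
  then show ?thesis
    using assms unfolding left_ideal_def additive_subgroup_def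
    by (auto simp: m_assoc[symmetric])
qed

lemma (in ring) left_ideal_sum_principal:
  assumes I: "left_ideal I R" and a: "a \<in> carrier R"
  shows "left_ideal {i \<oplus> r \<otimes> a | i r. i \<in> I \<and> r \<in> carrier R} R"
proof -
  interpret I: additive_subgroup I R using I by (simp add: left_ideal_def)
  have lI: "r \<otimes> i \<in> I" if "r \<in> carrier R" "i \<in> I" for r i
    using I that by (simp add: left_ideal_def)
  have [simp]: "i \<in> carrier R" if "i \<in> I" for i using that by (rule I.a_Hcarr)
  let ?L = "{i \<oplus> r \<otimes> a | i r. i \<in> I \<and> r \<in> carrier R}"
  have "subgroup ?L (add_monoid R)"
  proof (rule subgroup.intro)
    show "\<one>\<^bsub>add_monoid R\<^esub> \<in> ?L"
      using a I.zero_closed by (auto intro!: exI[of _ \<zero>])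
  next
    fix x y assume "x \<in> ?L" "y \<in> ?L"
    then obtain i r j s where *: "i \<in> I" "r \<in> carrier R" "x = i \<oplus> r \<otimes> a"
      "j \<in> I" "s \<in> carrier R" "y = j \<oplus> s \<otimes> a" by auto
    then have "x \<oplus> y = (i \<oplus> j) \<oplus> (r \<oplus> s) \<otimes> a"
      using a by (simp add: l_distr a_ac)
    then show "x \<otimes>\<^bsub>add_monoid R\<^esub> y \<in> ?L"
      using * I.a_closed[of i j] by auto
  next
    fix x assume "x \<in> ?L"
    then obtain i r where *: "i \<in> I" "r \<in> carrier R" "x = i \<oplus> r \<otimes> a" by auto
    have "inv\<^bsub>add_monoid R\<^esub> x = (\<ominus> i) \<oplus> (\<ominus> r) \<otimes> a"
      using * a by (simp add: a_inv_def[symmetric] l_minus minus_add)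
    then show "inv\<^bsub>add_monoid R\<^esub> x \<in> ?L"
      using * a I.a_inv_closed[of i] by auto
  qed (use a in auto)
  moreover have "s \<otimes> x \<in> ?L" if s: "s \<in> carrier R" and x: "x \<in> ?L" for s x
  proof -
    obtain i r where *: "i \<in> I" "r \<in> carrier R" "x = i \<oplus> r \<otimes> a" using x by auto
    have "s \<otimes> x = s \<otimes> i \<oplus> (s \<otimes> r) \<otimes> a"
      using * a s by (simp add: r_distr m_assoc)
    then show ?thesis using * s lI by auto
  qed
  ultimately show ?thesis unfolding left_ideal_def additive_subgroup_def by blast
qed

lemma (in ring) left_ideal_eq_carrier:
  assumes "left_ideal I R" "\<one> \<in> I"
  shows "I = carrier R"
proof -
  have "I \<subseteq> carrier R"
    using assms(1) additive_subgroup.a_subset unfolding left_ideal_def by blast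
  moreover have "r \<in> I" if "r \<in> carrier R" for r
    using assms that unfolding left_ideal_def by (metis r_one)
  ultimately show ?thesis by blast
qed

text \<open>Zorn: the union of a chain of left ideals avoiding \<open>\<one>\<close> is again one.\<close>

lemma (in ring) proper_left_ideal_le_maximal:
  assumes L: "left_ideal L R" and "\<one> \<notin> L"
  shows "\<exists>I. maximal_left_ideal I R \<and> L \<subseteq> I"
proof -
  let ?C = "{I. left_ideal I R \<and> \<one> \<notin> I \<and> L \<subseteq> I}"
  have "\<exists>U\<in>?C. \<forall>I\<in>Ch. I \<subseteq> U" if ch: "subset.chain ?C Ch" for Ch
  proof (cases "Ch = {}")
    case True
    then show ?thesis using assms by auto
  next
    case False
    have C: "\<And>I. I \<in> Ch \<Longrightarrow> left_ideal I R \<and> \<one> \<notin> I \<and> L \<subseteq> I"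
      and lin: "\<And>I J. I \<in> Ch \<Longrightarrow> J \<in> Ch \<Longrightarrow> I \<subseteq> J \<or> J \<subseteq> I"
      using ch unfolding subset.chain_def by auto
    have sg: "subgroup I (add_monoid R)" if "I \<in> Ch" for I
      using C[OF that] by (simp add: left_ideal_def additive_subgroup_def)
    have "subgroup (\<Union>Ch) (add_monoid R)"
    proof (rule subgroup.intro)
      show "\<Union>Ch \<subseteq> carrier (add_monoid R)"
        by (intro Union_least subgroup.subset sg)
      obtain I where "I \<in> Ch" using False by blast
      then show "\<one>\<^bsub>add_monoid R\<^esub> \<in> \<Union>Ch"
        using subgroup.one_closed[OF sg[OF \<open>I \<in> Ch\<close>]] by blast
      show "x \<otimes>\<^bsub>add_monoid R\<^esub> y \<in> \<Union>Ch" if xy: "x \<in> \<Union>Ch" "y \<in> \<Union>Ch" for x y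
      proof -
        obtain I J where IJ: "x \<in> I" "I \<in> Ch" "y \<in> J" "J \<in> Ch" using xy by blast
        obtain I' where I': "x \<in> I'" "y \<in> I'" "I' \<in> Ch" using lin[OF IJ(2,4)] IJ by blast
        show ?thesis
          using subgroup.m_closed[OF sg[OF I'(3)] I'(1,2)] I'(3) by blast
      qed
      show "inv\<^bsub>add_monoid R\<^esub> x \<in> \<Union>Ch" if x: "x \<in> \<Union>Ch" for x
      proof -
        obtain I where I: "x \<in> I" "I \<in> Ch" using x by blast
        show ?thesis using subgroup.m_inv_closed[OF sg[OF I(2)] I(1)] I(2) by blast
      qed
    qed
    moreover have "r \<otimes> a \<in> \<Union>Ch" if "r \<in> carrier R" "a \<in> \<Union>Ch" for r a
      using that C unfolding left_ideal_def by blast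
    ultimately have "left_ideal (\<Union>Ch) R" by (simp add: left_ideal_def additive_subgroup_def)
    moreover have "\<one> \<notin> \<Union>Ch" "L \<subseteq> \<Union>Ch" using C False by auto
    ultimately show ?thesis by blast
  qed
  then have "\<exists>I\<in>?C. \<forall>J\<in>?C. I \<subseteq> J \<longrightarrow> J = I"
    by (rule subset_Zorn)
  then obtain I where I: "I \<in> ?C" and max: "\<forall>J\<in>?C. I \<subseteq> J \<longrightarrow> J = I"
    by (rule bexE)
  have "maximal_left_ideal I R"
    unfolding maximal_left_ideal_def
  proof (intro conjI allI impI)
    show "left_ideal I R" "I \<noteq> carrier R" using I by auto
    fix J assume J: "left_ideal J R" "I \<subseteq> J"
    show "J = I \<or> J = carrier R"
    proof (cases "\<one> \<in> J")
      case True
      then show ?thesis using left_ideal_eq_carrier[OF J(1)] by simp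
    next
      case False
      have "L \<subseteq> J" using I J(2) by auto
      then show ?thesis using max J False by simp
    qed
  qed
  then show ?thesis using I by auto
qed

text \<open>If \<open>1 - r a\<close> has no left inverse, then it generates a proper left ideal, and a maximal left ideal
  above it cannot contain \<open>a\<close>. Conversely, a maximal left ideal \<open>I\<close> without \<open>a\<close> satisfies
  \<open>I + R a = R\<close>, hence contains some \<open>1 - r a\<close>. The criterion speaks about
  elements only, which makes it easy to transport along isomorphisms.\<close>

lemma (in ring) jacobson_radical_left_inverse:
  "jacobson_radical R =
     {a \<in> carrier R. \<forall>r\<in>carrier R. \<exists>u\<in>carrier R. u \<otimes> (\<one> \<ominus> r \<otimes> a) = \<one>}"
proof (intro equalityI subsetI)
  fix a assume a: "a \<in> jacobson_radical R"
  then have ac: "a \<in> carrier R" by (simp add: jacobson_radical_def)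
  have "\<exists>u\<in>carrier R. u \<otimes> (\<one> \<ominus> r \<otimes> a) = \<one>" if r: "r \<in> carrier R" for r
  proof (rule ccontr)
    assume no: "\<not> ?thesis"
    let ?b = "\<one> \<ominus> r \<otimes> a"
    have b: "?b \<in> carrier R" using r ac by simp
    let ?L = "{u \<otimes> ?b | u. u \<in> carrier R}"
    have "\<one> \<notin> ?L" using no by force
    then obtain I where I: "maximal_left_ideal I R" "?L \<subseteq> I"
      using proper_left_ideal_le_maximal[OF left_ideal_principal[OF b]] by blast
    then have Il: "left_ideal I R" by (simp add: maximal_left_ideal_def)
    interpret I: additive_subgroup I R using Il by (simp add: left_ideal_def)
    have "a \<in> I" using a I by (simp add: jacobson_radical_def)
    then have ra: "r \<otimes> a \<in> I" using r Il by (simp add: left_ideal_def)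
    have "?b \<in> I" using I(2) l_one[OF b, symmetric] one_closed by blast
    then have "?b \<oplus> r \<otimes> a \<in> I" using ra by (rule I.a_closed)
    moreover have "?b \<oplus> r \<otimes> a = \<one>" using r ac by (simp add: a_minus_def a_assoc l_neg)
    ultimately have "\<one> \<in> I" by simp
    then show False using left_ideal_eq_carrier[OF Il] I(1) by (simp add: maximal_left_ideal_def)
  qed
  then show "a \<in> {a \<in> carrier R. \<forall>r\<in>carrier R. \<exists>u\<in>carrier R. u \<otimes> (\<one> \<ominus> r \<otimes> a) = \<one>}"
    using ac by simp
next
  fix a assume a: "a \<in> {a \<in> carrier R. \<forall>r\<in>carrier R. \<exists>u\<in>carrier R. u \<otimes> (\<one> \<ominus> r \<otimes> a) = \<one>}"
  have ac: "a \<in> carrier R" using a by simp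
  have "a \<in> I" if I: "maximal_left_ideal I R" for I
  proof (rule ccontr)
    assume "a \<notin> I"
    have Il: "left_ideal I R" using I by (simp add: maximal_left_ideal_def)
    interpret I: additive_subgroup I R using Il by (simp add: left_ideal_def)
    let ?L = "{i \<oplus> r \<otimes> a | i r. i \<in> I \<and> r \<in> carrier R}"
    have "x \<in> ?L" if "x \<in> I" for x
      using that ac by (intro CollectI exI[of _ x] exI[of _ \<zero>]) auto
    moreover have "a \<in> ?L"
      using ac I.zero_closed by (intro CollectI exI[of _ \<zero>] exI[of _ \<one>]) auto
    ultimately have "?L = carrier R"
      using I left_ideal_sum_principal[OF Il ac] \<open>a \<notin> I\<close> unfolding maximal_left_ideal_def by blast
    then have "\<one> \<in> ?L" by simp
    then obtain i r where ir: "i \<in> I" "r \<in> carrier R" "\<one> = i \<oplus> r \<otimes> a" by auto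
    have ic: "i \<in> carrier R" using ir by simp
    have "\<one> \<ominus> r \<otimes> a = i"
      using ir(2) ic ac unfolding ir(3) by (simp add: a_minus_def a_assoc r_neg)
    moreover obtain u where "u \<in> carrier R" "u \<otimes> (\<one> \<ominus> r \<otimes> a) = \<one>" using a ir(2) by blast
    moreover have "u \<otimes> i \<in> I" using Il ir(1) \<open>u \<in> carrier R\<close> by (simp add: left_ideal_def)
    ultimately have "\<one> \<in> I" by simp
    then show False using left_ideal_eq_carrier[OF Il] I by (simp add: maximal_left_ideal_def)
  qed
  then show "a \<in> jacobson_radical R" using ac by (simp add: jacobson_radical_def)
qed

lemma (in ring) jacobson_radical_additive_subgroup: "additive_subgroup (jacobson_radical R) R"
proof -
  have sg: "subgroup I (add_monoid R)" if "maximal_left_ideal I R" for I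
    using that by (simp add: maximal_left_ideal_def left_ideal_def additive_subgroup_def)
  have J: "x \<in> jacobson_radical R \<longleftrightarrow>
      x \<in> carrier R \<and> (\<forall>I. maximal_left_ideal I R \<longrightarrow> x \<in> I)" for x
    by (simp add: jacobson_radical_def)
  have "subgroup (jacobson_radical R) (add_monoid R)"
  proof (rule subgroup.intro)
    show "jacobson_radical R \<subseteq> carrier (add_monoid R)" by (auto simp: jacobson_radical_def)
    show "\<one>\<^bsub>add_monoid R\<^esub> \<in> jacobson_radical R"
      unfolding J by (auto dest!: sg subgroup.one_closed)
    show "x \<otimes>\<^bsub>add_monoid R\<^esub> y \<in> jacobson_radical R"
      if xy: "x \<in> jacobson_radical R" "y \<in> jacobson_radical R" for x y
    proof -
      have "x \<oplus> y \<in> I" if "maximal_left_ideal I R" for I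
        using subgroup.m_closed[OF sg[OF that], of x y] xy that by (simp add: J)
      then show ?thesis using xy by (simp add: J)
    qed
    show "inv\<^bsub>add_monoid R\<^esub> x \<in> jacobson_radical R" if x: "x \<in> jacobson_radical R" for x
    proof -
      have "\<ominus> x \<in> I" if "maximal_left_ideal I R" for I
        using subgroup.m_inv_closed[OF sg[OF that], of x] x that by (simp add: J a_inv_def)
      then show ?thesis using x by (simp add: J a_inv_def[symmetric])
    qed
  qed
  then show ?thesis by (simp add: additive_subgroup_def)
qed

section \<open>Subrings of a ring type\<close>

definition subring_set :: "'a::ring_1 set \<Rightarrow> bool" where
  "subring_set A \<longleftrightarrow> 0 \<in> A \<and> 1 \<in> A \<and> (\<forall>a\<in>A. \<forall>b\<in>A. a + b \<in> A \<and> a * b \<in> A) \<and> (\<forall>a\<in>A. - a \<in> A)"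

lemma subring_setD:
  assumes "subring_set A"
  shows "0 \<in> A" "1 \<in> A" "a \<in> A \<Longrightarrow> b \<in> A \<Longrightarrow> a + b \<in> A" "a \<in> A \<Longrightarrow> b \<in> A \<Longrightarrow> a * b \<in> A"
    "a \<in> A \<Longrightarrow> - a \<in> A" "a \<in> A \<Longrightarrow> b \<in> A \<Longrightarrow> a - b \<in> A"
  using assms unfolding subring_set_def by (auto simp: diff_conv_add_uminus simp del: add_uminus_conv_diff)

text \<open>The Jacobson radical of the subring \<open>A\<close>, in the form of \<open>jacobson_radical_left_inverse\<close>.\<close>

definition quasi_radical :: "'a::ring_1 set \<Rightarrow> 'a set" where
  "quasi_radical A = {a \<in> A. \<forall>r\<in>A. \<exists>u\<in>A. u * (1 - r * a) = 1}"

lemma quasi_radical_mult_left: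
  assumes "subring_set A" "a \<in> quasi_radical A" "s \<in> A"
  shows "s * a \<in> quasi_radical A"
  using assms unfolding quasi_radical_def
  by (auto simp: subring_setD mult.assoc[symmetric])

text \<open>If \<open>u\<close> is a left inverse of \<open>1 - y x\<close>, then \<open>1 + x u y\<close> is one of \<open>1 - x y\<close>.\<close>

lemma quasi_radical_mult_right:
  assumes A: "subring_set A" and a: "a \<in> quasi_radical A" and s: "s \<in> A"
  shows "a * s \<in> quasi_radical A"
proof -
  have aA: "a \<in> A" using a by (simp add: quasi_radical_def)
  have "\<exists>u\<in>A. u * (1 - r * (a * s)) = 1" if r: "r \<in> A" for r
  proof -
    have "s * r \<in> A" using A s r by (simp add: subring_setD)
    then obtain u where u: "u \<in> A" "u * (1 - (s * r) * a) = 1"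
      using a by (auto simp: quasi_radical_def)
    have "(1 + r * a * u * s) * (1 - r * (a * s))
        = 1 - r * a * s + r * a * (u * (1 - (s * r) * a)) * s"
      by (simp add: algebra_simps)
    also have "\<dots> = 1" by (simp add: u)
    finally show ?thesis
      using A u(1) aA r s by (intro bexI[of _ "1 + r * a * u * s"]) (simp_all add: subring_setD)
  qed
  then show ?thesis using A aA s by (simp add: quasi_radical_def subring_setD)
qed

text \<open>A left inverse \<open>u\<close> of \<open>1 - a\<close> is \<open>1 - (- u) a\<close>, so it has a left inverse itself and is a unit.\<close>

lemma quasi_radical_right_inverse:
  assumes A: "subring_set A" and a: "a \<in> quasi_radical A"
  shows "\<exists>u\<in>A. (1 - a) * u = 1"
proof -
  have aA: "a \<in> A" using a by (simp add: quasi_radical_def)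
  obtain u where u: "u \<in> A" "u * (1 - a) = 1"
    using a A by (auto simp: quasi_radical_def subring_setD dest!: bspec[of A _ 1])
  then have eq: "u = 1 + u * a" by (simp add: algebra_simps)
  obtain v where v: "v \<in> A" "v * (1 - (- u) * a) = 1"
    using a A u by (auto simp: quasi_radical_def subring_setD dest!: bspec[of A _ "- u"])
  have vu: "v * u = 1" using v(2) eq by simp
  have "v = v * (u * (1 - a))" using u by simp
  also have "\<dots> = 1 - a" by (simp add: vu mult.assoc[symmetric])
  finally show ?thesis using vu u(1) by auto
qed

text \<open>A record structure that a map identifies with a subring of a ring type is a ring, and its
  Jacobson radical can be computed there.\<close>

locale ring_embedding =
  fixes R :: "('a, 'c) ring_scheme" and \<Phi> :: "'a \<Rightarrow> 'b::ring_1"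
  assumes inj: "inj_on \<Phi> (carrier R)"
    and subring: "subring_set (\<Phi> ` carrier R)"
    and add_closed: "a \<in> carrier R \<Longrightarrow> b \<in> carrier R \<Longrightarrow> a \<oplus>\<^bsub>R\<^esub> b \<in> carrier R"
    and mult_closed: "a \<in> carrier R \<Longrightarrow> b \<in> carrier R \<Longrightarrow> a \<otimes>\<^bsub>R\<^esub> b \<in> carrier R"
    and zero_closed: "\<zero>\<^bsub>R\<^esub> \<in> carrier R"
    and one_closed: "\<one>\<^bsub>R\<^esub> \<in> carrier R"
    and hom_add: "a \<in> carrier R \<Longrightarrow> b \<in> carrier R \<Longrightarrow> \<Phi> (a \<oplus>\<^bsub>R\<^esub> b) = \<Phi> a + \<Phi> b"
    and hom_mult: "a \<in> carrier R \<Longrightarrow> b \<in> carrier R \<Longrightarrow> \<Phi> (a \<otimes>\<^bsub>R\<^esub> b) = \<Phi> a * \<Phi> b"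
    and hom_zero: "\<Phi> \<zero>\<^bsub>R\<^esub> = 0"
    and hom_one: "\<Phi> \<one>\<^bsub>R\<^esub> = 1"
begin

lemma inj_eq: "a \<in> carrier R \<Longrightarrow> b \<in> carrier R \<Longrightarrow> \<Phi> a = \<Phi> b \<longleftrightarrow> a = b"
  using inj by (simp add: inj_on_eq_iff)

lemma ring: "ring R"
proof (rule ringI)
  show "abelian_group R"
  proof (rule abelian_groupI)
    show "\<exists>y\<in>carrier R. y \<oplus>\<^bsub>R\<^esub> x = \<zero>\<^bsub>R\<^esub>" if "x \<in> carrier R" for x
    proof -
      have "- \<Phi> x \<in> \<Phi> ` carrier R" using subring that by (simp add: subring_setD)
      then obtain y where "y \<in> carrier R" "\<Phi> y = - \<Phi> x" by (metis imageE)
      then have "y \<oplus>\<^bsub>R\<^esub> x = \<zero>\<^bsub>R\<^esub>"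
        using that by (simp add: inj_eq[symmetric] hom_add hom_zero add_closed zero_closed)
      with \<open>y \<in> carrier R\<close> show ?thesis by blast
    qed
  qed (simp_all add: inj_eq[symmetric] hom_add hom_zero add_closed zero_closed algebra_simps)
  show "monoid R"
    by (rule monoidI)
      (simp_all add: inj_eq[symmetric] hom_mult hom_one mult_closed one_closed mult.assoc)
qed (simp_all add: inj_eq[symmetric] hom_mult hom_add mult_closed add_closed algebra_simps)

lemma hom_minus:
  assumes "a \<in> carrier R" "b \<in> carrier R"
  shows "\<Phi> (a \<ominus>\<^bsub>R\<^esub> b) = \<Phi> a - \<Phi> b"
proof -
  interpret R: ring R by (rule ring)
  have "\<Phi> b + \<Phi> (\<ominus>\<^bsub>R\<^esub> b) = 0"
    using assms by (simp add: hom_add[symmetric] R.r_neg hom_zero)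
  then have "\<Phi> (\<ominus>\<^bsub>R\<^esub> b) = - \<Phi> b" by (simp add: eq_neg_iff_add_eq_0 add.commute)
  then show ?thesis using assms by (simp add: a_minus_def hom_add)
qed

lemma jacobson_radical_iff:
  assumes "a \<in> carrier R"
  shows "a \<in> jacobson_radical R \<longleftrightarrow> \<Phi> a \<in> quasi_radical (\<Phi> ` carrier R)"
proof -
  interpret R: ring R by (rule ring)
  have "u \<otimes>\<^bsub>R\<^esub> (\<one>\<^bsub>R\<^esub> \<ominus>\<^bsub>R\<^esub> r \<otimes>\<^bsub>R\<^esub> a) = \<one>\<^bsub>R\<^esub> \<longleftrightarrow> \<Phi> u * (1 - \<Phi> r * \<Phi> a) = 1"
    if "u \<in> carrier R" "r \<in> carrier R" for u r
    using that assms by (simp add: inj_eq[symmetric] hom_mult hom_minus hom_one)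
  then show ?thesis
    using assms by (auto simp: R.jacobson_radical_left_inverse quasi_radical_def)
qed

lemma jacobson_radical_ideal: "ideal (jacobson_radical R) R"
proof -
  interpret R: ring R by (rule ring)
  have J: "jacobson_radical R \<subseteq> carrier R" by (auto simp: jacobson_radical_def)
  show ?thesis
  proof (rule idealI[OF ring])
    show "subgroup (jacobson_radical R) (add_monoid R)"
      using R.jacobson_radical_additive_subgroup by (simp add: additive_subgroup_def)
    fix a x assume ax: "a \<in> jacobson_radical R" "x \<in> carrier R"
    then have "a \<in> carrier R" using J by blast
    then show "x \<otimes>\<^bsub>R\<^esub> a \<in> jacobson_radical R" "a \<otimes>\<^bsub>R\<^esub> x \<in> jacobson_radical R"
      using ax subring
      by (simp_all add: jacobson_radical_iff hom_mult quasi_radical_mult_left quasi_radical_mult_right)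
  qed
qed

end

section \<open>Groups of bijections\<close>

abbreviation finv :: "('a \<Rightarrow> 'b) \<Rightarrow> 'b \<Rightarrow> 'a" where
  "finv \<equiv> inv_into UNIV"

text \<open>The model group consists of bijections, written additively: under convolution, the finitely
  supported functions on a type of class \<open>group_add\<close> form a type of class \<open>ring_1\<close>.\<close>

typedef 'a sym = "{f :: 'a \<Rightarrow> 'a. bij f}"
  morphisms act Sym by (rule exI[of _ id]) simp

instantiation sym :: (type) group_add
begin

definition "0 = Sym id"
definition "f + g = Sym (act f \<circ> act g)"
definition "- f = Sym (finv (act f))"
definition "f - (g :: 'a sym) = Sym (act f \<circ> finv (act g))"

instance
proof
  have [simp]: "bij (act f)" for f :: "'a sym" using act[of f] by simp
  have [simp]: "bij (finv (act f))" for f :: "'a sym" by (simp add: bij_imp_bij_inv)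
  fix a b c :: "'a sym"
  show "a + b + c = a + (b + c)"
    by (simp add: plus_sym_def Sym_inverse bij_comp comp_assoc)
  show "0 + a = a" "a + 0 = a"
    by (simp_all add: plus_sym_def zero_sym_def Sym_inverse act_inverse)
  show "- a + a = 0"
    by (simp add: plus_sym_def zero_sym_def uminus_sym_def Sym_inverse bij_is_inj)
  show "a + - b = a - b"
    by (simp add: plus_sym_def minus_sym_def uminus_sym_def Sym_inverse)
qed

end

lemma bij_act: "bij (act g)"
  using act[of g] by simp

lemma act_zero [simp]: "act 0 x = x"
  by (simp add: zero_sym_def Sym_inverse)

lemma act_plus [simp]: "act (f + g) x = act f (act g x)"
  by (simp add: plus_sym_def Sym_inverse bij_comp bij_act)

lemma sym_eqI: "(\<And>x. act f x = act g x) \<Longrightarrow> f = g"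
  by (metis act_inject ext)

definition nmult :: "nat \<Rightarrow> 'a::monoid_add \<Rightarrow> 'a" where
  "nmult k a = sum_list (replicate k a)"

lemma nmult_simps [simp]: "nmult 0 a = 0" "nmult (Suc k) a = a + nmult k a"
  by (simp_all add: nmult_def)

lemma nmult_add: "nmult (j + k) a = nmult j a + nmult k a"
  by (induction j) (simp_all add: add.assoc)

lemma nmult_mult: "nmult (j * k) a = nmult j (nmult k a)"
  by (induction j) (simp_all add: nmult_add)

lemma nmult_commute: assumes "a + b = b + a" shows "nmult k a + b = b + nmult k a"
proof (induction k)
  case (Suc k)
  have "nmult (Suc k) a + b = a + (nmult k a + b)" by (simp add: add.assoc)
  also have "\<dots> = (a + b) + nmult k a" unfolding Suc by (simp add: add.assoc)
  also have "\<dots> = b + nmult (Suc k) a" unfolding assms by (simp add: add.assoc)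
  finally show ?case .
qed simp

lemma uminus_commute:
  fixes a b :: "'a::group_add"
  assumes "a + b = b + a"
  shows "- a + b = b - a"
proof -
  have "- a + b = - a + (b + a) - a" by (simp add: add.assoc[symmetric])
  also have "\<dots> = b - a" unfolding assms[symmetric] by (simp add: add.assoc[symmetric])
  finally show ?thesis .
qed

section \<open>A faithful model of the monoid\<close>

locale transitive_abelian =
  fixes n l :: nat and H :: "(nat \<Rightarrow> nat) set"
  assumes n_pos: "n \<ge> 1" and l_pos: "l \<ge> 1"
    and subgroup: "subgroup H (sym_group n)"
    and abelian: "comm_group ((sym_group n)\<lparr>carrier := H\<rparr>)"
    and transitive: "transitive_on {1..n} H"
begin

declare One_nat_def [simp del] atLeastAtMost_iff [simp del]

lemma H_permutes: "\<sigma> \<in> H \<Longrightarrow> \<sigma> permutes {1..n}"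
  using subgroup.subset[OF subgroup] by (auto simp: sym_group_def)

lemma H_id: "id \<in> H"
  using subgroup.one_closed[OF subgroup] by (simp add: sym_group_def)

lemma H_comp: "\<sigma> \<in> H \<Longrightarrow> \<tau> \<in> H \<Longrightarrow> \<sigma> \<circ> \<tau> \<in> H"
  using subgroup.m_closed[OF subgroup] by (simp add: sym_group_def)

lemma H_bij: "\<sigma> \<in> H \<Longrightarrow> bij \<sigma>"
  using H_permutes permutes_bij by blast

lemma H_inv: assumes "\<sigma> \<in> H" shows "finv \<sigma> \<in> H"
proof -
  have eq: "inv\<^bsub>sym_group n\<^esub> \<sigma> = finv \<sigma>"
    using sym_group_inv_equality[of \<sigma> n] H_permutes[OF assms] by (simp add: sym_group_def)
  show ?thesis using subgroup.m_inv_closed[OF subgroup assms] unfolding eq .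
qed

lemma H_commute: "\<sigma> \<in> H \<Longrightarrow> \<tau> \<in> H \<Longrightarrow> \<sigma> (\<tau> x) = \<tau> (\<sigma> x)"
  using comm_monoid.m_comm[OF comm_group.axioms(1)[OF abelian], of \<sigma> \<tau>]
  by (simp add: sym_group_def fun_eq_iff)

lemma H_finite: "finite H"
  by (rule finite_subset[OF _ finite_permutations[of "{1..n}"]]) (auto dest: H_permutes)

lemma H_funpow: assumes "\<sigma> \<in> H" shows "\<sigma> ^^ card H = id"
proof -
  interpret G: comm_group "(sym_group n)\<lparr>carrier := H\<rparr>" by (rule abelian)
  have pow: "\<sigma> [^]\<^bsub>(sym_group n)\<lparr>carrier := H\<rparr>\<^esub> k = \<sigma> ^^ k" for k :: nat
  proof (induction k)
    case 0
    then show ?case by (simp add: sym_group_def)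
  next
    case (Suc k)
    then show ?case by (simp add: sym_group_def funpow_swap1 fun_eq_iff)
  qed
  have "\<sigma> [^]\<^bsub>(sym_group n)\<lparr>carrier := H\<rparr>\<^esub> card H = id"
    using G.pow_order_eq_1[of \<sigma>] assms by (simp add: order_def sym_group_def)
  then show ?thesis by (simp add: pow)
qed

lemma one_mem: "1 \<in> {1..n}" using n_pos by (simp add: atLeastAtMost_iff)

lemma H_mem: "\<sigma> \<in> H \<Longrightarrow> i \<in> {1..n} \<Longrightarrow> \<sigma> i \<in> {1..n}"
  using H_permutes permutes_in_image by metis

text \<open>Commuting with a transitive group, a permutation is determined by its value at one point: a
  transitive abelian group acts regularly.\<close>

lemma H_eqI:
  assumes "\<sigma> \<in> H" "\<tau> \<in> H" "\<sigma> 1 = \<tau> 1"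
  shows "\<sigma> = \<tau>"
proof
  fix x
  show "\<sigma> x = \<tau> x"
  proof (cases "x \<in> {1..n}")
    case True
    then obtain \<rho> where \<rho>: "\<rho> \<in> H" "\<rho> 1 = x"
      using transitive one_mem unfolding transitive_on_def by blast
    then show ?thesis using assms H_commute by metis
  next
    case False
    then show ?thesis using assms H_permutes by (metis permutes_not_in)
  qed
qed

definition elt :: "nat \<Rightarrow> nat \<Rightarrow> nat" where
  "elt i = (SOME \<sigma>. \<sigma> \<in> H \<and> \<sigma> 1 = i)"

lemma elt: assumes "i \<in> {1..n}" shows "elt i \<in> H" "elt i 1 = i"
proof -
  have "\<exists>\<sigma>. \<sigma> \<in> H \<and> \<sigma> 1 = i"
    using transitive one_mem assms unfolding transitive_on_def by blast
  from someI_ex[OF this] show "elt i \<in> H" "elt i 1 = i" by (simp_all add: elt_def)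
qed

lemma elt_apply:
  assumes "\<sigma> \<in> H" "i \<in> {1..n}"
  shows "elt (\<sigma> i) = \<sigma> \<circ> elt i"
  using assms by (intro H_eqI) (simp_all add: elt H_mem H_comp)

lemma elt_one: "elt 1 = id"
  using one_mem by (intro H_eqI) (simp_all add: elt H_id)

definition if_dvd :: "int \<Rightarrow> (nat \<Rightarrow> nat) \<Rightarrow> nat \<Rightarrow> nat" where
  "if_dvd a \<sigma> = (if int l dvd a then \<sigma> else id)"

lemma if_dvd_mem: "\<sigma> \<in> H \<Longrightarrow> if_dvd a \<sigma> \<in> H"
  by (simp add: if_dvd_def H_id)

text \<open>The semidirect product \<open>(H\<^sup>l / diagonal) \<rtimes> \<int>\<close> acts faithfully on triples \<open>(a, b, p)\<close>: the integers
  \<open>a\<close> and \<open>b\<close> select two of the \<open>l\<close> factors by their residues and are shifted by the degree, while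
  the point \<open>p\<close> is moved by the quotient of the two selected entries. Only quotients of entries are
  invariant under the diagonal, hence the pair of indices. The generator \<open>x\<^sub>i\<close> has its label \<open>elt i\<close>
  in the factor of residue 0 and trivial entries elsewhere.\<close>

definition gen :: "nat \<Rightarrow> (int \<times> int \<times> nat) sym" where
  "gen i = Sym (\<lambda>(a, b, p). (a + 1, b + 1, if_dvd a (elt i) (if_dvd b (finv (elt i)) p)))"

lemma act_gen:
  assumes "i \<in> {1..n}"
  shows "act (gen i) (a, b, p) = (a + 1, b + 1, if_dvd a (elt i) (if_dvd b (finv (elt i)) p))"
proof -
  have b: "bij (if_dvd a (elt i))" "bij (if_dvd b (finv (elt i)))" for a b
    using elt(1)[OF assms] by (simp_all add: H_bij H_inv if_dvd_mem)
  have "bij (\<lambda>(a, b, p). (a + 1, b + 1, if_dvd a (elt i) (if_dvd b (finv (elt i)) p)))"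
  proof (rule bijI)
    show "inj (\<lambda>(a, b, p). (a + 1, b + 1, if_dvd a (elt i) (if_dvd b (finv (elt i)) p)))"
      using b by (auto simp: inj_def dest!: bij_is_inj injD)
    show "surj (\<lambda>(a, b, p). (a + 1, b + 1, if_dvd a (elt i) (if_dvd b (finv (elt i)) p)))"
    proof (rule surjI)
      fix x :: "int \<times> int \<times> nat"
      obtain a b p where x: "x = (a, b, p)" by (cases x)
      show "(\<lambda>(a, b, p). (a + 1, b + 1, if_dvd a (elt i) (if_dvd b (finv (elt i)) p)))
        ((\<lambda>(a, b, p). (a - 1, b - 1, finv (if_dvd (b - 1) (finv (elt i))) (finv (if_dvd (a - 1) (elt i)) p))) x) = x"
        using b by (simp add: x bij_is_surj surj_f_inv_f)
    qed
  qed
  then show ?thesis by (simp add: gen_def Sym_inverse)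
qed

text \<open>For varying \<open>d\<close> and \<open>A\<close>, these bijections form a group that contains the generators. The last
  condition makes \<open>x\<^sub>1\<^sup>l\<close>, which shifts both indices by \<open>l\<close>, a central element of it.\<close>

definition shape :: "(int \<times> int \<times> nat) sym \<Rightarrow> int \<Rightarrow> (int \<Rightarrow> int \<Rightarrow> nat \<Rightarrow> nat) \<Rightarrow> bool" where
  "shape g d A \<longleftrightarrow> (\<forall>a b p. act g (a, b, p) = (a + d, b + d, A a b p)) \<and> (\<forall>a b. A a b \<in> H) \<and>
     (\<forall>a b. A (a + int l) (b + int l) = A a b)"

lemma shape_zero: "shape 0 0 (\<lambda>_ _. id)"
  by (simp add: shape_def H_id)

lemma shape_add:
  assumes "shape g d A" "shape g' d' A'"
  shows "shape (g + g') (d + d') (\<lambda>a b. A (a + d') (b + d') \<circ> A' a b)"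
  using assms unfolding shape_def
  by (auto simp: H_comp algebra_simps) (metis add.commute add.left_commute)+

lemma shape_uminus:
  assumes "shape g d A"
  shows "shape (- g) (- d) (\<lambda>a b. finv (A (a - d) (b - d)))"
proof -
  have A: "A a b \<in> H" for a b using assms by (simp add: shape_def)
  have "act (- g) (a, b, p) = (a - d, b - d, finv (A (a - d) (b - d)) p)" for a b p
  proof -
    have "act g (a - d, b - d, finv (A (a - d) (b - d)) p) = (a, b, p)"
      using assms A by (simp add: shape_def H_bij bij_is_surj surj_f_inv_f)
    then have "act (- g) (a, b, p) = act (- g + g) (a - d, b - d, finv (A (a - d) (b - d)) p)"
      by (simp del: left_minus)
    then show ?thesis by simp
  qed
  moreover have "A (a + int l - d) (b + int l - d) = A (a - d) (b - d)" for a b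
    using assms unfolding shape_def by (metis add_diff_eq diff_add_eq)
  ultimately show ?thesis using A by (simp add: shape_def H_inv)
qed

definition deg :: "(int \<times> int \<times> nat) sym \<Rightarrow> int" where
  "deg g = fst (act g (0, 0, 1))"

lemma shape_deg: "shape g d A \<Longrightarrow> deg g = d"
  by (simp add: shape_def deg_def)

lemma shape_gen:
  assumes "i \<in> {1..n}"
  shows "shape (gen i) 1 (\<lambda>a b. if_dvd a (elt i) \<circ> if_dvd b (finv (elt i)))"
  using assms elt(1)[OF assms] by (simp add: shape_def act_gen H_comp H_inv if_dvd_mem) (simp add: if_dvd_def)

definition word :: "nat list \<Rightarrow> (int \<times> int \<times> nat) sym" where
  "word w = sum_list (map gen w)"

lemma word_simps [simp]:
  "word [] = 0" "word (i # w) = gen i + word w" "word (u @ v) = word u + word v"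
  by (simp_all add: word_def)

lemma word_replicate: "word (replicate k i) = nmult k (gen i)"
  by (simp add: word_def nmult_def map_replicate)

text \<open>The product of the labels of the letters in one residue class of positions. Words act from the
  right end, so a letter counts when the number of letters behind it is congruent to \<open>- a\<close>
  modulo \<open>l\<close>.\<close>

fun residue_prod :: "nat list \<Rightarrow> int \<Rightarrow> nat \<Rightarrow> nat" where
  "residue_prod [] a = id"
| "residue_prod (i # w) a = if_dvd (a + int (length w)) (elt i) \<circ> residue_prod w a"

lemma residue_prod_mem: "w \<in> lists {1..n} \<Longrightarrow> residue_prod w a \<in> H"
  by (induction w) (auto simp: H_id H_comp if_dvd_mem elt)

lemma act_word:
  assumes "w \<in> lists {1..n}"
  shows "act (word w) (a, b, p) =
    (a + int (length w), b + int (length w), residue_prod w a (finv (residue_prod w b) p))"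
  using assms
proof (induction w)
  case Nil
  then show ?case by simp
next
  case (Cons i w)
  have i: "i \<in> {1..n}" and w: "w \<in> lists {1..n}" by (fact Cons.hyps)+
  let ?s = "if_dvd (a + int (length w)) (elt i)" and ?t = "if_dvd (b + int (length w)) (elt i)"
  have t: "finv ?t = if_dvd (b + int (length w)) (finv (elt i))" by (simp add: if_dvd_def inv_id)
  have mem: "?s \<in> H" "?t \<in> H" "finv ?t \<in> H" "residue_prod w a \<in> H" "residue_prod w b \<in> H"
    "finv (residue_prod w b) \<in> H"
    using i w by (simp_all add: elt if_dvd_mem residue_prod_mem H_inv)
  have b: "finv (residue_prod (i # w) b) = finv (residue_prod w b) \<circ> finv ?t"
    using mem by (simp add: o_inv_distrib H_bij del: o_apply)
  have a: "residue_prod (i # w) a p = ?s (residue_prod w a p)" for p by simp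
  show ?case
    using Cons.IH mem unfolding a b
    by (simp add: act_gen[OF i] t[symmetric] H_commute[of "finv ?t"])
qed

lemma shape_word:
  assumes "w \<in> lists {1..n}"
  shows "\<exists>A. shape (word w) (int (length w)) A"
  using assms
proof (induction w)
  case Nil
  then show ?case using shape_zero by auto
next
  case (Cons i w)
  then obtain A where "shape (word w) (int (length w)) A" by auto
  from shape_add[OF shape_gen this] Cons show ?case by (auto simp: add.commute)
qed

lemma deg_word: "w \<in> lists {1..n} \<Longrightarrow> deg (word w) = int (length w)"
  using shape_word shape_deg by blast

lemma residue_prod_none:
  "(\<And>k. k < length w \<Longrightarrow> \<not> int l dvd a + int k) \<Longrightarrow> residue_prod w a = id"
  by (induction w) (auto simp: if_dvd_def)

lemma dvd_window:
  assumes "int l dvd a + int k" "int l dvd a + int k'" "k < l" "k' < l"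
  shows "k = k'"
proof -
  have "int l dvd int k - int k'" using dvd_diff[OF assms(1,2)] by simp
  moreover have "\<bar>int k - int k'\<bar> < int l" using assms(3,4) by linarith
  ultimately show ?thesis using dvd_imp_le_int[of "int k - int k'" "int l"] by fastforce
qed

lemma residue_prod_single:
  assumes "k < length w" "length w \<le> l" "int l dvd a + int k"
  shows "residue_prod w a = elt (w ! (length w - 1 - k))"
  using assms
proof (induction w)
  case Nil
  then show ?case by simp
next
  case (Cons i w)
  show ?case
  proof (cases "k = length w")
    case True
    have "residue_prod w a = id"
    proof (rule residue_prod_none)
      fix k' assume "k' < length w"
      then show "\<not> int l dvd a + int k'"
        using dvd_window[of a k k'] Cons.prems True by auto
    qed
    then show ?thesis using True Cons.prems by (simp add: if_dvd_def)
  next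
    case False
    then have "k < length w" using Cons.prems by simp
    moreover have "\<not> int l dvd a + int (length w)"
      using False dvd_window[of a k "length w"] Cons.prems by auto
    moreover have "(i # w) ! (length (i # w) - 1 - k) = w ! (length w - 1 - k)"
      using \<open>k < length w\<close> by (simp add: nth_Cons' One_nat_def)
    ultimately show ?thesis using Cons.IH Cons.prems by (simp add: if_dvd_def)
  qed
qed

lemma residue_prod_map:
  assumes w: "w \<in> lists {1..n}" "length w = l" and s: "\<sigma> \<in> H"
  shows "residue_prod (map \<sigma> w) a = \<sigma> \<circ> residue_prod w a"
proof -
  define k where "k = nat ((- a) mod int l)"
  have k: "k < length w" "int l dvd a + int k"
    using l_pos w(2) by (simp_all add: k_def nat_less_iff) (simp add: dvd_eq_mod_eq_0 mod_add_right_eq)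
  let ?j = "length w - 1 - k"
  have "w ! ?j \<in> {1..n}" using w(1) k(1) by (auto simp: in_lists_conv_set)
  then show ?thesis
    using residue_prod_single[of k w a] residue_prod_single[of k "map \<sigma> w" a] k w(2) s
    by (simp add: elt_apply)
qed

lemma map_mem_lists: "w \<in> lists {1..n} \<Longrightarrow> \<sigma> \<in> H \<Longrightarrow> map \<sigma> w \<in> lists {1..n}"
  using H_mem by (force simp: in_lists_conv_set)

text \<open>The defining relations hold in the model: \<open>l\<close> consecutive positions meet each residue class exactly
  once, so \<open>\<sigma>\<close> enters once through \<open>a\<close> and once, inverted, through \<open>b\<close>.\<close>

lemma word_map:
  assumes w: "w \<in> lists {1..n}" "length w = l" and s: "\<sigma> \<in> H"
  shows "word (map \<sigma> w) = word w"
proof (rule sym_eqI)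
  fix x :: "int \<times> int \<times> nat"
  obtain a b p where x: "x = (a, b, p)" by (cases x)
  have m: "residue_prod w a \<in> H" "residue_prod w b \<in> H" "finv (residue_prod w b) \<in> H" "finv \<sigma> \<in> H"
    using w s by (simp_all add: residue_prod_mem H_inv)
  have "finv (\<sigma> \<circ> residue_prod w b) = finv (residue_prod w b) \<circ> finv \<sigma>"
    using m s by (simp add: o_inv_distrib H_bij)
  moreover have "\<sigma> (residue_prod w a (finv (residue_prod w b) (finv \<sigma> p)))
      = residue_prod w a (finv (residue_prod w b) p)"
    using m s by (simp add: H_commute[of \<sigma>] H_bij bij_is_surj surj_f_inv_f)
  ultimately show "act (word (map \<sigma> w)) x = act (word w) x"
    using w s by (simp add: x act_word map_mem_lists residue_prod_map)
qed

text \<open>A word of fewer than \<open>l\<close> letters leaves a residue class empty. With the second index in that class,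
  the action on the third component reads off the letters one at a time.\<close>

lemma word_inj_short:
  assumes u: "u \<in> lists {1..n}" and v: "v \<in> lists {1..n}"
    and len: "length u = length v" "length u < l" and eq: "word u = word v"
  shows "u = v"
proof (rule nth_equalityI[OF len(1)])
  fix j assume j: "j < length u"
  define k where "k = length u - 1 - j"
  have k: "k < length u" "length u - 1 - k = j" using j by (auto simp: k_def)
  have none: "residue_prod w 1 = id" if "length w = length u" for w
  proof (rule residue_prod_none)
    fix k' assume "k' < length w"
    then have "0 < 1 + int k'" "1 + int k' < int l" using len that by auto
    then show "\<not> int l dvd 1 + int k'" using zdvd_not_zless by blast
  qed
  have "act (word u) (- int k, 1, 1) = act (word v) (- int k, 1, 1)" using eq by simp
  then have "elt (u ! j) 1 = elt (v ! j) 1"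
    using k len residue_prod_single[of k u "- int k"] residue_prod_single[of k v "- int k"]
    by (simp add: act_word u v none inv_id)
  moreover have "u ! j \<in> {1..n}" "v ! j \<in> {1..n}" using u v j len by (auto simp: in_lists_conv_set)
  ultimately show "u ! j = v ! j" by (simp add: elt)
qed

abbreviation cong :: "(nat list \<times> nat list) set" where
  "cong \<equiv> presentation_cong {1..n} (S_relations n l H)"

lemma cong_sound: "(u, v) \<in> cong \<Longrightarrow> u \<in> lists {1..n} \<and> v \<in> lists {1..n} \<and> word u = word v"
proof (induction rule: presentation_cong.induct)
  case (rel u v)
  then show ?case using word_map by (fastforce simp: S_relations_def)
qed auto

text \<open>As long as there are \<open>l\<close> letters left, a relation turns the first of them into \<open>1\<close>.\<close>

lemma cong_normal_form:
  assumes "w \<in> lists {1..n}" "length w \<ge> l"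
  shows "\<exists>v\<in>lists {1..n}. length v = l - 1 \<and> (w, replicate (length w - (l - 1)) 1 @ v) \<in> cong"
  using assms
proof (induction "length w" arbitrary: w rule: less_induct)
  case less
  obtain a w' where w: "w = a # w'" using less.prems l_pos by (cases w) auto
  have a: "a \<in> {1..n}" using less.prems w by simp
  define \<sigma> where "\<sigma> = finv (elt a)"
  have s: "\<sigma> \<in> H" using a by (simp add: \<sigma>_def elt H_inv)
  have sa: "\<sigma> a = 1"
    using elt[OF a] unfolding \<sigma>_def by (metis H_bij bij_is_inj inv_f_f)
  have tk: "take l w \<in> lists {1..n}" "length (take l w) = l" "drop l w \<in> lists {1..n}"
    using less.prems by (auto simp: in_lists_conv_set dest: in_set_takeD in_set_dropD)
  define w'' where "w'' = map \<sigma> (take (l - 1) w') @ drop (l - 1) w'"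
  obtain l' where l': "l = Suc l'" using l_pos by (cases l) auto
  have "(take l w, map \<sigma> (take l w)) \<in> cong"
    using tk s by (intro presentation_cong.rel map_mem_lists) (auto simp: S_relations_def)
  then have "(take l w @ drop l w, map \<sigma> (take l w) @ drop l w) \<in> cong"
    using presentation_cong.refl[OF tk(3)] by (rule presentation_cong.append)
  moreover have "map \<sigma> (take l w) @ drop l w = 1 # w''"
    by (simp add: w w''_def l' sa)
  ultimately have step: "(w, 1 # w'') \<in> cong" by simp
  have w'': "w'' \<in> lists {1..n}" using cong_sound[OF step] by simp
  have len: "length w = Suc (length w'')" by (simp add: w w''_def)
  show ?case
  proof (cases "length w'' \<ge> l")
    case True
    then obtain v where v: "v \<in> lists {1..n}" "length v = l - 1"
      "(w'', replicate (length w'' - (l - 1)) 1 @ v) \<in> cong"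
      using less.hyps[of w''] len w'' by auto
    have "([1] @ w'', [1] @ (replicate (length w'' - (l - 1)) 1 @ v)) \<in> cong"
      using one_mem by (intro presentation_cong.append presentation_cong.refl v(3)) simp
    moreover have "[1] @ (replicate (length w'' - (l - 1)) 1 @ v) = replicate (length w - (l - 1)) 1 @ v"
      using True len by (simp add: Suc_diff_le)
    ultimately show ?thesis
      using step v(1,2) by (metis append_Cons append_Nil presentation_cong.trans)
  next
    case False
    then have "length w'' = l - 1" using less.prems len by simp
    then show ?thesis using step w'' len l' by (intro bexI[of _ w'']) auto
  qed
qed

text \<open>Two normal forms of equal length with equal images differ only in their last \<open>l - 1\<close> letters, because
  the leading ones can be cancelled in the group; \<open>word_inj_short\<close> compares what remains.\<close>

lemma cong_iff:
  "(u, v) \<in> cong \<longleftrightarrow> u \<in> lists {1..n} \<and> v \<in> lists {1..n} \<and> word u = word v"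
proof
  assume uv: "u \<in> lists {1..n} \<and> v \<in> lists {1..n} \<and> word u = word v"
  then have len: "length u = length v" using deg_word by (metis of_nat_eq_iff)
  show "(u, v) \<in> cong"
  proof (cases "length u \<ge> l")
    case True
    let ?r = "replicate (length u - (l - 1)) (1::nat)"
    obtain u' where u': "u' \<in> lists {1..n}" "length u' = l - 1" "(u, ?r @ u') \<in> cong"
      using cong_normal_form True uv by blast
    obtain v' where v': "v' \<in> lists {1..n}" "length v' = l - 1" "(v, ?r @ v') \<in> cong"
      using cong_normal_form[of v] True uv len by auto
    have "word (?r @ u') = word (?r @ v')"
      using uv cong_sound[OF u'(3)] cong_sound[OF v'(3)] by simp
    then have "u' = v'" using u' v' l_pos by (intro word_inj_short) simp_all
    then show ?thesis using u'(3) v'(3) presentation_cong.sym presentation_cong.trans by metis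
  next
    case False
    then have "u = v" using uv len by (intro word_inj_short) auto
    then show ?thesis using uv by (auto intro: presentation_cong.refl)
  qed
qed (rule cong_sound)

section \<open>The group of fractions in the model\<close>

definition zeta :: "(int \<times> int \<times> nat) sym" where
  "zeta = nmult l (gen 1)"

definition words :: "(int \<times> int \<times> nat) sym set" where
  "words = word ` lists {1..n}"

definition fracs :: "(int \<times> int \<times> nat) sym set" where
  "fracs = {s - nmult k zeta | s k. s \<in> words}"

text \<open>The relation \<open>x\<^sub>1\<^sup>l = x\<^sub>i\<^sup>l\<close>, obtained from the permutation that takes 1 to \<open>i\<close>.\<close>

lemma nmult_gen: assumes "i \<in> {1..n}" shows "nmult l (gen i) = zeta"
proof -
  have "map (elt i) (replicate l 1) = replicate l i" using assms by (simp add: elt map_replicate)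
  moreover have "replicate l 1 \<in> lists {1..n}" using one_mem by (simp add: in_lists_conv_set)
  ultimately have "word (replicate l i) = word (replicate l 1)"
    using word_map[of "replicate l 1" "elt i"] assms by (simp add: elt)
  then show ?thesis by (simp add: word_replicate zeta_def)
qed

lemma shape_zeta: "shape zeta (int l) (\<lambda>_ _. id)"
proof -
  have "shape (nmult k (gen 1)) (int k) (\<lambda>_ _. id)" for k
  proof (induction k)
    case 0
    show ?case unfolding nmult_simps of_nat_0 by (rule shape_zero)
  next
    case (Suc k)
    have "(\<lambda>a b. if_dvd a (elt 1) \<circ> if_dvd b (finv (elt 1))) = (\<lambda>_ _. id)"
      by (simp add: elt_one if_dvd_def inv_id)
    then have "shape (gen 1) 1 (\<lambda>_ _. id)"
      using shape_gen[OF one_mem] by (simp only:)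
    from shape_add[OF this Suc] show ?case
      unfolding nmult_simps of_nat_Suc comp_id by (simp only: add.commute)
  qed
  then show ?thesis by (simp add: zeta_def)
qed

lemma zeta_commute: assumes "shape g d A" shows "zeta + g = g + zeta"
proof (rule sym_eqI)
  fix x :: "int \<times> int \<times> nat"
  obtain a b p where x: "x = (a, b, p)" by (cases x)
  show "act (zeta + g) x = act (g + zeta) x"
    using assms shape_zeta by (simp add: x shape_def)
qed

lemma shape_zero_commute: assumes "shape g 0 A" "shape h 0 B" shows "g + h = h + g"
proof (rule sym_eqI)
  fix x :: "int \<times> int \<times> nat"
  obtain a b p where x: "x = (a, b, p)" by (cases x)
  show "act (g + h) x = act (h + g) x"
    using assms by (simp add: x shape_def H_commute)
qed

lemma shape_zero_exponent: assumes "shape g 0 A" shows "nmult (card H) g = 0"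
proof (rule sym_eqI)
  fix x :: "int \<times> int \<times> nat"
  obtain a b p where x: "x = (a, b, p)" by (cases x)
  have "act (nmult k g) (a, b, p) = (a, b, (A a b ^^ k) p)" for k
    by (induction k) (use assms in \<open>simp_all add: shape_def\<close>)
  then show "act (nmult (card H) g) x = act 0 x"
    using assms by (simp add: x shape_def H_funpow)
qed

lemma words_zero: "0 \<in> words"
  unfolding words_def by (rule image_eqI[of _ _ "[]"]) simp_all

lemma words_add:
  assumes "s \<in> words" "t \<in> words"
  shows "s + t \<in> words"
proof -
  obtain u v where "u \<in> lists {1..n}" "s = word u" "v \<in> lists {1..n}" "t = word v"
    using assms by (auto simp: words_def)
  then have "s + t = word (u @ v)" "u @ v \<in> lists {1..n}" by simp_all
  then show ?thesis unfolding words_def by (rule image_eqI)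
qed

lemma words_nmult: "s \<in> words \<Longrightarrow> nmult k s \<in> words"
  by (induction k) (simp_all add: words_zero words_add)

lemma words_gen: "i \<in> {1..n} \<Longrightarrow> gen i \<in> words"
  unfolding words_def by (rule image_eqI[of _ _ "[i]"]) simp_all

lemma words_zeta: "zeta \<in> words"
  unfolding zeta_def by (intro words_nmult words_gen one_mem)

lemma words_shape: "s \<in> words \<Longrightarrow> \<exists>d A. shape s d A"
  unfolding words_def using shape_word by blast

lemma words_zeta_commute: assumes "s \<in> words" shows "nmult k zeta + s = s + nmult k zeta"
proof -
  obtain d A where "shape s d A" using words_shape[OF assms] by blast
  then show ?thesis by (intro nmult_commute zeta_commute)
qed

lemma fracs_shape: assumes "g \<in> fracs" shows "\<exists>d A. shape g d A"
proof -
  obtain s k where g: "g = s - nmult k zeta" and s: "s \<in> words"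
    using assms unfolding fracs_def by blast
  obtain d A where 1: "shape s d A" using words_shape s by blast
  obtain e B where 2: "shape (nmult k zeta) e B" using words_shape words_nmult words_zeta by blast
  show ?thesis unfolding g diff_conv_add_uminus using shape_add[OF 1 shape_uminus[OF 2]] by blast
qed

lemma words_fracs: "s \<in> words \<Longrightarrow> s \<in> fracs"
  unfolding fracs_def by (intro CollectI exI[of _ s] exI[of _ 0]) simp

lemma fracs_zeta_commute: "g \<in> fracs \<Longrightarrow> zeta + g = g + zeta"
  using fracs_shape zeta_commute by blast

lemma fracs_add: assumes "g \<in> fracs" "h \<in> fracs" shows "g + h \<in> fracs"
proof -
  obtain s k where g: "g = s - nmult k zeta" and s: "s \<in> words"
    using assms(1) unfolding fracs_def by blast
  obtain t j where h: "h = t - nmult j zeta" and t: "t \<in> words"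
    using assms(2) unfolding fracs_def by blast
  let ?k = "nmult k zeta" and ?j = "nmult j zeta"
  have "g + h = s + (- ?k + t) - ?j" by (simp add: g h diff_conv_add_uminus add.assoc del: add_uminus_conv_diff)
  also have "- ?k + t = t - ?k" using words_zeta_commute[OF t] by (rule uminus_commute)
  also have "s + (t - ?k) - ?j = (s + t) - nmult (j + k) zeta"
    by (simp add: nmult_add minus_add diff_conv_add_uminus add.assoc del: add_uminus_conv_diff)
  finally show ?thesis unfolding fracs_def using words_add[OF s t] by blast
qed

text \<open>Up to the central element \<open>zeta\<close>, the inverse of \<open>x\<^sub>i\<close> is \<open>x\<^sub>i\<^sup>l\<^sup>-\<^sup>1\<close>.\<close>

lemma words_inverse: assumes "s \<in> words" shows "\<exists>t\<in>words. \<exists>k. t + s = nmult k zeta"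
proof -
  obtain w where w: "w \<in> lists {1..n}" "s = word w" using assms by (auto simp: words_def)
  have "\<exists>t\<in>words. t + word w = nmult (length w) zeta"
    using w(1)
  proof (induction w)
    case Nil
    then show ?case using words_zero by auto
  next
    case (Cons i w)
    then obtain t where t: "t \<in> words" "t + word w = nmult (length w) zeta" by auto
    have i: "i \<in> {1..n}" by (fact Cons.hyps)
    let ?t = "t + nmult (l - 1) (gen i)"
    have "nmult (l - 1) (gen i) + gen i = nmult (l - 1 + 1) (gen i)" by (simp only: nmult_add One_nat_def nmult_simps add_0_right)
    then have z: "nmult (l - 1) (gen i) + gen i = zeta" using nmult_gen[OF i] l_pos by simp
    have zt: "zeta + t = t + zeta"
      using words_zeta_commute[OF t(1), of 1] by (simp add: One_nat_def)
    have "?t + word (i # w) = t + (nmult (l - 1) (gen i) + gen i) + word w"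
      by (simp add: add.assoc)
    also have "\<dots> = zeta + (t + word w)"
      unfolding z by (simp only: zt add.assoc[symmetric])
    finally have "?t + word (i # w) = nmult (length (i # w)) zeta" using t(2) by simp
    moreover have "?t \<in> words" using t(1) i by (intro words_add words_nmult words_gen)
    ultimately show ?case by blast
  qed
  then show ?thesis using w by blast
qed

lemma fracs_uminus: assumes "g \<in> fracs" shows "- g \<in> fracs"
proof -
  obtain s k where g: "g = s - nmult k zeta" and s: "s \<in> words"
    using assms unfolding fracs_def by blast
  obtain t j where t: "t \<in> words" "t + s = nmult j zeta" using words_inverse s by blast
  have "- s = - (t + s) + t" by (simp add: minus_add add.assoc)
  also have "\<dots> = t - nmult j zeta"
    unfolding t(2) using words_zeta_commute[OF t(1)] by (rule uminus_commute)
  finally have "- s \<in> fracs" unfolding fracs_def using t(1) by blast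
  moreover have "nmult k zeta \<in> fracs" by (intro words_fracs words_nmult words_zeta)
  moreover have "- g = nmult k zeta + - s" by (simp add: g)
  ultimately show ?thesis using fracs_add[of "nmult k zeta" "- s"] by simp
qed

lemma deg_add: assumes "g \<in> fracs" "h \<in> fracs" shows "deg (g + h) = deg g + deg h"
proof -
  obtain d A e B where "shape g d A" "shape h e B"
    using fracs_shape[OF assms(1)] fracs_shape[OF assms(2)] by blast
  then show ?thesis using shape_deg[OF shape_add] shape_deg by simp
qed

lemma deg_zeta: "deg zeta = int l"
  using shape_zeta shape_deg by blast

lemma deg_nmult: "g \<in> fracs \<Longrightarrow> deg (nmult k g) = int k * deg g \<and> nmult k g \<in> fracs"
  by (induction k) (use shape_zero shape_deg in \<open>auto simp: deg_add fracs_add words_fracs words_zero algebra_simps\<close>)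

lemma deg_zero_shape: "g \<in> fracs \<Longrightarrow> deg g = 0 \<Longrightarrow> \<exists>A. shape g 0 A"
  using fracs_shape shape_deg by metis

text \<open>The normal form of a word of length at least \<open>l + k l\<close> starts with \<open>k l\<close> letters \<open>1\<close>, which absorb
  the denominator \<open>x\<^sub>1\<^sup>k\<^sup>l\<close>.\<close>

lemma high_degree_words: assumes "g \<in> fracs" "deg g \<ge> int l"
  shows "\<exists>w\<in>lists {1..n}. g = word w \<and> deg g = int (length w)"
proof -
  obtain w k where w: "w \<in> lists {1..n}" and g: "g = word w - nmult k zeta"
    using assms(1) unfolding fracs_def words_def by blast
  have wf: "word w \<in> fracs" and zf: "nmult k zeta \<in> fracs"
    using w words_fracs words_nmult words_zeta by (auto simp: words_def)
  have "word w = g + nmult k zeta" by (simp add: g)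
  then have d: "int (length w) = deg g + int (k * l)"
    using deg_add[OF assms(1) zf] deg_word[OF w] deg_nmult[of zeta k] words_fracs[OF words_zeta]
    by (simp add: deg_zeta)
  then have len: "length w \<ge> l + k * l" using assms(2) by linarith
  then obtain v where v: "v \<in> lists {1..n}" "length v = l - 1"
    "(w, replicate (length w - (l - 1)) 1 @ v) \<in> cong"
    using cong_normal_form[OF w] by auto
  define m where "m = length w - (l - 1) - k * l"
  have m: "length w - (l - 1) = k * l + m" using len l_pos by (simp add: m_def)
  have "word w = nmult (k * l + m) (gen 1) + word v"
    using cong_sound[OF v(3)] by (simp add: word_replicate m)
  also have "\<dots> = nmult k zeta + word (replicate m 1 @ v)"
    by (simp add: nmult_add nmult_mult zeta_def word_replicate add.assoc)
  also have "\<dots> = word (replicate m 1 @ v) + nmult k zeta"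
    using v(1) one_mem
    by (intro words_zeta_commute) (auto simp: words_def in_lists_conv_set simp del: word_simps intro!: imageI)
  finally have eq: "g = word (replicate m 1 @ v)" by (simp add: g)
  moreover have "replicate m 1 @ v \<in> lists {1..n}" using v(1) one_mem by (auto simp: in_lists_conv_set)
  ultimately show ?thesis using deg_word by metis
qed

text \<open>Adding \<open>zeta\<close> takes elements of degree 0 to images of words of length \<open>l\<close>.\<close>

lemma finite_deg_zero: "finite {g \<in> fracs. deg g = 0}"
proof (rule finite_subset)
  show "{g \<in> fracs. deg g = 0} \<subseteq> (\<lambda>w. word w - zeta) ` {w. set w \<subseteq> {1..n} \<and> length w = l}"
  proof
    fix g assume "g \<in> {g \<in> fracs. deg g = 0}"
    then have g: "g \<in> fracs" "deg g = 0" by auto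
    have "g + zeta \<in> fracs" "deg (g + zeta) = int l"
      using g by (simp_all add: fracs_add words_fracs words_zeta deg_add deg_zeta)
    then obtain w where "w \<in> lists {1..n}" "g + zeta = word w" "length w = l"
      using high_degree_words[of "g + zeta"] by auto
    moreover from this have "g = word w - zeta" by (metis add_diff_cancel)
    ultimately show "g \<in> (\<lambda>w. word w - zeta) ` {w. set w \<subseteq> {1..n} \<and> length w = l}"
      by (auto simp: in_lists_conv_set)
  qed
  show "finite ((\<lambda>w. word w - zeta) ` {w. set w \<subseteq> {1..n} \<and> length w = l})"
    using finite_lists_length_eq[of "{1..n}" l] by (intro finite_imageI) simp
qed

end

section \<open>Group algebras inside a ring type\<close>

abbreviation keys where "keys \<equiv> Poly_Mapping.keys"
abbreviation lookup where "lookup \<equiv> Poly_Mapping.lookup"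
abbreviation single where "single \<equiv> Poly_Mapping.single"

definition alg :: "'g set \<Rightarrow> ('g \<Rightarrow>\<^sub>0 'k::zero) set" where
  "alg A = {f. keys f \<subseteq> A}"

abbreviation delta :: "'g \<Rightarrow> 'g \<Rightarrow>\<^sub>0 'k::zero_neq_one" where
  "delta g \<equiv> single g 1"

lemma alg_zero [simp]: "0 \<in> alg A"
  by (simp add: alg_def)

lemma alg_add: "f \<in> alg A \<Longrightarrow> g \<in> alg A \<Longrightarrow> f + g \<in> alg A"
  using Poly_Mapping.keys_add[of f g] by (auto simp: alg_def)

lemma alg_uminus: "f \<in> alg A \<Longrightarrow> - (f :: 'g \<Rightarrow>\<^sub>0 'k::ab_group_add) \<in> alg A"
  by (auto simp: alg_def in_keys_iff)

lemma alg_minus: "f \<in> alg A \<Longrightarrow> g \<in> alg A \<Longrightarrow> (f :: 'g \<Rightarrow>\<^sub>0 'k::ab_group_add) - g \<in> alg A"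
  using alg_add[of f A "- g"] alg_uminus[of g A] by simp

lemma alg_sum: "(\<And>i. i \<in> I \<Longrightarrow> f i \<in> alg A) \<Longrightarrow> sum f I \<in> alg A"
  by (induction I rule: infinite_finite_induct) (auto simp: alg_add)

lemma alg_single: "a \<in> A \<Longrightarrow> single a c \<in> alg A"
  by (simp add: alg_def)

lemma alg_mono: "A \<subseteq> B \<Longrightarrow> f \<in> alg A \<Longrightarrow> f \<in> alg B"
  by (auto simp: alg_def)

lemma alg_mult:
  assumes "f \<in> alg A" "g \<in> alg B" "\<And>a b. a \<in> A \<Longrightarrow> b \<in> B \<Longrightarrow> a + b \<in> C"
  shows "f * g \<in> alg C"
proof -
  have "keys (f * g) \<subseteq> {a + b | a b. a \<in> keys f \<and> b \<in> keys g}" by (rule Poly_Mapping.keys_mult)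
  also have "\<dots> \<subseteq> C" using assms by (auto simp: alg_def)
  finally show ?thesis by (simp add: alg_def)
qed

lemma sum_single:
  fixes f :: "'g \<Rightarrow>\<^sub>0 'k::comm_monoid_add"
  shows "f = (\<Sum>a\<in>keys f. single a (lookup f a))"
proof (rule poly_mapping_eqI)
  fix x
  have "lookup (\<Sum>a\<in>keys f. single a (lookup f a)) x = (\<Sum>a\<in>keys f. if a = x then lookup f a else 0)"
    by (simp add: lookup_sum lookup_single when_def)
  also have "\<dots> = lookup f x" by (simp add: in_keys_iff)
  finally show "lookup f x = lookup (\<Sum>a\<in>keys f. single a (lookup f a)) x" by simp
qed

lemma alg_induct [consumes 1, case_names zero add]:
  fixes f :: "'g \<Rightarrow>\<^sub>0 'k::comm_monoid_add"
  assumes "f \<in> alg A" "P 0" "\<And>a c p. a \<in> A \<Longrightarrow> p \<in> alg A \<Longrightarrow> P p \<Longrightarrow> P (single a c + p)"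
  shows "P f"
proof -
  have "P (\<Sum>a\<in>I. single a (lookup f a)) \<and> (\<Sum>a\<in>I. single a (lookup f a)) \<in> alg A"
    if "finite I" "I \<subseteq> A" for I
    using that by (induction I) (auto simp: assms alg_add alg_single)
  then have "P (\<Sum>a\<in>keys f. single a (lookup f a))" using assms(1) by (simp add: alg_def)
  then show ?thesis using sum_single by metis
qed

lemma single_zero_commute: "single 0 c * f = f * single 0 c"
  for f :: "'g::monoid_add \<Rightarrow>\<^sub>0 'k::comm_ring_1"
proof -
  have "f \<in> alg UNIV" by (simp add: alg_def)
  then show ?thesis
    by (induction rule: alg_induct) (simp_all add: distrib_left distrib_right mult_single mult.commute)
qed

lemma single_split: "single g c = single 0 c * (delta g :: 'g::monoid_add \<Rightarrow>\<^sub>0 'k::comm_ring_1)"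
  by (simp add: mult_single)

lemma delta_mult: "delta g * (delta h :: 'g::monoid_add \<Rightarrow>\<^sub>0 'k::comm_ring_1) = delta (g + h)"
  by (simp add: mult_single)

lemma delta_cancel:
  "(delta g * (delta (- g) * f) :: 'g::group_add \<Rightarrow>\<^sub>0 'k::comm_ring_1) = f"
  "delta (- g) * (delta g * f) = f"
  by (simp_all add: mult.assoc[symmetric] delta_mult)

lemma lookup_delta_left: "lookup (delta g * f) x = lookup f (- g + x)"
  for f :: "'g::group_add \<Rightarrow>\<^sub>0 'k::comm_ring_1"
proof -
  have eq: "g + a = x \<longleftrightarrow> a = - g + x" for a by (metis add_minus_cancel minus_add_cancel)
  have "f \<in> alg UNIV" by (simp add: alg_def)
  then show ?thesis
    by (induction rule: alg_induct)
      (simp_all add: distrib_left mult_single lookup_add lookup_single when_def eq)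
qed

lemma lookup_delta_right: "lookup (f * delta g) x = lookup f (x - g)"
  for f :: "'g::group_add \<Rightarrow>\<^sub>0 'k::comm_ring_1"
proof -
  have eq: "a + g = x \<longleftrightarrow> a = x - g" for a by (simp add: eq_diff_eq)
  have "f \<in> alg UNIV" by (simp add: alg_def)
  then show ?thesis
    by (induction rule: alg_induct)
      (simp_all add: distrib_right mult_single lookup_add lookup_single when_def eq)
qed

definition part :: "'g set \<Rightarrow> ('g \<Rightarrow>\<^sub>0 'k::comm_monoid_add) \<Rightarrow> 'g \<Rightarrow>\<^sub>0 'k" where
  "part A f = (\<Sum>a\<in>keys f \<inter> A. single a (lookup f a))"

lemma lookup_part: "lookup (part A f) x = (if x \<in> A then lookup f x else 0)"
proof -
  have "lookup (part A f) x = (\<Sum>a\<in>keys f \<inter> A. if a = x then lookup f a else 0)"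
    by (simp add: part_def lookup_sum lookup_single when_def)
  also have "\<dots> = (if x \<in> A then lookup f x else 0)" by (simp add: in_keys_iff)
  finally show ?thesis .
qed

lemma part_add: "part A (f + g) = part A f + part A g"
  by (rule poly_mapping_eqI) (simp add: lookup_part lookup_add)

lemma part_zero [simp]: "part A 0 = 0"
  by (rule poly_mapping_eqI) (simp add: lookup_part)

lemma part_alg: "f \<in> alg B \<Longrightarrow> part A f \<in> alg (A \<inter> B)"
  by (auto simp: alg_def in_keys_iff lookup_part split: if_splits)

lemma part_eq: "f \<in> alg B \<Longrightarrow> B \<subseteq> A \<Longrightarrow> part A f = f"
  by (rule poly_mapping_eqI) (auto simp: alg_def in_keys_iff lookup_part)

lemma part_eq_zero: "f \<in> alg B \<Longrightarrow> B \<inter> A = {} \<Longrightarrow> part A f = 0"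
  by (rule poly_mapping_eqI) (auto simp: alg_def in_keys_iff lookup_part)

section \<open>Commuting nilpotent elements\<close>

lemma power_mult_commute:
  fixes a b :: "'a::monoid_mult"
  assumes "a * b = b * a"
  shows "(a * b) ^ m = a ^ m * b ^ m"
proof (induction m)
  case (Suc m)
  have b: "b * a ^ m = a ^ m * b" using power_commuting_commutes[OF assms, of m] by simp
  have "(a * b) ^ Suc m = a * (b * a ^ m) * b ^ m" by (simp add: Suc mult.assoc)
  also have "\<dots> = a ^ Suc m * b ^ Suc m" unfolding b by (simp add: mult.assoc)
  finally show ?case .
qed simp

lemma nilpotent_add:
  fixes a b :: "'a::ring_1"
  assumes ab: "a * b = b * a" and "a ^ p = 0" "b ^ q = 0"
  shows "(a + b) ^ (p + q) = 0"
proof -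
  have zero: "x ^ r = 0" if "x ^ p = 0" "p \<le> r" for x :: 'a and p r :: nat
    using that by (metis le_add_diff_inverse mult_zero_left power_add)
  \<comment> \<open>Each factor \<open>a + b\<close> that is multiplied out raises one of the exponents \<open>r\<close>, \<open>s\<close> by one.\<close>
  have "a ^ r * b ^ s * (a + b) ^ m = 0" if "r + s + m \<ge> p + q" for r s m
    using that
  proof (induction m arbitrary: r s)
    case 0
    then have "r \<ge> p \<or> s \<ge> q" by linarith
    then show ?case using zero assms by auto
  next
    case (Suc m)
    have "b ^ s * a = a * b ^ s" using power_commuting_commutes[of b a s] ab by simp
    then have "a ^ r * b ^ s * (a + b) = a ^ Suc r * b ^ s + a ^ r * b ^ Suc s"
      by (simp add: distrib_left mult.assoc power_Suc2 del: power_Suc)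
    moreover have "a ^ r * b ^ s * (a + b) ^ Suc m = a ^ r * b ^ s * (a + b) * (a + b) ^ m"
      by (simp add: mult.assoc)
    ultimately have "a ^ r * b ^ s * (a + b) ^ Suc m
        = a ^ Suc r * b ^ s * (a + b) ^ m + a ^ r * b ^ Suc s * (a + b) ^ m"
      by (simp add: distrib_right del: power_Suc)
    also have "\<dots> = 0" using Suc.IH[of "Suc r" s] Suc.IH[of r "Suc s"] Suc.prems by simp
    finally show ?case .
  qed
  from this[of 0 0 "p + q"] show ?thesis by simp
qed

lemma prod_list_extract:
  fixes b :: "'a::monoid_mult"
  assumes "\<And>x. x \<in> set xs \<Longrightarrow> x * b = b * x"
  shows "prod_list xs = b ^ count_list xs b * prod_list (filter (\<lambda>x. x \<noteq> b) xs)"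
  using assms
proof (induction xs)
  case (Cons x xs)
  have "x * b ^ k = b ^ k * x" for k
    using power_commuting_commutes[of b x k] Cons.prems[of x] by simp
  then show ?case using Cons by (simp add: mult.assoc[symmetric] power_commutes)
qed simp

text \<open>Pigeonhole: some \<open>b\<close> occurs at least \<open>k b\<close> times, and its occurrences can be collected.\<close>

lemma prod_list_commuting_nilpotents:
  fixes B :: "'a::ring_1 set"
  assumes B: "finite B" and comm: "\<And>x y. x \<in> B \<Longrightarrow> y \<in> B \<Longrightarrow> x * y = y * x"
    and nil: "\<And>b. b \<in> B \<Longrightarrow> b ^ k b = 0"
    and xs: "set xs \<subseteq> B" "length xs > (\<Sum>b\<in>B. k b)"
  shows "prod_list xs = 0"
proof -
  have "(\<Sum>b\<in>B. count_list xs b) = length xs" using xs(1) B by (rule sum_count_set)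
  then have "\<not> (\<forall>b\<in>B. count_list xs b \<le> k b)"
    using xs(2) sum_mono[of B "count_list xs" k] by auto
  then obtain b where b: "b \<in> B" "count_list xs b \<ge> k b" by (auto simp: not_le intro: less_imp_le)
  then have "b ^ count_list xs b = 0"
    using nil by (metis le_add_diff_inverse mult_zero_left power_add)
  then show ?thesis using prod_list_extract[of xs b] comm b xs(1) by auto
qed

section \<open>Group algebras of groups with a degree\<close>

text \<open>
  The properties of \<open>G\<close> on which the radical computation rests: it is an extension of a finite abelian
  group by a group of integers, and it has a central element of positive degree. The conjugation
  action on the elements of degree 0 therefore factors through a finite cyclic group.
\<close>

locale graded_group =
  fixes Gr :: "'g::group_add set" and dg :: "'g \<Rightarrow> int" and z :: 'g and l :: nat
  assumes Gr_zero: "0 \<in> Gr" and Gr_add: "g \<in> Gr \<Longrightarrow> h \<in> Gr \<Longrightarrow> g + h \<in> Gr"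
    and Gr_uminus: "g \<in> Gr \<Longrightarrow> - g \<in> Gr"
    and dg_add: "g \<in> Gr \<Longrightarrow> h \<in> Gr \<Longrightarrow> dg (g + h) = dg g + dg h"
    and z_mem: "z \<in> Gr" and dg_z: "dg z = int l" and l_pos: "l \<ge> 1"
    and z_central: "g \<in> Gr \<Longrightarrow> z + g = g + z"
    and finite_tors: "finite {g \<in> Gr. dg g = 0}"
    and tors_commute: "g \<in> Gr \<Longrightarrow> h \<in> Gr \<Longrightarrow> dg g = 0 \<Longrightarrow> dg h = 0 \<Longrightarrow> g + h = h + g"
begin

definition T :: "'g set" where "T = {g \<in> Gr. dg g = 0}"

lemma dg_zero: "dg 0 = 0"
  using dg_add[OF Gr_zero Gr_zero] by simp

lemma dg_uminus: "g \<in> Gr \<Longrightarrow> dg (- g) = - dg g"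
  using dg_add[of g "- g"] Gr_uminus dg_zero by simp

lemma T_sub: "T \<subseteq> Gr" by (auto simp: T_def)

lemma T_finite: "finite T" using finite_tors by (simp add: T_def)

lemma T_zero: "0 \<in> T" by (simp add: T_def Gr_zero dg_zero)

lemma T_add: "g \<in> T \<Longrightarrow> h \<in> T \<Longrightarrow> g + h \<in> T" by (simp add: T_def Gr_add dg_add)

lemma T_uminus: "g \<in> T \<Longrightarrow> - g \<in> T" by (simp add: T_def Gr_uminus dg_uminus)

lemma T_conj: "t \<in> T \<Longrightarrow> g \<in> Gr \<Longrightarrow> - g + t + g \<in> T"
  by (simp add: T_def Gr_uminus Gr_add dg_add dg_uminus)

definition degs :: "int set \<Rightarrow> 'g set" where
  "degs D = {g \<in> Gr. dg g \<in> D}"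

lemma T_degs: "T = degs {0}" by (simp add: T_def degs_def)

lemma alg_degs_mult:
  assumes "f \<in> alg (degs D)" "h \<in> alg (degs E)" "\<And>i j. i \<in> D \<Longrightarrow> j \<in> E \<Longrightarrow> i + j \<in> F"
  shows "f * h \<in> alg (degs F)"
  using assms(1,2) by (rule alg_mult) (auto simp: degs_def Gr_add dg_add assms(3))

lemma alg_degs_mono: "f \<in> alg (degs D) \<Longrightarrow> D \<subseteq> E \<Longrightarrow> f \<in> alg (degs E)"
  by (auto simp: alg_def degs_def)

lemma alg_degs_G: "f \<in> alg (degs D) \<Longrightarrow> f \<in> alg Gr"
  by (auto simp: alg_def degs_def)

lemma alg_degs_single: "g \<in> Gr \<Longrightarrow> dg g \<in> D \<Longrightarrow> single g c \<in> alg (degs D)"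
  by (simp add: alg_single degs_def)

lemma algG_mult: "f \<in> alg Gr \<Longrightarrow> g \<in> alg Gr \<Longrightarrow> f * g \<in> alg Gr"
  by (rule alg_mult) (auto simp: Gr_add)

lemma algT_mult: "f \<in> alg T \<Longrightarrow> g \<in> alg T \<Longrightarrow> f * g \<in> alg T"
  by (rule alg_mult) (auto simp: T_add)

lemma algT_one: "(1 :: 'g \<Rightarrow>\<^sub>0 'k::comm_ring_1) \<in> alg T"
  using alg_single[OF T_zero, of "1::'k"] by simp

lemma algT_power: "(f :: 'g \<Rightarrow>\<^sub>0 'k::comm_ring_1) \<in> alg T \<Longrightarrow> f ^ m \<in> alg T"
  by (induction m) (auto simp: algT_one algT_mult)

lemma algT_G: "f \<in> alg T \<Longrightarrow> f \<in> alg Gr"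
  using alg_mono T_sub by blast

lemma algT_scalar: "single 0 c \<in> alg T"
  by (rule alg_single[OF T_zero])

lemma algT_commute:
  fixes a b :: "'g \<Rightarrow>\<^sub>0 'k::comm_ring_1"
  assumes "a \<in> alg T" "b \<in> alg T"
  shows "a * b = b * a"
  using assms(1)
proof (induction rule: alg_induct)
  case (add s c p)
  have "single s c * b = b * single s c"
    using assms(2)
  proof (induction rule: alg_induct)
    case (add t d q)
    have "s + t = t + s" using add(1) \<open>s \<in> T\<close> tors_commute by (auto simp: T_def)
    then show ?case using add by (simp add: distrib_left distrib_right mult_single mult.commute)
  qed simp
  then show ?case using add by (simp add: distrib_left distrib_right)
qed simp

definition conjg :: "'g \<Rightarrow> ('g \<Rightarrow>\<^sub>0 'k::comm_ring_1) \<Rightarrow> 'g \<Rightarrow>\<^sub>0 'k" where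
  "conjg g a = delta (- g) * a * delta g"

lemma conjg_mult: "conjg g (a * b) = conjg g a * conjg g b"
  by (simp add: conjg_def mult.assoc delta_cancel)

lemma conjg_one: "conjg g 1 = 1"
  by (simp add: conjg_def delta_mult)

lemma conjg_power: "conjg g (a ^ m) = conjg g a ^ m"
  by (induction m) (simp_all add: conjg_one conjg_mult)

lemma conjg_zero: "conjg g 0 = 0"
  by (simp add: conjg_def)

lemma conjg_alg: assumes "a \<in> alg T" "g \<in> Gr" shows "conjg g a \<in> alg T"
proof -
  have "delta (- g) * a \<in> alg {- g + t | t. t \<in> T}"
    by (rule alg_mult[OF alg_single[of _ "{- g}"] assms(1)]) auto
  then show ?thesis unfolding conjg_def
    by (rule alg_mult[OF _ alg_single[of _ "{g}"]]) (auto simp: T_conj assms(2))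
qed

lemma delta_conjg: "delta g * conjg g a = a * delta g"
  by (simp add: conjg_def mult.assoc delta_cancel)

lemma conjg_inj: "conjg g a = conjg g b \<Longrightarrow> a = b"
proof -
  assume "conjg g a = conjg g b"
  then have "a * delta g * delta (- g) = b * delta g * delta (- g)" by (simp flip: delta_conjg)
  then show ?thesis by (simp add: mult.assoc delta_mult)
qed

lemma lookup_conjg: "lookup (conjg g a) x = lookup a (g + (x - g))"
  by (simp add: conjg_def lookup_delta_left lookup_delta_right)

definition N :: "('g \<Rightarrow>\<^sub>0 'k::field) set" where
  "N = {a \<in> alg T. \<exists>m. a ^ m = 0}"

lemma N_zero: "0 \<in> N"
  by (auto simp: N_def intro: exI[of _ 1])

lemma N_add: "a \<in> N \<Longrightarrow> b \<in> N \<Longrightarrow> a + b \<in> N"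
  using nilpotent_add algT_commute by (fastforce simp: N_def alg_add)

lemma N_mult: assumes "a \<in> N" "b \<in> alg T" shows "a * b \<in> N" "b * a \<in> N"
proof -
  obtain m where a: "a \<in> alg T" "a ^ m = 0" using assms by (auto simp: N_def)
  have ab: "a * b = b * a" using a assms algT_commute by blast
  then have "(a * b) ^ m = 0" using a(2) by (simp add: power_mult_commute)
  then show "a * b \<in> N" using a assms by (auto simp: N_def algT_mult)
  then show "b * a \<in> N" using ab by simp
qed

lemma N_conj: assumes "a \<in> N" "g \<in> Gr" shows "conjg g a \<in> N"
proof -
  obtain m where a: "a \<in> alg T" "a ^ m = 0" using assms by (auto simp: N_def)
  then have "conjg g a ^ m = 0" by (simp add: conjg_zero flip: conjg_power)
  then show ?thesis using a assms conjg_alg by (auto simp: N_def)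
qed

lemma N_power: assumes "a ^ m \<in> N" "a \<in> alg T" shows "a \<in> N"
  using assms by (auto simp: N_def simp flip: power_mult)

text \<open>The right ideal \<open>U K[G]\<close>, provided that \<open>U \<subseteq> K[T]\<close> is closed under scalar multiplication; all
  scalars are taken from \<open>U\<close>.\<close>

inductive_set right_span :: "('g \<Rightarrow>\<^sub>0 'k::field) set \<Rightarrow> ('g \<Rightarrow>\<^sub>0 'k) set" for U where
  zero: "0 \<in> right_span U"
| add: "a \<in> U \<Longrightarrow> g \<in> Gr \<Longrightarrow> f \<in> right_span U \<Longrightarrow> a * delta g + f \<in> right_span U"

lemma right_span_single: "a \<in> U \<Longrightarrow> g \<in> Gr \<Longrightarrow> a * delta g \<in> right_span U"
  using right_span.add[of a U g 0] by (simp add: right_span.zero)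

lemma right_span_add: "f \<in> right_span U \<Longrightarrow> h \<in> right_span U \<Longrightarrow> f + h \<in> right_span U"
  by (induction rule: right_span.induct) (auto simp: add.assoc intro: right_span.add)

lemma right_span_sum: "(\<And>i. i \<in> I \<Longrightarrow> f i \<in> right_span U) \<Longrightarrow> sum f I \<in> right_span U"
  by (induction I rule: infinite_finite_induct) (auto simp: right_span_add right_span.zero)

lemma right_span_alg: assumes "f \<in> right_span U" "U \<subseteq> alg T" shows "f \<in> alg Gr"
  using assms(1)
proof (induction rule: right_span.induct)
  case (add a g f)
  then have "a \<in> alg Gr" using assms(2) algT_G by blast
  then show ?case using add by (intro alg_add algG_mult alg_single) auto
qed simp

text \<open>The ideal \<open>N K[G]\<close> is two-sided because conjugation by group elements preserves \<open>N\<close>.\<close>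

abbreviation nil_ideal :: "('g \<Rightarrow>\<^sub>0 'k::field) set" where "nil_ideal \<equiv> right_span N"

lemma N_alg: "N \<subseteq> alg T" by (auto simp: N_def)

lemma N_nil_ideal: "a \<in> N \<Longrightarrow> a \<in> nil_ideal"
  using right_span_single[of a N 0] Gr_zero by simp

lemma nil_ideal_mult_left: assumes "f \<in> nil_ideal" "h \<in> alg Gr" shows "h * f \<in> nil_ideal"
  using assms(2)
proof (induction rule: alg_induct)
  case (add k c p)
  have "single k c * f \<in> nil_ideal"
    using assms(1)
  proof (induction rule: right_span.induct)
    case (add a g f)
    have "single k c * (a * delta g) = (single 0 c * conjg (- k) a) * delta (k + g)"
      by (simp add: conjg_def mult.assoc delta_cancel flip: delta_mult) (simp add: single_split[of k c] mult.assoc)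
    moreover have "single 0 c * conjg (- k) a \<in> N"
      using add(1) \<open>k \<in> Gr\<close> by (intro N_mult N_conj algT_scalar Gr_uminus)
    ultimately show ?case
      using add \<open>k \<in> Gr\<close> by (simp add: distrib_left right_span.add Gr_add)
  qed (simp add: right_span.zero)
  then show ?case using add by (simp add: distrib_right right_span_add)
qed (simp add: right_span.zero)

lemma nil_ideal_mult_right: assumes "f \<in> nil_ideal" "h \<in> alg Gr" shows "f * h \<in> nil_ideal"
  using assms(2)
proof (induction rule: alg_induct)
  case (add k c p)
  have "f * single k c \<in> nil_ideal"
    using assms(1)
  proof (induction rule: right_span.induct)
    case (add a g f)
    have "a * delta g * single k c = (a * single 0 c) * delta (g + k)"
      by (simp add: mult.assoc mult_single)
    moreover have "a * single 0 c \<in> N" using add(1) by (intro N_mult algT_scalar)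
    ultimately show ?case
      using add \<open>k \<in> Gr\<close> by (simp add: distrib_right right_span.add Gr_add)
  qed (simp add: right_span.zero)
  then show ?case using add by (simp add: distrib_left right_span_add)
qed (simp add: right_span.zero)

lemma algG_one: "(1 :: 'g \<Rightarrow>\<^sub>0 'k::comm_ring_1) \<in> alg Gr"
  using algT_one algT_G by blast

lemma nil_ideal_uminus: "f \<in> nil_ideal \<Longrightarrow> - f \<in> nil_ideal"
  using nil_ideal_mult_left[of f "- 1"] by (simp add: alg_uminus algG_one)

lemma nil_ideal_minus: "f \<in> nil_ideal \<Longrightarrow> h \<in> nil_ideal \<Longrightarrow> f - h \<in> nil_ideal"
  using right_span_add[of f N "- h"] nil_ideal_uminus[of h] by simp

definition degree_part :: "int \<Rightarrow> ('g \<Rightarrow>\<^sub>0 'k::comm_monoid_add) \<Rightarrow> 'g \<Rightarrow>\<^sub>0 'k" where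
  "degree_part d f = part {g. dg g = d} f"

lemma nil_ideal_degree_part: assumes "f \<in> nil_ideal" shows "degree_part d f \<in> nil_ideal"
  using assms
proof (induction rule: right_span.induct)
  case (add a g f)
  have "a \<in> alg (degs {0})" using add(1) N_alg by (auto simp: T_degs)
  moreover have "delta g \<in> alg (degs {dg g})" using add(2) by (intro alg_degs_single) simp_all
  ultimately have "a * delta g \<in> alg (degs {dg g})" by (rule alg_degs_mult) simp
  then have "degree_part d (a * delta g) = (if dg g = d then a * delta g else 0)"
    unfolding degree_part_def by (auto simp: degs_def intro: part_eq part_eq_zero)
  then show ?case using add by (auto simp: degree_part_def part_add right_span_add right_span_single)
qed (simp add: degree_part_def right_span.zero)

text \<open>Projecting \<open>a g\<close> with \<open>a \<in> N\<close> to \<open>K[T]\<close> gives \<open>a g\<close> or \<open>0\<close>, according to the degree of \<open>g\<close>; in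
  both cases the result is nilpotent.\<close>

lemma nil_ideal_T: assumes "f \<in> nil_ideal" "f \<in> alg T" shows "f \<in> N"
proof -
  have "part T f \<in> N" using assms(1)
  proof (induction rule: right_span.induct)
    case (add a g f)
    have a: "a \<in> alg T" using add(1) N_alg by blast
    have "part T (a * delta g) \<in> N"
    proof (cases "g \<in> T")
      case True
      then have "a * delta g \<in> N" using add(1) by (intro N_mult alg_single)
      then show ?thesis using N_alg part_eq[of "a * delta g" T T] by auto
    next
      case False
      have "a * delta g \<in> alg (degs {dg g})"
        using a add(2) by (intro alg_degs_mult[of a "{0}" _ "{dg g}"] alg_degs_single) (auto simp: T_degs)
      then have "part T (a * delta g) = 0"
        using False add(2) by (intro part_eq_zero) (auto simp: T_def degs_def)
      then show ?thesis by (simp add: N_zero)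
    qed
    then show ?case using add by (simp add: part_add N_add)
  qed (simp add: N_zero)
  then show ?thesis using part_eq[OF assms(2)] by simp
qed

lemma sum_degree_part: assumes "finite D" "dg ` keys f \<subseteq> D" shows "(\<Sum>d\<in>D. degree_part d f) = f"
proof (rule poly_mapping_eqI)
  fix x
  have "lookup (\<Sum>d\<in>D. degree_part d f) x = (\<Sum>d\<in>D. if d = dg x then lookup f x else 0)"
    by (simp add: lookup_sum degree_part_def lookup_part eq_commute)
  also have "\<dots> = lookup f x"
    using assms by (cases "x \<in> keys f") (auto simp: in_keys_iff)
  finally show "lookup (\<Sum>d\<in>D. degree_part d f) x = lookup f x" .
qed

lemma degree_part_eq_zero: "d \<notin> dg ` keys f \<Longrightarrow> degree_part d f = 0"
  by (rule poly_mapping_eqI) (auto simp: degree_part_def lookup_part in_keys_iff)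

lemma degree_part_alg: "f \<in> alg Gr \<Longrightarrow> degree_part d f \<in> alg (degs {d})"
  using part_alg[of f Gr "{g. dg g = d}"] by (simp add: degree_part_def degs_def Int_def conj_commute)

lemma split_at:
  "f = part {g. dg g > d} f + degree_part d f + part {g. dg g < d} f"
  by (rule poly_mapping_eqI) (auto simp: lookup_add degree_part_def lookup_part)

lemma part_above: "part {g. dg g > d} f = (\<Sum>e\<in>{e \<in> dg ` keys f. e > d}. degree_part e f)"
proof -
  let ?h = "part {g. dg g > d} f"
  have "keys ?h \<subseteq> {g \<in> keys f. dg g > d}"
    by (auto simp: in_keys_iff lookup_part split: if_splits)
  then have "?h = (\<Sum>e\<in>{e \<in> dg ` keys f. e > d}. degree_part e ?h)"
    by (intro sum_degree_part[symmetric]) auto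
  also have "\<dots> = (\<Sum>e\<in>{e \<in> dg ` keys f. e > d}. degree_part e f)"
    by (intro sum.cong refl poly_mapping_eqI) (auto simp: degree_part_def lookup_part)
  finally show ?thesis .
qed

end

context graded_group
begin

section \<open>Isolating a conjugation-stable factor\<close>

text \<open>Conjugation permutes coefficients, so conjugates of \<open>a\<close> take finitely many values on the finite
  set \<open>T\<close>.\<close>

lemma finite_conjugates:
  fixes a :: "'g \<Rightarrow>\<^sub>0 'k::field"
  assumes a: "a \<in> alg T"
  shows "finite ((\<lambda>g. conjg g a) ` Gr)"
proof (rule finite_subset)
  let ?F = "{f :: 'g \<Rightarrow> 'k. \<forall>x. (x \<in> T \<longrightarrow> f x \<in> insert 0 (lookup a ` keys a)) \<and> (x \<notin> T \<longrightarrow> f x = 0)}"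
  show "(\<lambda>g. conjg g a) ` Gr \<subseteq> Abs_poly_mapping ` ?F"
  proof
    fix b assume "b \<in> (\<lambda>g. conjg g a) ` Gr"
    then obtain g where g: "g \<in> Gr" "b = conjg g a" by blast
    have "b \<in> alg T" using g a conjg_alg by blast
    then have "lookup b \<in> ?F"
      by (auto simp: g(2) lookup_conjg alg_def in_keys_iff)
    then show "b \<in> Abs_poly_mapping ` ?F"
      by (rule rev_image_eqI) (simp add: lookup_inverse)
  qed
  show "finite (Abs_poly_mapping ` ?F)"
    using finite_set_of_finite_funs[OF T_finite, of "insert 0 (lookup a ` keys a)" 0]
    by (intro finite_imageI) simp
qed

text \<open>Among the sets of conjugates of \<open>a\<close> that contain \<open>a\<close> and have a product that is not nilpotent, let
  \<open>I\<close> be one of maximal size, with product \<open>c\<close>. Conjugation maps \<open>I\<close> to a set \<open>J\<close> of the same kind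
  with product \<open>c'\<close>. The product over \<open>I \<union> J\<close> divides \<open>c' c\<close>; so if \<open>c' c\<close> is not nilpotent, then
  maximality forces \<open>J = I\<close> and \<open>c' = c\<close>. This replaces the choice of a primitive idempotent of
  \<open>K[T]\<close> modulo \<open>N\<close>.\<close>

lemma stable_factor:
  fixes a :: "'g \<Rightarrow>\<^sub>0 'k::field"
  assumes a: "a \<in> alg T" "a \<notin> N"
  shows "\<exists>u\<in>alg T. u * a \<notin> N \<and> (\<forall>g\<in>Gr. conjg g (u * a) = u * a \<or> conjg g (u * a) * (u * a) \<in> N)"
proof -
  let ?M = "\<lparr>carrier = alg T, monoid.mult = (*), one = 1\<rparr> :: ('g \<Rightarrow>\<^sub>0 'k) monoid"
  interpret M: comm_monoid ?M
    by (rule comm_monoidI) (simp_all add: algT_one algT_mult mult.assoc, rule algT_commute)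
  define P where "P I = finprod ?M (\<lambda>x. x) I" for I
  let ?O = "(\<lambda>g. conjg g a) ` Gr"
  have OT: "?O \<subseteq> alg T" using a conjg_alg by blast
  have conjg_conjg: "conjg g (conjg h a) = conjg (h + g) a" for g h
  proof -
    have "delta (- (h + g)) = delta (- g) * (delta (- h) :: 'g \<Rightarrow>\<^sub>0 'k)"
      by (simp add: delta_mult minus_add)
    moreover have "delta (h + g) = delta h * (delta g :: 'g \<Rightarrow>\<^sub>0 'k)" by (simp add: delta_mult)
    ultimately show ?thesis by (simp only: conjg_def mult.assoc)
  qed
  have closed: "conjg g x \<in> ?O" if g: "g \<in> Gr" and x: "x \<in> ?O" for g x
  proof -
    obtain h where h: "h \<in> Gr" "x = conjg h a" using x by blast
    then show ?thesis unfolding h(2) conjg_conjg using g Gr_add by blast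
  qed
  have fin: "finite I" if "I \<subseteq> ?O" for I
    using finite_conjugates[OF a(1)] that finite_subset by blast
  have PT: "P I \<in> alg T" if "I \<subseteq> ?O" for I
    using M.finprod_closed[of "\<lambda>x. x" I] that OT by (auto simp: P_def)
  have "conjg 0 a = a" by (simp add: conjg_def)
  then have aO: "a \<in> ?O" using Gr_zero by (metis imageI)
  have Pins: "P (insert x I) = x * P I" if "insert x I \<subseteq> ?O" "x \<notin> I" for x I
  proof -
    have "P (insert x I) = x \<otimes>\<^bsub>?M\<^esub> P I"
      unfolding P_def
    proof (rule M.finprod_insert)
      show "finite I" using that fin[of I] by blast
      show "(\<lambda>x. x) \<in> I \<rightarrow> carrier ?M" using that OT by fastforce
      show "x \<in> carrier ?M" using that OT by fastforce
    qed (use that in simp)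
    then show ?thesis by simp
  qed
  have conjP: "P (conjg g ` I) = conjg g (P I)" if g: "g \<in> Gr" and I: "I \<subseteq> ?O" for g I
  proof -
    show ?thesis
      using fin[OF I] I
    proof (induction I rule: finite_induct)
      case empty
      then show ?case by (simp add: P_def conjg_one)
    next
      case (insert x I)
      have "conjg g x \<notin> conjg g ` I" using insert(2) conjg_inj by blast
      then have "P (insert (conjg g x) (conjg g ` I)) = conjg g x * P (conjg g ` I)"
        using insert.prems closed[OF g] by (intro Pins) auto
      moreover have "P (insert x I) = x * P I" using insert by (intro Pins) auto
      ultimately show ?case using insert by (simp add: conjg_mult)
    qed
  qed
  have img: "conjg g ` I \<subseteq> ?O" if "g \<in> Gr" and "I \<subseteq> ?O" for g I
    using closed that by blast
  let ?C = "{I. I \<subseteq> ?O \<and> a \<in> I \<and> P I \<notin> N}"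
  have "P {a} = a" using Pins[of a "{}"] aO by (simp add: P_def)
  then have "{a} \<in> ?C" using a(2) aO by simp
  moreover have finC: "finite ?C"
    by (rule finite_subset[of _ "Pow ?O"]) (use finite_conjugates[OF a(1)] in auto)
  ultimately have "Max (card ` ?C) \<in> card ` ?C" by (intro Max_in) auto
  then obtain I where I: "I \<in> ?C" "card I = Max (card ` ?C)" by force
  have max: "card J \<le> card I" if "J \<in> ?C" for J
    unfolding I(2) using finC that by (intro Max_ge) auto
  have IO: "I \<subseteq> ?O" and aI: "a \<in> I" and PI: "P I \<notin> N" using I(1) by auto
  define u where "u = P (I - {a})"
  have uT: "u \<in> alg T" unfolding u_def using IO by (intro PT) blast
  have "P (insert a (I - {a})) = a * P (I - {a})" using IO aI by (intro Pins) auto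
  then have "P I = a * u" using aI by (simp add: u_def insert_absorb)
  then have ua: "u * a = P I" using algT_commute[OF uT a(1)] by simp
  have "conjg g (P I) = P I \<or> conjg g (P I) * P I \<in> N" if g: "g \<in> Gr" for g
  proof (cases "conjg g (P I) * P I \<in> N")
    case False
    let ?J = "conjg g ` I"
    have J: "?J \<subseteq> ?O" using img[OF g IO] .
    have "P (?J \<union> I) \<otimes>\<^bsub>?M\<^esub> P (?J \<inter> I) = P ?J \<otimes>\<^bsub>?M\<^esub> P I"
      unfolding P_def using IO J fin[OF IO] fin[OF J] OT by (intro M.finprod_Un_Int) fastforce+
    then have "P (?J \<union> I) * P (?J \<inter> I) = conjg g (P I) * P I" by (simp add: conjP[OF g IO])
    moreover have "P (?J \<inter> I) \<in> alg T" using IO by (intro PT) blast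
    ultimately have "P (?J \<union> I) \<notin> N" using False N_mult(1) by metis
    then have "?J \<union> I \<in> ?C" using IO J aI by blast
    then have "card (?J \<union> I) \<le> card I" by (rule max)
    then have "?J \<union> I = I" using fin[OF IO] fin[OF J] by (intro card_seteq[symmetric]) auto
    moreover have "card ?J = card I" by (rule card_image) (auto intro!: inj_onI dest: conjg_inj)
    ultimately have "?J = I" using fin[OF IO] by (intro card_subset_eq) auto
    then show ?thesis using conjP[OF g IO] by simp
  qed simp
  then show ?thesis using uT PI by (intro bexI[of _ u]) (auto simp: ua)
qed

section \<open>The leading coefficient argument\<close>

lemma z_nmult: "nmult k z \<in> Gr" "dg (nmult k z) = int (k * l)"
  by (induction k) (simp_all add: Gr_zero Gr_add z_mem dg_zero dg_add dg_z algebra_simps)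

lemma z_nmult_central:
  fixes f :: "'g \<Rightarrow>\<^sub>0 'k::comm_ring_1"
  shows "f \<in> alg Gr \<Longrightarrow> delta (nmult k z) * f = f * delta (nmult k z)"
proof (induction rule: alg_induct)
  case (add g c p)
  have "nmult k z + g = g + nmult k z" using z_central[OF add(1)] by (rule nmult_commute)
  then show ?case using add by (simp add: distrib_left distrib_right mult_single)
qed simp

text \<open>For a group element \<open>h\<close>, the product \<open>c h c\<close> equals \<open>h c' c\<close> for a conjugate \<open>c'\<close> of \<open>c\<close>: it
  either commutes with \<open>c\<close> or lies in the nil ideal.\<close>

lemma stable_sandwich:
  fixes c :: "'g \<Rightarrow>\<^sub>0 'k::field"
  assumes c: "c \<in> alg T" "\<And>g. g \<in> Gr \<Longrightarrow> conjg g c = c \<or> conjg g c * c \<in> N"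
    and f: "f \<in> alg (degs D)"
  shows "\<exists>w\<in>alg (degs D). \<exists>\<nu>\<in>nil_ideal. c * f * c = w + \<nu> \<and> c * w = w * c"
  using f
proof (induction rule: alg_induct)
  case zero
  then show ?case by (intro bexI[of _ 0]) (auto simp: right_span.zero)
next
  case (add h s p)
  then obtain w \<nu> where w: "w \<in> alg (degs D)" "\<nu> \<in> nil_ideal" "c * p * c = w + \<nu>" "c * w = w * c"
    by blast
  have h: "h \<in> Gr" "dg h \<in> D" using add(1) by (auto simp: degs_def)
  have sh: "single h s \<in> alg Gr" using h by (intro alg_single)
  have "c * single h s = (c * single 0 s) * delta h" by (simp add: mult.assoc mult_single)
  also have "\<dots> = single 0 s * (delta h * conjg h c)"
    unfolding delta_conjg by (simp only: single_zero_commute[of s c, symmetric] mult.assoc)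
  also have "\<dots> = single h s * conjg h c" by (simp add: mult.assoc[symmetric] mult_single)
  finally have ch: "c * single h s = single h s * conjg h c" .
  show ?case
  proof (cases "conjg h c = c")
    case True
    let ?w = "c * single h s * c"
    have cd: "c \<in> alg (degs {0})" using c(1) by (simp add: T_degs)
    have "?w \<in> alg (degs D)"
      by (rule alg_degs_mult[OF alg_degs_mult[OF cd alg_degs_single[OF h]] cd]) auto
    moreover have "c * ?w = ?w * c" using ch True by (simp add: mult.assoc[symmetric])
    ultimately show ?thesis
      using w by (intro bexI[of _ "?w + w"] bexI[of _ \<nu>]) (simp_all add: alg_add algebra_simps)
  next
    case False
    then have "conjg h c * c \<in> N" using c(2) h by blast
    then have "single h s * (conjg h c * c) \<in> nil_ideal" using N_nil_ideal nil_ideal_mult_left sh by blast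
    then have "c * single h s * c \<in> nil_ideal" by (simp add: ch mult.assoc)
    then show ?thesis
      using w by (intro bexI[of _ w] bexI[of _ "c * single h s * c + \<nu>"])
        (simp_all add: right_span_add algebra_simps)
  qed
qed

text \<open>The elements that become \<open>0\<close> in \<open>K[G] / N K[G]\<close> when \<open>c\<close> is inverted.\<close>

definition c_torsion :: "('g \<Rightarrow>\<^sub>0 'k::field) \<Rightarrow> ('g \<Rightarrow>\<^sub>0 'k) set" where
  "c_torsion c = {f \<in> alg Gr. \<exists>k. c ^ k * f \<in> nil_ideal}"

lemma c_torsion_zero: "0 \<in> c_torsion c"
  by (simp add: c_torsion_def right_span.zero)

lemma c_torsion_add:
  assumes "c \<in> alg T" "f \<in> c_torsion c" "h \<in> c_torsion c"
  shows "f + h \<in> c_torsion c"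
proof -
  obtain i j where ij: "f \<in> alg Gr" "h \<in> alg Gr" "c ^ i * f \<in> nil_ideal" "c ^ j * h \<in> nil_ideal"
    using assms by (auto simp: c_torsion_def)
  have "c ^ k \<in> alg Gr" for k using assms(1) algT_power algT_G by blast
  then have "c ^ j * (c ^ i * f) + c ^ i * (c ^ j * h) \<in> nil_ideal"
    by (intro right_span_add nil_ideal_mult_left[OF ij(3)] nil_ideal_mult_left[OF ij(4)])
  moreover have "c ^ j * (c ^ i * f) = c ^ (i + j) * f" "c ^ i * (c ^ j * h) = c ^ (i + j) * h"
    by (simp_all add: mult.assoc[symmetric] add.commute flip: power_add)
  then have "c ^ j * (c ^ i * f) + c ^ i * (c ^ j * h) = c ^ (i + j) * (f + h)"
    by (simp add: distrib_left)
  ultimately show ?thesis using ij by (auto simp: c_torsion_def alg_add)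
qed

lemma c_torsion_sum:
  "c \<in> alg T \<Longrightarrow> (\<And>i. i \<in> I \<Longrightarrow> f i \<in> c_torsion c) \<Longrightarrow> sum f I \<in> c_torsion c"
  by (induction I rule: infinite_finite_induct) (auto simp: c_torsion_zero c_torsion_add)

text \<open>The equation \<open>y = 1 + v y\<close> with \<open>v\<close> of positive degree pushes the lowest degree of \<open>y\<close> up to \<open>0\<close>.\<close>

lemma right_inverse_nonneg:
  fixes v y :: "'g \<Rightarrow>\<^sub>0 'k::field"
  assumes v: "v \<in> alg (degs {0<..})" and y: "y \<in> alg Gr" and inv: "(1 - v) * y = 1"
  shows "degree_part 0 y = 1"
proof -
  have eq: "y = 1 + v * y" using inv by (simp add: algebra_simps)
  have one: "(1 :: 'g \<Rightarrow>\<^sub>0 'k) \<in> alg (degs D)" if "0 \<in> D" for D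
    using alg_degs_single[of 0 D "1::'k"] that by (simp add: Gr_zero dg_zero)
  have "y \<in> alg (degs {- int e..}) \<Longrightarrow> y \<in> alg (degs {0..})" for e
  proof (induction e)
    case (Suc e)
    have "v * y \<in> alg (degs {- int e..})"
      by (rule alg_degs_mult[OF v Suc.prems]) auto
    then have "1 + v * y \<in> alg (degs {- int e..})"
      using one[of "{- int e..}"] by (intro alg_add) auto
    then show ?case using Suc.IH eq by simp
  qed simp
  moreover have "y \<in> alg (degs {- int (\<Sum>g\<in>keys y. nat \<bar>dg g\<bar>)..})"
  proof -
    have "- int (\<Sum>g\<in>keys y. nat \<bar>dg g\<bar>) \<le> dg g" if "g \<in> keys y" for g
    proof -
      have "nat \<bar>dg g\<bar> \<le> (\<Sum>g\<in>keys y. nat \<bar>dg g\<bar>)" using that by (intro member_le_sum) auto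
      then show ?thesis by linarith
    qed
    then show ?thesis using y by (auto simp: alg_def degs_def)
  qed
  ultimately have "y \<in> alg (degs {0..})" by blast
  with v have "v * y \<in> alg (degs {0<..})" by (rule alg_degs_mult) simp
  then have "degree_part 0 (v * y) = 0" unfolding degree_part_def by (rule part_eq_zero) (auto simp: degs_def)
  moreover have "degree_part 0 (1 :: 'g \<Rightarrow>\<^sub>0 'k) = 1"
    unfolding degree_part_def using one[of "{0}"] by (intro part_eq) (auto simp: degs_def)
  ultimately have "degree_part 0 (1 + v * y) = 1" by (simp add: degree_part_def part_add)
  then show ?thesis using eq by simp
qed

text \<open>Modulo the nil ideal and after inverting \<open>c\<close>, the element \<open>v\<close> has an invertible leading coefficient
  in degree \<open>k l > 0\<close>. If \<open>y\<close> had a component of degree \<open>m \<ge> 0\<close> that survives this localization,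
  then the highest one would contribute a non-zero component of degree \<open>m + k l\<close> to \<open>(1 - v) y = 1\<close>,
  which is impossible. So all these components vanish there, and among them is the component \<open>1\<close> of
  degree \<open>0\<close>: some power of \<open>c\<close> is in the nil ideal.\<close>

lemma leading_coefficient_nilpotent:
  fixes c w \<nu> y :: "'g \<Rightarrow>\<^sub>0 'k::field"
  assumes c: "c \<in> alg T" and k: "k \<ge> 1"
    and w: "w \<in> alg (degs {..<int (k * l)})" "c * w = w * c"
    and \<nu>: "\<nu> \<in> nil_ideal"
    and v: "v = delta (nmult k z) * c ^ 3 + w + \<nu>" "v \<in> alg (degs {0<..})"
    and y: "y \<in> alg Gr" "(1 - v) * y = 1"
  shows "c \<in> N"
proof -
  let ?D = "int (k * l)" and ?Z = "delta (nmult k z) :: 'g \<Rightarrow>\<^sub>0 'k"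
  have D: "?D > 0" using k l_pos by simp
  have cG: "c ^ i \<in> alg Gr" for i using c algT_power algT_G by blast
  have cd: "c ^ i \<in> alg (degs {0})" for i using algT_power[OF c, of i] by (simp add: T_degs)
  have wG: "w \<in> alg Gr" using w(1) by (rule alg_degs_G)
  have ZG: "?Z \<in> alg Gr" using z_nmult by (intro alg_single)
  have cw: "c ^ i * w = w * c ^ i" for i using power_commuting_commutes[OF w(2)] .
  have "degree_part s y \<in> c_torsion c" if s: "s \<ge> 0" for s
  proof (rule ccontr)
    assume neg: "degree_part s y \<notin> c_torsion c"
    let ?B = "{s. s \<ge> 0 \<and> degree_part s y \<notin> c_torsion c}"
    have finB: "finite ?B"
    proof (rule finite_subset)
      show "?B \<subseteq> dg ` keys y"
      proof
        fix e assume "e \<in> ?B"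
        then have "degree_part e y \<noteq> 0" using c_torsion_zero[of c] by auto
        then show "e \<in> dg ` keys y" using degree_part_eq_zero[of e y] by blast
      qed
    qed simp
    define m where "m = Max ?B"
    have "m \<in> ?B" unfolding m_def using finB neg s by (intro Max_in) auto
    then have m: "m \<ge> 0" "degree_part m y \<notin> c_torsion c" by auto
    have above: "degree_part e y \<in> c_torsion c" if "e > m" for e
    proof (rule ccontr)
      assume "degree_part e y \<notin> c_torsion c"
      then have "e \<in> ?B" using that m(1) by simp
      then have "e \<le> m" unfolding m_def using finB by (rule Max_ge[rotated])
      then show False using that by simp
    qed
    let ?hi = "part {g. dg g > m} y" and ?ym = "degree_part m y" and ?lo = "part {g. dg g < m} y"
    have "?hi \<in> c_torsion c"
      unfolding part_above by (rule c_torsion_sum[OF c]) (auto intro: above)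
    then obtain i where hiG: "?hi \<in> alg Gr" and i: "c ^ i * ?hi \<in> nil_ideal" by (auto simp: c_torsion_def)
    have y_split: "y = ?hi + ?ym + ?lo" by (rule split_at)
    have ymd: "?ym \<in> alg (degs {m})" by (rule degree_part_alg[OF y(1)])
    have ymG: "?ym \<in> alg Gr" using ymd by (rule alg_degs_G)
    have lod: "?lo \<in> alg (degs {..<m})"
      by (rule alg_mono[OF _ part_alg[OF y(1)]]) (auto simp: degs_def)
    have loG: "?lo \<in> alg Gr" using lod by (rule alg_degs_G)
    let ?low = "degs {..<m + ?D}"
    \<comment> \<open>Multiply \<open>(1 - v) y = 1\<close> by \<open>c ^ i\<close> and sort the terms: \<open>E1\<close> and \<open>E2\<close> are in the nil ideal, \<open>L\<close> has
      degree below \<open>m + k l\<close>, and \<open>A\<close> is homogeneous of degree \<open>m + k l\<close>.\<close>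
    define E1 where "E1 = c ^ i * ?hi - ?Z * c ^ 3 * (c ^ i * ?hi) - w * (c ^ i * ?hi)"
    define E2 where "E2 = c ^ i * \<nu> * y"
    define L where "L = c ^ i * (?ym + ?lo) - c ^ (i + 3) * ?Z * ?lo - w * (c ^ i * (?ym + ?lo)) - c ^ i"
    define A where "A = ?Z * (c ^ (i + 3) * ?ym)"
    have c3: "c ^ 3 * (c ^ i * h) = c ^ i * (c ^ 3 * h)" for h
      by (simp add: mult.assoc[symmetric] add.commute flip: power_add)
    have cZ: "c ^ j * ?Z = ?Z * c ^ j" for j using z_nmult_central[OF cG] by simp
    have cZ': "c ^ j * (?Z * h) = ?Z * (c ^ j * h)" for j h
      by (simp only: mult.assoc[symmetric] cZ)
    have "c ^ i = c ^ i * ((1 - v) * y)" using y(2) by simp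
    also have "\<dots> = c ^ i * y - c ^ i * ?Z * c ^ 3 * y - c ^ i * w * y - E2"
      by (simp add: v(1) E2_def algebra_simps)
    also have "\<dots> = c ^ i * y - ?Z * c ^ (i + 3) * y - w * (c ^ i * y) - E2"
      by (simp add: cZ cw power_add mult.assoc)
    also have "c ^ i * y = c ^ i * ?hi + c ^ i * (?ym + ?lo)"
      by (subst y_split) (simp add: distrib_left add.assoc)
    also have "?Z * c ^ (i + 3) * y = ?Z * c ^ 3 * (c ^ i * ?hi) + A + c ^ (i + 3) * ?Z * ?lo"
      by (subst y_split) (simp add: A_def cZ cZ' distrib_left mult.assoc power_add c3)
    also have "c ^ i * ?hi + c ^ i * (?ym + ?lo)
        - (?Z * c ^ 3 * (c ^ i * ?hi) + A + c ^ (i + 3) * ?Z * ?lo)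
        - w * (c ^ i * ?hi + c ^ i * (?ym + ?lo)) - E2
      = E1 - A + (c ^ i * (?ym + ?lo) - c ^ (i + 3) * ?Z * ?lo - w * (c ^ i * (?ym + ?lo))) - E2"
      by (simp only: E1_def distrib_left[of w] diff_conv_add_uminus minus_add_distrib add_ac)
    also have "c ^ i * (?ym + ?lo) - c ^ (i + 3) * ?Z * ?lo - w * (c ^ i * (?ym + ?lo)) = L + c ^ i"
      by (simp only: L_def diff_add_cancel)
    finally have A: "A = E1 - E2 + L" by (simp add: algebra_simps)
    have E: "E1 - E2 \<in> nil_ideal"
      unfolding E1_def E2_def using i wG ZG cG[of 3]
      by (intro nil_ideal_minus nil_ideal_mult_left[OF i] nil_ideal_mult_right[OF nil_ideal_mult_left[OF \<nu> cG] y(1)] algG_mult)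
    have Zd: "?Z \<in> alg (degs {?D})" using z_nmult by (intro alg_degs_single) simp_all
    have "?ym + ?lo \<in> alg (degs {..m})"
      by (intro alg_add alg_degs_mono[OF ymd] alg_degs_mono[OF lod]) auto
    then have cyl: "c ^ i * (?ym + ?lo) \<in> alg (degs {..m})" by (rule alg_degs_mult[OF cd]) auto
    have "c ^ i * (?ym + ?lo) \<in> alg ?low" using D by (intro alg_degs_mono[OF cyl]) auto
    moreover have "w * (c ^ i * (?ym + ?lo)) \<in> alg ?low" by (rule alg_degs_mult[OF w(1) cyl]) auto
    moreover have "c ^ i \<in> alg ?low" using D m(1) by (intro alg_degs_mono[OF cd]) auto
    moreover have "c ^ (i + 3) * ?Z * ?lo \<in> alg ?low"
    proof -
      have "c ^ (i + 3) * ?Z \<in> alg (degs {?D})" by (rule alg_degs_mult[OF cd Zd]) simp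
      then show ?thesis by (rule alg_degs_mult[OF _ lod]) auto
    qed
    ultimately have "L \<in> alg ?low" unfolding L_def by (intro alg_minus)
    then have "degree_part (m + ?D) L = 0" unfolding degree_part_def by (rule part_eq_zero) (auto simp: degs_def)
    moreover have "A \<in> alg (degs {m + ?D})"
      unfolding A_def by (rule alg_degs_mult[OF Zd alg_degs_mult[OF cd ymd, of "{m}"]]) auto
    then have "degree_part (m + ?D) A = A" unfolding degree_part_def by (rule part_eq) (auto simp: degs_def)
    moreover have "degree_part (m + ?D) A = degree_part (m + ?D) (E1 - E2) + degree_part (m + ?D) L"
      by (simp add: A degree_part_def part_add)
    ultimately have "A \<in> nil_ideal" using nil_ideal_degree_part[OF E] by simp
    then have "delta (- nmult k z) * A \<in> nil_ideal"
      using z_nmult by (intro nil_ideal_mult_left alg_single Gr_uminus) auto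
    then have "c ^ (i + 3) * ?ym \<in> nil_ideal" by (simp add: A_def delta_cancel)
    then have "?ym \<in> c_torsion c" using ymG by (auto simp: c_torsion_def)
    then show False using m(2) by simp
  qed
  then have "degree_part 0 y \<in> c_torsion c" by simp
  then have "1 \<in> c_torsion c" using right_inverse_nonneg[OF v(2) y] by simp
  then obtain i where "c ^ i \<in> nil_ideal" by (auto simp: c_torsion_def)
  then have "c ^ i \<in> N" using nil_ideal_T algT_power c by blast
  then show ?thesis using N_power c by blast
qed

text \<open>
  The submonoid \<open>M\<close> stands for \<open>G\<close> or for the image of \<open>S\<close>. It has all elements of large degree, and
  so the multipliers \<open>r1\<close> and \<open>r2\<close> below, which are built from elements of \<open>K[T]\<close> and a group element, belong to \<open>K[M]\<close>
  after multiplication by a power of \<open>z\<close>.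
\<close>

lemma quasi_radical_sub_nil_ideal:
  fixes x :: "'g \<Rightarrow>\<^sub>0 'k::field"
  assumes M: "M \<subseteq> Gr" "0 \<in> M" "\<And>g h. g \<in> M \<Longrightarrow> h \<in> M \<Longrightarrow> g + h \<in> M"
    and high: "\<And>g. g \<in> Gr \<Longrightarrow> dg g \<ge> int l \<Longrightarrow> g \<in> M"
    and x: "x \<in> quasi_radical (alg M)"
  shows "x \<in> nil_ideal"
proof (rule ccontr)
  assume "x \<notin> nil_ideal"
  have sub: "subring_set (alg M :: ('g \<Rightarrow>\<^sub>0 'k) set)"
    using alg_single[OF M(2), of "1::'k"]
    by (auto simp: subring_set_def alg_add alg_uminus intro: alg_mult M(3))
  have xM: "x \<in> alg M" using x by (simp add: quasi_radical_def)
  then have xG: "x \<in> alg Gr" using alg_mono M(1) by blast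
  let ?B = "{d. degree_part d x \<notin> nil_ideal}"
  have finB: "finite ?B"
  proof (rule finite_subset)
    show "?B \<subseteq> dg ` keys x"
    proof
      fix e assume "e \<in> ?B"
      then have "degree_part e x \<noteq> 0" using right_span.zero[of N] by auto
      then show "e \<in> dg ` keys x" using degree_part_eq_zero[of e x] by blast
    qed
  qed simp
  have "?B \<noteq> {}"
  proof
    assume "?B = {}"
    then have "(\<Sum>d\<in>dg ` keys x. degree_part d x) \<in> nil_ideal" by (intro right_span_sum) auto
    then show False using \<open>x \<notin> nil_ideal\<close> sum_degree_part[of "dg ` keys x" x] by simp
  qed
  define d where "d = Max ?B"
  have d: "degree_part d x \<notin> nil_ideal" using Max_in[OF finB \<open>?B \<noteq> {}\<close>] by (simp add: d_def)
  have above: "degree_part e x \<in> nil_ideal" if "e > d" for e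
  proof (rule ccontr)
    assume "degree_part e x \<notin> nil_ideal"
    then have "e \<le> d" unfolding d_def using finB by (intro Max_ge) auto
    then show False using that by simp
  qed
  let ?hi = "part {g. dg g > d} x" and ?lo = "part {g. dg g < d} x"
  have hi: "?hi \<in> nil_ideal" unfolding part_above by (rule right_span_sum) (auto intro: above)
  have lo: "?lo \<in> alg (degs {..<d})"
    by (rule alg_mono[OF _ part_alg[OF xG]]) (auto simp: degs_def)
  have xd: "degree_part d x \<in> alg (degs {d})" by (rule degree_part_alg[OF xG])
  have "degree_part d x \<noteq> 0" using d right_span.zero by metis
  then obtain g where "g \<in> keys (degree_part d x)" by (metis keys_eq_empty equals0I)
  then have g: "g \<in> Gr" "dg g = d" using xd by (auto simp: alg_def degs_def)
  define a where "a = degree_part d x * delta (- g)"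
  have gd: "delta (- g) \<in> alg (degs {- d})"
    using g by (intro alg_degs_single) (simp_all add: Gr_uminus dg_uminus)
  have aT: "a \<in> alg T"
    unfolding a_def T_degs by (rule alg_degs_mult[OF xd gd]) simp
  have ag: "a * delta g = degree_part d x" by (simp add: a_def mult.assoc delta_mult)
  then have aN: "a \<notin> N" using d g(1) right_span_single by metis
  obtain u where u: "u \<in> alg T" and uaN: "u * a \<notin> N"
    and stab: "\<And>g. g \<in> Gr \<Longrightarrow> conjg g (u * a) = u * a \<or> conjg g (u * a) * (u * a) \<in> N"
    using stable_factor[OF aT aN] by blast
  define c where "c = u * a"
  have cT: "c \<in> alg T" using u aT by (simp add: c_def algT_mult)
  have Td: "b \<in> alg (degs {0})" if "b \<in> alg T" for b :: "'g \<Rightarrow>\<^sub>0 'k" using that by (simp add: T_degs)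
  define B where "B = (\<Sum>g\<in>keys x. nat \<bar>dg g\<bar>)"
  have xB: "x \<in> alg (degs {- int B..})"
  proof -
    have "- int B \<le> dg g" if "g \<in> keys x" for g
    proof -
      have "nat \<bar>dg g\<bar> \<le> B" unfolding B_def using that by (intro member_le_sum) auto
      then show ?thesis by linarith
    qed
    then show ?thesis using xG by (auto simp: alg_def degs_def)
  qed
  \<comment> \<open>Large enough to make the degrees of \<open>r1\<close> and \<open>r2\<close> at least \<open>l\<close> and those of \<open>r1 * x * r2\<close>
    positive.\<close>
  define q where "q = l + nat \<bar>d\<bar> + B + 1"
  have q: "int (q * l) \<ge> int l + \<bar>d\<bar> + int B + 1"
  proof -
    have "q \<le> q * l" using l_pos by simp
    then show ?thesis unfolding q_def by linarith
  qed
  let ?Z = "delta (nmult q z) :: 'g \<Rightarrow>\<^sub>0 'k"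
  have Zd: "?Z \<in> alg (degs {int (q * l)})" using z_nmult by (intro alg_degs_single) simp_all
  define r1 where "r1 = ?Z * (c * u)"
  define r2 where "r2 = delta (- g) * (?Z * c)"
  have r1d: "r1 \<in> alg (degs {int (q * l)})"
    unfolding r1_def by (rule alg_degs_mult[OF Zd Td]) (simp_all add: algT_mult cT u)
  have r2d: "r2 \<in> alg (degs {int (q * l) - d})"
    unfolding r2_def
    by (rule alg_degs_mult[OF gd alg_degs_mult[OF Zd Td[OF cT], of "{int (q * l)}"]]) auto
  have r1M: "r1 \<in> alg M" using r1d by (rule alg_mono[rotated]) (use q high in \<open>auto simp: degs_def\<close>)
  have r2M: "r2 \<in> alg M" using r2d by (rule alg_mono[rotated]) (use q high in \<open>auto simp: degs_def\<close>)
  define v where "v = r1 * x * r2"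
  have "v \<in> quasi_radical (alg M)"
    unfolding v_def using sub x r1M r2M by (intro quasi_radical_mult_right quasi_radical_mult_left)
  then obtain y where y: "y \<in> alg M" "(1 - v) * y = 1" using quasi_radical_right_inverse[OF sub] by blast
  have yG: "y \<in> alg Gr" using y alg_mono M(1) by blast
  have vpos: "v \<in> alg (degs {0<..})"
    unfolding v_def
    by (rule alg_degs_mult[OF alg_degs_mult[OF r1d xB, of "{int (q * l) - int B..}"] r2d])
      (use q in auto)
  define f where "f = u * ?lo * delta (- g)"
  have fd: "f \<in> alg (degs {..<0})"
    unfolding f_def
    by (rule alg_degs_mult[OF alg_degs_mult[OF Td[OF u] lo, of "{..<d}"] gd]) auto
  obtain w \<nu> where w: "w \<in> alg (degs {..<0})" "\<nu> \<in> nil_ideal" "c * f * c = w + \<nu>" "c * w = w * c"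
    using stable_sandwich[OF cT _ fd] stab unfolding c_def by blast
  let ?ZZ = "delta (nmult (2 * q) z) :: 'g \<Rightarrow>\<^sub>0 'k"
  have Zc: "?Z * h = h * ?Z" if "h \<in> alg Gr" for h using z_nmult_central that by blast
  have ZZ: "?Z * ?Z = ?ZZ" by (simp add: delta_mult mult_2 nmult_add)
  have G: "c \<in> alg Gr" "u \<in> alg Gr" "x \<in> alg Gr" "delta (- g) \<in> (alg Gr :: ('g \<Rightarrow>\<^sub>0 'k) set)"
    using cT u algT_G xG g by (auto intro!: alg_single Gr_uminus)
  have "v = ?Z * ((c * u * x * delta (- g)) * ?Z) * c"
    by (simp add: v_def r1_def r2_def mult.assoc)
  also have "(c * u * x * delta (- g)) * ?Z = ?Z * (c * u * x * delta (- g))"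
    using G by (intro Zc[symmetric] algG_mult)
  also have "?Z * (?Z * (c * u * x * delta (- g))) * c = ?ZZ * (c * (u * x * delta (- g)) * c)"
    by (simp add: mult.assoc flip: ZZ)
  also have "u * x * delta (- g) = u * ?hi * delta (- g) + c + f"
  proof -
    have "u * x * delta (- g) = u * (?hi + degree_part d x + ?lo) * delta (- g)" using split_at[of x d] by simp
    then show ?thesis by (simp add: f_def c_def a_def algebra_simps)
  qed
  also have "c * (u * ?hi * delta (- g) + c + f) * c
      = c * (u * ?hi * delta (- g)) * c + c ^ 3 + (w + \<nu>)"
    by (simp add: distrib_left distrib_right w(3)[symmetric] power3_eq_cube)
  finally have veq: "v = ?ZZ * c ^ 3 + ?ZZ * w + ?ZZ * (c * (u * ?hi * delta (- g)) * c + \<nu>)"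
    by (simp add: algebra_simps)
  have wd: "?ZZ * w \<in> alg (degs {..<int (2 * q * l)})"
    using z_nmult[of "2 * q"]
    by (intro alg_degs_mult[OF alg_degs_single[of _ "{int (2 * q * l)}"] w(1)]) auto
  have "c * (?ZZ * w) = (?ZZ * c) * w"
    by (simp only: z_nmult_central[OF G(1), of "2 * q"] mult.assoc[symmetric])
  also have "\<dots> = ?ZZ * w * c" by (simp only: w(4) mult.assoc)
  finally have cw: "c * (?ZZ * w) = ?ZZ * w * c" .
  have \<nu>': "?ZZ * (c * (u * ?hi * delta (- g)) * c + \<nu>) \<in> nil_ideal"
    using z_nmult
    by (intro nil_ideal_mult_left[OF right_span_add[OF nil_ideal_mult_right[OF nil_ideal_mult_left[OF
          nil_ideal_mult_right[OF nil_ideal_mult_left[OF hi G(2)] G(4)] G(1)] G(1)] w(2)]] alg_single)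
  have "2 * q \<ge> 1" by (simp add: q_def)
  then have "c \<in> N"
    by (rule leading_coefficient_nilpotent[OF cT _ wd cw \<nu>' veq vpos yG y(2)])
  then show False using uaN by (simp add: c_def)
qed

end

section \<open>Nilpotency of the ideal generated by the nilpotent elements\<close>

abbreviation scal :: "'k::field \<Rightarrow> ('g::group_add \<Rightarrow>\<^sub>0 'k) \<Rightarrow> 'g \<Rightarrow>\<^sub>0 'k" where
  "scal c f \<equiv> single 0 c * f"

lemma vector_space_scal:
  "vector_space (scal :: 'k::field \<Rightarrow> ('g::group_add \<Rightarrow>\<^sub>0 'k) \<Rightarrow> _)"
  by unfold_locales
    (simp_all add: distrib_left distrib_right single_add mult_single flip: mult.assoc)

context graded_group
begin

interpretation vs: vector_space "scal :: 'k::field \<Rightarrow> ('g \<Rightarrow>\<^sub>0 'k) \<Rightarrow> _"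
  by (rule vector_space_scal)

fun nil_power :: "nat \<Rightarrow> ('g \<Rightarrow>\<^sub>0 'k::field) set" where
  "nil_power 0 = alg T"
| "nil_power (Suc m) = {p * a | p a. p \<in> nil_power m \<and> a \<in> N}"

lemma nil_power_alg: "nil_power m \<subseteq> alg T"
  by (induction m) (auto simp: N_def algT_mult)

lemma scal_commute: "f * scal c g = scal c (f * g)" for f g :: "'g \<Rightarrow>\<^sub>0 'k::field"
  by (metis mult.assoc single_zero_commute)

lemma N_finite_basis:
  "\<exists>B :: ('g \<Rightarrow>\<^sub>0 'k::field) set. finite B \<and> B \<subseteq> N \<and> N \<subseteq> vs.span B"
proof -
  obtain B :: "('g \<Rightarrow>\<^sub>0 'k) set" where B: "B \<subseteq> N" "vs.independent B" "N \<subseteq> vs.span B"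
    using vs.maximal_independent_subset[of N] by blast
  have "alg T \<subseteq> vs.span (delta ` T :: ('g \<Rightarrow>\<^sub>0 'k) set)"
  proof
    fix f :: "'g \<Rightarrow>\<^sub>0 'k" assume "f \<in> alg T"
    then show "f \<in> vs.span (delta ` T)"
    proof (induction rule: alg_induct)
      case zero
      then show ?case by (rule vs.span_zero)
    next
      case (add t c p)
      have "scal c (delta t) \<in> vs.span (delta ` T)"
        using add(1) by (intro vs.span_scale vs.span_base) simp
      then show ?case using add(3) vs.span_add by (simp add: mult_single)
    qed
  qed
  then have "B \<subseteq> vs.span (delta ` T)" using B(1) N_alg by blast
  then have "finite B" using vs.independent_span_bound[of "delta ` T" B] B(2) T_finite by simp
  then show ?thesis using B by blast
qed

text \<open>In terms of a finite basis \<open>B\<close> of \<open>N\<close>, a product of \<open>m\<close> elements of \<open>N\<close> is a combination of products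
  of \<open>m\<close> basis elements, and these vanish for large \<open>m\<close>.\<close>

lemma nil_power_eventually_zero: "\<exists>m. nil_power m \<subseteq> {0 :: 'g \<Rightarrow>\<^sub>0 'k::field}"
proof -
  obtain B :: "('g \<Rightarrow>\<^sub>0 'k) set" where B: "finite B" "B \<subseteq> N" "N \<subseteq> vs.span B"
    using N_finite_basis by blast
  define S where "S m = {r * prod_list xs | r xs. r \<in> alg T \<and> set xs \<subseteq> B \<and> length xs = m}" for m
  have step: "p * a \<in> vs.span (S (Suc m))" if p: "p \<in> vs.span (S m)" and a: "a \<in> vs.span B" for p a m
    using a
  proof (induction rule: vs.span_induct_alt)
    case base
    then show ?case by (simp add: vs.span_zero)
  next
    case (step c b q)
    have "p * b \<in> vs.span (S (Suc m))"
      using p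
    proof (induction rule: vs.span_induct_alt)
      case base
      then show ?case by (simp add: vs.span_zero)
    next
      case (step d s p')
      obtain r xs where s: "s = r * prod_list xs" "r \<in> alg T" "set xs \<subseteq> B" "length xs = m"
        using step(1) by (auto simp: S_def)
      have "s * b = r * prod_list (xs @ [b])" by (simp add: s(1) mult.assoc)
      moreover have "set (xs @ [b]) \<subseteq> B" "length (xs @ [b]) = Suc m" using s \<open>b \<in> B\<close> by auto
      ultimately have "s * b \<in> S (Suc m)" unfolding S_def using s(2) by blast
      then have "scal d (s * b) \<in> vs.span (S (Suc m))" by (intro vs.span_scale vs.span_base)
      then show ?case using step(2) vs.span_add by (simp add: distrib_right mult.assoc)
    qed
    then have "scal c (p * b) \<in> vs.span (S (Suc m))" by (rule vs.span_scale)
    then show ?case using step(2) vs.span_add by (simp add: distrib_left scal_commute)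
  qed
  have nil_power: "nil_power m \<subseteq> vs.span (S m)" for m
  proof (induction m)
    case 0
    have "r \<in> S 0" if "r \<in> alg T" for r using that unfolding S_def by (intro CollectI exI[of _ r] exI[of _ "[]"]) simp
    then show ?case using vs.span_base by auto
  next
    case (Suc m)
    then show ?case using step B(3) by fastforce
  qed
  have "\<exists>k. b ^ k = 0" if "b \<in> B" for b using that B(2) by (auto simp: N_def)
  then obtain k where k: "\<And>b. b \<in> B \<Longrightarrow> b ^ k b = 0" by metis
  define m where "m = Suc (\<Sum>b\<in>B. k b)"
  have "B \<subseteq> alg T" using B(2) N_alg by blast
  then have comm: "x * y = y * x" if "x \<in> B" "y \<in> B" for x y using that algT_commute by blast
  have "S m \<subseteq> {0}"
    using prod_list_commuting_nilpotents[OF B(1) comm k] unfolding S_def m_def by auto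
  then have "vs.span (S m) \<subseteq> {0}" by (intro vs.span_minimal) (auto simp: vs.subspace_def)
  then show ?thesis using nil_power by blast
qed

lemma alg_right_span_nil_power: "f \<in> alg Gr \<Longrightarrow> f \<in> right_span (nil_power 0)"
proof (induction rule: alg_induct)
  case (add g c p)
  have "single 0 c * delta g + p \<in> right_span (nil_power 0)"
    using add algT_scalar by (intro right_span.add) auto
  then show ?case by (simp add: mult_single)
qed (rule right_span.zero)

lemma right_span_nil_power_mult:
  assumes "f \<in> right_span (nil_power m)" "h \<in> nil_ideal"
  shows "f * h \<in> right_span (nil_power (Suc m))"
  using assms(1)
proof (induction rule: right_span.induct)
  case (add p g f)
  have "p * delta g * h \<in> right_span (nil_power (Suc m))"
    using assms(2)
  proof (induction rule: right_span.induct)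
    case (add a k h)
    have "p * delta g * (a * delta k) = (p * conjg (- g) a) * delta (g + k)"
      by (simp add: conjg_def mult.assoc delta_cancel flip: delta_mult)
    moreover have "p * conjg (- g) a \<in> nil_power (Suc m)"
      using \<open>p \<in> nil_power m\<close> N_conj[OF add(1) Gr_uminus[OF \<open>g \<in> Gr\<close>]] by auto
    ultimately have "p * delta g * (a * delta k) + p * delta g * h \<in> right_span (nil_power (Suc m))"
      using add Gr_add[OF \<open>g \<in> Gr\<close>] by (simp only: right_span.add)
    then show ?case by (simp add: distrib_left)
  qed (simp add: right_span.zero)
  then show ?case using add by (simp add: distrib_right right_span_add del: nil_power.simps)
qed (simp add: right_span.zero)

lemma right_span_trivial: assumes "U \<subseteq> {0}" "f \<in> right_span U" shows "f = 0"
  using assms(2) by (induction rule: right_span.induct) (use assms(1) in auto)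

text \<open>For nilpotent \<open>r a\<close>, the geometric series inverts \<open>1 - r a\<close>.\<close>

lemma N_quasi_radical:
  fixes a :: "'g \<Rightarrow>\<^sub>0 'k::field"
  assumes a: "a \<in> N"
  shows "a \<in> quasi_radical (alg T)"
proof -
  have "\<exists>u\<in>alg T. u * (1 - r * a) = 1" if r: "r \<in> alg T" for r
  proof -
    have "r * a \<in> N" using a r by (rule N_mult)
    then obtain m where m: "(r * a) ^ m = 0" and ra: "r * a \<in> alg T" by (auto simp: N_def)
    have "(\<Sum>i<m. b ^ i) * (1 - b) = 1 - b ^ m" for b :: "'g \<Rightarrow>\<^sub>0 'k"
    proof (induction m)
      case (Suc m)
      have "(\<Sum>i<Suc m. b ^ i) * (1 - b) = (\<Sum>i<m. b ^ i) * (1 - b) + b ^ m * (1 - b)"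
        by (simp only: sum.lessThan_Suc distrib_right)
      also have "\<dots> = 1 - b ^ Suc m" unfolding Suc by (simp add: right_diff_distrib power_commutes)
      finally show ?case .
    qed simp
    from this[of "r * a"] have "(\<Sum>i<m. (r * a) ^ i) * (1 - r * a) = 1" using m by simp
    moreover have "(\<Sum>i<m. (r * a) ^ i) \<in> alg T" using ra by (intro alg_sum algT_power)
    ultimately show ?thesis by blast
  qed
  then show ?thesis using a N_alg by (auto simp: quasi_radical_def)
qed

section \<open>Semisimple coefficients\<close>

text \<open>Maschke's argument: averaging a linear projection onto \<open>a K[T]\<close> over \<open>T\<close> makes it
  \<open>K[T]\<close>-linear. Its value at \<open>1\<close> is some \<open>a r\<close>, whence \<open>a = a (a s)\<close>, where \<open>s\<close> is a scalar multiple
  of \<open>r\<close>; iterating this kills a nilpotent \<open>a\<close>.\<close>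

lemma nilpotent_eq_zero:
  fixes a :: "'g \<Rightarrow>\<^sub>0 'k::field"
  assumes card: "of_nat (card T) \<noteq> (0 :: 'k)" and a: "a \<in> N"
  shows "a = 0"
proof -
  have aT: "a \<in> alg T" using a N_alg by blast
  let ?V = "{a * r | r. r \<in> alg T}"
  have V: "vs.subspace ?V"
  proof (rule vs.subspaceI)
    show "0 \<in> ?V" using alg_zero[of T] by (auto intro: exI[of _ 0])
    show "x + y \<in> ?V" if xy: "x \<in> ?V" "y \<in> ?V" for x y
    proof -
      obtain r s where "r \<in> alg T" "x = a * r" "s \<in> alg T" "y = a * s" using xy by blast
      then have "r + s \<in> alg T" "x + y = a * (r + s)" by (simp_all add: alg_add distrib_left)
      then show ?thesis by blast
    qed
    show "scal c x \<in> ?V" if x: "x \<in> ?V" for c x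
    proof -
      obtain r where "r \<in> alg T" "x = a * r" using x by blast
      then have "scal c r \<in> alg T" "scal c x = a * scal c r" by (simp_all add: algT_mult algT_scalar scal_commute)
      then show ?thesis by blast
    qed
  qed
  interpret vp: vector_space_pair "scal :: 'k \<Rightarrow> ('g \<Rightarrow>\<^sub>0 'k) \<Rightarrow> _" "scal :: 'k \<Rightarrow> ('g \<Rightarrow>\<^sub>0 'k) \<Rightarrow> _"
    by (rule vector_space_pair.intro[OF vector_space_scal vector_space_scal])
  have "Vector_Spaces.linear scal scal (\<lambda>f :: 'g \<Rightarrow>\<^sub>0 'k. f)"
    by (simp add: Vector_Spaces.linear_iff vector_space_scal)
  from vp.linear_exists_left_inverse_on[OF this V]
  obtain \<pi> where \<pi>: "range \<pi> \<subseteq> ?V" "Vector_Spaces.linear scal scal \<pi>" "\<And>v. v \<in> ?V \<Longrightarrow> \<pi> v = v"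
    by (auto simp: inj_on_def)
  have \<pi>_add: "\<pi> (x + y) = \<pi> x + \<pi> y" and \<pi>_scal: "\<pi> (scal c x) = scal c (\<pi> x)" for x y c
    using \<pi>(2) by (simp_all add: Vector_Spaces.linear_iff)
  have \<pi>_zero: "\<pi> 0 = 0" using \<pi>_add[of 0 0] by simp
  \<comment> \<open>The sum over \<open>T\<close>; the division by the order of \<open>T\<close> is postponed to the definition of \<open>s\<close>.\<close>
  define avg where "avg f = (\<Sum>t\<in>T. delta t * \<pi> (delta (- t) * f))" for f
  have avg_add: "avg (f + h) = avg f + avg h" for f h
    by (simp add: avg_def distrib_left \<pi>_add sum.distrib)
  have avg_scal: "avg (scal c f) = scal c (avg f)" for c f
    by (simp add: avg_def sum_distrib_left scal_commute \<pi>_scal)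
  have avg_delta: "avg (delta s * f) = delta s * avg f" if s: "s \<in> T" for s f
  proof -
    have bij: "bij_betw (\<lambda>t. s + t) T T"
      using s by (intro bij_betwI[of _ _ _ "\<lambda>t. - s + t"]) (auto simp: T_add T_uminus add.assoc[symmetric])
    have "avg (delta s * f) = (\<Sum>t\<in>T. delta (s + t) * \<pi> (delta (- (s + t)) * (delta s * f)))"
      unfolding avg_def by (rule sum.reindex_bij_betw[OF bij, symmetric])
    also have "\<dots> = delta s * avg f"
      unfolding avg_def sum_distrib_left
    proof (rule sum.cong[OF HOL.refl])
      fix t assume "t \<in> T"
      have "delta (- (s + t)) * (delta s * f) = delta (- t) * f"
        by (simp add: delta_mult mult.assoc[symmetric] minus_add add.assoc del: add_uminus_conv_diff)
      then show "delta (s + t) * \<pi> (delta (- (s + t)) * (delta s * f))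
          = delta s * (delta t * \<pi> (delta (- t) * f))"
        by (simp add: delta_mult mult.assoc[symmetric])
    qed
    finally show ?thesis .
  qed
  have avg_mult: "avg (g * f) = g * avg f" if "g \<in> alg T" for g f
    using that
  proof (induction rule: alg_induct)
    case zero
    then show ?case by (simp add: avg_def \<pi>_zero)
  next
    case (add t c p)
    have "avg (single t c * f) = avg (scal c (delta t * f))"
      by (simp add: mult_single flip: mult.assoc)
    also have "\<dots> = single t c * avg f"
      unfolding avg_scal avg_delta[OF add(1)] by (simp add: mult_single flip: mult.assoc)
    finally show ?case using add by (simp add: distrib_right avg_add)
  qed
  have "avg 1 \<in> ?V"
    unfolding avg_def
  proof (rule vs.subspace_sum[OF V])
    fix t assume t: "t \<in> T"
    obtain r where r: "r \<in> alg T" "\<pi> (delta (- t) * 1) = a * r" using \<pi>(1) by blast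
    have "delta t * (a * r) = a * (delta t * r)"
      using algT_commute[OF aT alg_single[OF t]] by (simp flip: mult.assoc)
    moreover have "delta t * r \<in> alg T" using r(1) t by (intro algT_mult alg_single)
    ultimately show "delta t * \<pi> (delta (- t) * 1) \<in> ?V" unfolding r(2) by blast
  qed
  then obtain r where r: "r \<in> alg T" "avg 1 = a * r" by blast
  have "avg a = (\<Sum>t\<in>T. a)"
    unfolding avg_def
  proof (rule sum.cong[OF HOL.refl])
    fix t assume t: "t \<in> T"
    have "delta (- t) * a = a * delta (- t)" by (rule algT_commute[OF alg_single[OF T_uminus[OF t]] aT])
    moreover have "delta (- t) \<in> alg T" using t by (intro alg_single T_uminus)
    ultimately have "delta (- t) * a \<in> ?V" by blast
    then show "delta t * \<pi> (delta (- t) * a) = a" by (simp add: \<pi>(3) delta_cancel)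
  qed
  also have "\<dots> = scal (of_nat (card T)) a" by (simp add: single_of_nat)
  finally have "scal (of_nat (card T)) a = avg (a * 1)" by simp
  also have "\<dots> = a * (a * r)" by (simp only: avg_mult[OF aT] r(2))
  finally have eq: "scal (of_nat (card T)) a = a * (a * r)" .
  let ?i = "inverse (of_nat (card T)) :: 'k"
  define s where "s = scal ?i r"
  have "a = scal (inverse c) (scal c a)" if "c \<noteq> 0" for c
    using that by (simp add: mult_single flip: mult.assoc)
  from this[OF card] have "a = scal ?i (scal (of_nat (card T)) a)" .
  also have "\<dots> = a * (a * s)" unfolding eq s_def by (simp only: scal_commute)
  finally have as: "a = a * (a * s)" .
  have sT: "s \<in> alg T" unfolding s_def using r(1) by (intro algT_mult algT_scalar)
  have pow: "a = a * (a * s) ^ m" for m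
  proof (induction m)
    case (Suc m)
    have "a * (a * s) ^ Suc m = a * (a * s) * (a * s) ^ m" by (simp add: mult.assoc)
    also have "\<dots> = a" using as Suc by simp
    finally show ?case by simp
  qed simp
  obtain m where "a ^ m = 0" using a by (auto simp: N_def)
  then have "(a * s) ^ m = 0" using algT_commute[OF aT sT] by (simp add: power_mult_commute)
  then show ?thesis using pow[of m] by simp
qed

end

section \<open>Quotients by kernels\<close>

text \<open>Both the presented monoid and the localization are sets of classes of the kernel of a map
  into the model group, with a product computed on representatives.\<close>

locale kernel_quotient =
  fixes D :: "'d set" and f :: "'d \<Rightarrow> 'x::monoid_add" and m :: "'d \<Rightarrow> 'd \<Rightarrow> 'd"
  assumes m_closed: "a \<in> D \<Longrightarrow> b \<in> D \<Longrightarrow> m a b \<in> D"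
    and f_m: "a \<in> D \<Longrightarrow> b \<in> D \<Longrightarrow> f (m a b) = f a + f b"
begin

definition ker :: "('d \<times> 'd) set" where
  "ker = {(x, y). x \<in> D \<and> y \<in> D \<and> f x = f y}"

definition val :: "'d set \<Rightarrow> 'x" where
  "val C = f (SOME x. x \<in> C)"

definition mul :: "'d set \<Rightarrow> 'd set \<Rightarrow> 'd set" where
  "mul A B = (\<Union>a\<in>A. \<Union>b\<in>B. ker `` {m a b})"

lemma class_eq: "x \<in> D \<Longrightarrow> ker `` {x} = {y \<in> D. f y = f x}"
  by (auto simp: ker_def)

lemma val_class:
  assumes "x \<in> D"
  shows "val (ker `` {x}) = f x"
proof -
  have "(SOME y. y \<in> ker `` {x}) \<in> ker `` {x}"
    by (rule someI[of _ x]) (simp add: class_eq assms)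
  then show ?thesis by (simp add: class_eq assms val_def)
qed

lemma quotientE':
  assumes "C \<in> D // ker"
  obtains x where "x \<in> D" "C = ker `` {x}"
  using assms by (rule quotientE)

lemma inj_val: "inj_on val (D // ker)"
proof (rule inj_onI)
  fix A B assume AB: "A \<in> D // ker" "B \<in> D // ker" "val A = val B"
  obtain x where x: "x \<in> D" "A = ker `` {x}" using AB(1) by (rule quotientE')
  obtain y where y: "y \<in> D" "B = ker `` {y}" using AB(2) by (rule quotientE')
  have "f x = f y" using AB(3) by (simp only: x(2) y(2) val_class[OF x(1)] val_class[OF y(1)])
  then show "A = B" by (simp only: x(2) y(2) class_eq[OF x(1)] class_eq[OF y(1)])
qed

lemma val_image: "val ` (D // ker) = f ` D"
proof (intro equalityI subsetI)
  fix v assume "v \<in> val ` (D // ker)"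
  then obtain C where C: "C \<in> D // ker" "v = val C" by blast
  obtain x where "x \<in> D" "C = ker `` {x}" using C(1) by (rule quotientE')
  then show "v \<in> f ` D" using C(2) by (simp add: val_class)
next
  fix v assume "v \<in> f ` D"
  then obtain x where x: "x \<in> D" "v = f x" by blast
  then have "v = val (ker `` {x})" "ker `` {x} \<in> D // ker" by (simp_all add: val_class quotientI)
  then show "v \<in> val ` (D // ker)" by (rule image_eqI)
qed

lemma mul_class:
  assumes "x \<in> D" "y \<in> D"
  shows "mul (ker `` {x}) (ker `` {y}) = ker `` {m x y}"
proof -
  have "ker `` {m a b} = ker `` {m x y}" if "a \<in> ker `` {x}" "b \<in> ker `` {y}" for a b
    using that assms by (simp add: class_eq m_closed f_m)
  moreover have "x \<in> ker `` {x}" "y \<in> ker `` {y}" using assms by (simp_all add: class_eq)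
  ultimately show ?thesis unfolding mul_def by blast
qed

lemma mul_closed: assumes "A \<in> D // ker" "B \<in> D // ker" shows "mul A B \<in> D // ker"
proof -
  obtain x where x: "x \<in> D" "A = ker `` {x}" using assms(1) by (rule quotientE')
  obtain y where y: "y \<in> D" "B = ker `` {y}" using assms(2) by (rule quotientE')
  show ?thesis using x y by (simp add: mul_class m_closed quotientI)
qed

lemma val_mul: assumes "A \<in> D // ker" "B \<in> D // ker" shows "val (mul A B) = val A + val B"
proof -
  obtain x where x: "x \<in> D" "A = ker `` {x}" using assms(1) by (rule quotientE')
  obtain y where y: "y \<in> D" "B = ker `` {y}" using assms(2) by (rule quotientE')
  show ?thesis using x y by (simp add: mul_class val_class m_closed f_m)
qed

end

section \<open>Monoids embedded in a group type\<close>

locale monoid_embedding =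
  fixes M :: "('m, 'b) monoid_scheme" and \<phi> :: "'m \<Rightarrow> 'x::monoid_add"
  assumes inj: "inj_on \<phi> (carrier M)"
    and closed: "a \<in> carrier M \<Longrightarrow> b \<in> carrier M \<Longrightarrow> a \<otimes>\<^bsub>M\<^esub> b \<in> carrier M"
    and one: "\<one>\<^bsub>M\<^esub> \<in> carrier M"
    and hom: "a \<in> carrier M \<Longrightarrow> b \<in> carrier M \<Longrightarrow> \<phi> (a \<otimes>\<^bsub>M\<^esub> b) = \<phi> a + \<phi> b"
    and hom_one: "\<phi> \<one>\<^bsub>M\<^esub> = 0"
begin

lemma inj_eq: "a \<in> carrier M \<Longrightarrow> b \<in> carrier M \<Longrightarrow> \<phi> a = \<phi> b \<longleftrightarrow> a = b"
  using inj by (simp add: inj_on_eq_iff)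

lemma monoid: "monoid M"
  by (rule monoidI) (simp_all add: inj_eq[symmetric] closed one hom hom_one add.assoc)

lemma pow: "a \<in> carrier M \<Longrightarrow> a [^]\<^bsub>M\<^esub> k \<in> carrier M \<and> \<phi> (a [^]\<^bsub>M\<^esub> k) = nmult k (\<phi> a)"
  for k :: nat
proof (induction k)
  case 0
  then show ?case using monoid.nat_pow_0[OF monoid] by (simp add: one hom_one)
next
  case (Suc k)
  have "nmult k (\<phi> a) + \<phi> a = nmult (Suc k) (\<phi> a)"
    using nmult_commute[of "\<phi> a" "\<phi> a" k] by simp
  then show ?case using Suc monoid.nat_pow_Suc[OF monoid] by (simp add: closed hom)
qed

definition \<Phi> :: "('m \<Rightarrow>\<^sub>0 'k::comm_ring_1) \<Rightarrow> 'x \<Rightarrow>\<^sub>0 'k" where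
  "\<Phi> f = (\<Sum>a\<in>keys f. single (\<phi> a) (lookup f a))"

lemma \<Phi>_zero: "\<Phi> 0 = 0"
  by (simp add: \<Phi>_def)

lemma \<Phi>_add: "\<Phi> (f + g) = \<Phi> f + \<Phi> g"
  unfolding \<Phi>_def by (rule setsum_keys_plus_distrib) (simp_all add: single_add)

lemma \<Phi>_single: "\<Phi> (single a c) = single (\<phi> a) c"
  by (simp add: \<Phi>_def)

lemma \<Phi>_sum: "\<Phi> (sum f I) = (\<Sum>i\<in>I. \<Phi> (f i))"
  by (induction I rule: infinite_finite_induct) (simp_all add: \<Phi>_zero \<Phi>_add)

lemma lookup_\<Phi>:
  assumes "f \<in> alg (carrier M)" "a \<in> carrier M"
  shows "lookup (\<Phi> f) (\<phi> a) = lookup f a"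
proof -
  have "lookup (\<Phi> f) (\<phi> a) = (\<Sum>b\<in>keys f. if \<phi> b = \<phi> a then lookup f b else 0)"
    by (simp add: \<Phi>_def lookup_sum lookup_single when_def)
  also have "\<dots> = (\<Sum>b\<in>keys f. if b = a then lookup f b else 0)"
    using assms by (intro sum.cong HOL.refl) (auto simp: alg_def inj_eq)
  also have "\<dots> = lookup f a" by (simp add: in_keys_iff)
  finally show ?thesis .
qed

lemma \<Phi>_image: "\<Phi> ` alg (carrier M) = (alg (\<phi> ` carrier M) :: ('x \<Rightarrow>\<^sub>0 'k::comm_ring_1) set)"
proof (intro equalityI subsetI)
  fix F assume "F \<in> \<Phi> ` alg (carrier M)"
  then obtain f where f: "f \<in> alg (carrier M)" "F = \<Phi> f" by blast
  show "F \<in> alg (\<phi> ` carrier M)"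
    unfolding f(2) \<Phi>_def using f(1) by (intro alg_sum alg_single) (auto simp: alg_def)
next
  fix F :: "'x \<Rightarrow>\<^sub>0 'k" assume "F \<in> alg (\<phi> ` carrier M)"
  then show "F \<in> \<Phi> ` alg (carrier M)"
  proof (induction rule: alg_induct)
    case zero
    then show ?case by (rule image_eqI[of _ _ 0]) (simp_all add: \<Phi>_zero)
  next
    case (add x c p)
    then obtain a f where af: "a \<in> carrier M" "x = \<phi> a" "f \<in> alg (carrier M)" "p = \<Phi> f" by blast
    show ?case
      by (rule image_eqI[of _ _ "single a c + f"])
        (simp_all add: af \<Phi>_add \<Phi>_single alg_add alg_single)
  qed
qed

lemma \<Phi>_mult:
  assumes "f \<in> alg (carrier M)" "g \<in> alg (carrier M)"
  shows "\<Phi> (f \<otimes>\<^bsub>monoid_algebra K M\<^esub> g) = \<Phi> f * \<Phi> g"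
proof -
  have "\<Phi> (f \<otimes>\<^bsub>monoid_algebra K M\<^esub> g)
      = (\<Sum>a\<in>keys f. \<Sum>b\<in>keys g. single (\<phi> (a \<otimes>\<^bsub>M\<^esub> b)) (lookup f a * lookup g b))"
    by (simp add: monoid_algebra_def \<Phi>_sum \<Phi>_single)
  also have "\<dots> = (\<Sum>a\<in>keys f. \<Sum>b\<in>keys g. single (\<phi> a) (lookup f a) * single (\<phi> b) (lookup g b))"
    using assms by (intro sum.cong HOL.refl) (auto simp: alg_def hom mult_single subset_iff)
  also have "\<dots> = \<Phi> f * \<Phi> g" by (simp add: \<Phi>_def sum_product)
  finally show ?thesis .
qed

lemma carrier_algebra: "carrier (monoid_algebra K M) = alg (carrier M)"
  by (simp add: monoid_algebra_def alg_def)

lemma zero_algebra: "\<zero>\<^bsub>monoid_algebra K M\<^esub> = 0"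
  by (simp add: monoid_algebra_def)

lemma add_algebra: "f \<oplus>\<^bsub>monoid_algebra K M\<^esub> g = f + g"
  by (simp add: monoid_algebra_def)

lemma mult_algebra_closed:
  assumes "f \<in> alg (carrier M)" "g \<in> alg (carrier M)"
  shows "f \<otimes>\<^bsub>monoid_algebra K M\<^esub> g \<in> alg (carrier M)"
proof -
  have eq: "f \<otimes>\<^bsub>monoid_algebra K M\<^esub> g
      = (\<Sum>a\<in>keys f. \<Sum>b\<in>keys g. single (a \<otimes>\<^bsub>M\<^esub> b) (lookup f a * lookup g b))"
    by (simp add: monoid_algebra_def)
  show ?thesis
    unfolding eq using assms by (intro alg_sum alg_single closed) (auto simp: alg_def)
qed

end

lemma subring_set_alg:
  fixes A :: "'x::monoid_add set"
  assumes "0 \<in> A" "\<And>a b. a \<in> A \<Longrightarrow> b \<in> A \<Longrightarrow> a + b \<in> A"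
  shows "subring_set (alg A :: ('x \<Rightarrow>\<^sub>0 'k::comm_ring_1) set)"
  using alg_single[OF assms(1), of "1::'k"]
  by (auto simp: subring_set_def alg_add alg_uminus intro: alg_mult assms(2))

lemma (in monoid_embedding) ring_embedding:
  "ring_embedding (monoid_algebra (K :: 'k::comm_ring_1 itself) M) \<Phi>"
proof
  show "inj_on \<Phi> (carrier (monoid_algebra K M))"
  proof (rule inj_onI, unfold carrier_algebra)
    fix f g :: "'m \<Rightarrow>\<^sub>0 'k"
    assume fg: "f \<in> alg (carrier M)" "g \<in> alg (carrier M)" "\<Phi> f = \<Phi> g"
    show "f = g"
    proof (rule poly_mapping_eqI)
      fix a
      show "lookup f a = lookup g a"
      proof (cases "a \<in> carrier M")
        case True
        then show ?thesis using fg lookup_\<Phi> by metis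
      next
        case False
        then have "a \<notin> keys f" "a \<notin> keys g" using fg by (auto simp: alg_def)
        then show ?thesis by (simp add: in_keys_iff)
      qed
    qed
  qed
  have "0 \<in> \<phi> ` carrier M" using one hom_one by (metis image_eqI)
  moreover have "x + y \<in> \<phi> ` carrier M" if xy: "x \<in> \<phi> ` carrier M" "y \<in> \<phi> ` carrier M" for x y
  proof -
    obtain a b where "a \<in> carrier M" "x = \<phi> a" "b \<in> carrier M" "y = \<phi> b" using xy by blast
    then have "x + y = \<phi> (a \<otimes>\<^bsub>M\<^esub> b)" "a \<otimes>\<^bsub>M\<^esub> b \<in> carrier M" by (simp_all add: hom closed)
    then show ?thesis by blast
  qed
  ultimately show "subring_set (\<Phi> ` carrier (monoid_algebra K M))"
    unfolding carrier_algebra \<Phi>_image by (rule subring_set_alg)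
  show "\<Phi> \<one>\<^bsub>monoid_algebra K M\<^esub> = 1"
    by (simp add: monoid_algebra_def \<Phi>_single hom_one)
  show "\<one>\<^bsub>monoid_algebra K M\<^esub> \<in> carrier (monoid_algebra K M)"
    using alg_single[OF one] unfolding carrier_algebra by (simp add: monoid_algebra_def)
qed (simp_all add: carrier_algebra zero_algebra add_algebra \<Phi>_zero \<Phi>_add \<Phi>_mult alg_add mult_algebra_closed)

section \<open>The monoid and its group of fractions inside the model\<close>

context transitive_abelian
begin

interpretation WQ: kernel_quotient "lists {1..n}" word "(@)"
  by unfold_locales simp_all

lemma ker_word: "WQ.ker = cong"
  by (auto simp: WQ.ker_def cong_iff)

abbreviation Sm :: "nat list set monoid" where "Sm \<equiv> S_monoid n l H"

lemma S_carrier: "carrier Sm = lists {1..n} // WQ.ker"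
  by (simp add: S_monoid_def presented_monoid_def ker_word)

lemma S_mult: "A \<otimes>\<^bsub>Sm\<^esub> B = WQ.mul A B"
  by (simp add: S_monoid_def presented_monoid_def ker_word WQ.mul_def)

lemma S_one: "\<one>\<^bsub>Sm\<^esub> = WQ.ker `` {[]}"
  by (simp add: S_monoid_def presented_monoid_def ker_word)

definition embS :: "nat list set \<Rightarrow> (int \<times> int \<times> nat) sym" where "embS = WQ.val"

lemma monoid_embedding_S: "monoid_embedding Sm embS"
  by unfold_locales
    (auto simp: S_carrier S_mult S_one embS_def WQ.inj_val WQ.mul_closed WQ.val_mul WQ.val_class
      intro: quotientI)

interpretation ES: monoid_embedding Sm embS
  by (rule monoid_embedding_S)

lemma embS_image: "embS ` carrier Sm = words"
  by (simp add: S_carrier embS_def WQ.val_image words_def)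

lemma S_gen: "S_gen n l H 1 \<in> carrier Sm" "embS (S_gen n l H 1) = gen 1"
proof -
  have eq: "S_gen n l H 1 = WQ.ker `` {[1]}" by (simp add: S_gen_def presentation_gen_def ker_word)
  have "[1] \<in> lists {1..n}" using one_mem by simp
  then show "S_gen n l H 1 \<in> carrier Sm" "embS (S_gen n l H 1) = gen 1"
    by (simp_all add: eq S_carrier quotientI embS_def WQ.val_class)
qed

definition dens :: "nat list set set" where
  "dens = {(S_gen n l H 1 [^]\<^bsub>Sm\<^esub> l) [^]\<^bsub>Sm\<^esub> k |k::nat. True}"

lemma dens: "c \<in> dens \<Longrightarrow> c \<in> carrier Sm \<and> (\<exists>k. embS c = nmult k zeta)"
  using ES.pow[OF S_gen(1), of l] ES.pow[of "S_gen n l H 1 [^]\<^bsub>Sm\<^esub> l"]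
  by (auto simp: dens_def S_gen zeta_def)

lemma dens_image: "\<exists>c\<in>dens. embS c = nmult k zeta"
  using ES.pow[OF S_gen(1), of l] ES.pow[of "S_gen n l H 1 [^]\<^bsub>Sm\<^esub> l" k]
  by (intro bexI[of _ "(S_gen n l H 1 [^]\<^bsub>Sm\<^esub> l) [^]\<^bsub>Sm\<^esub> k"]) (auto simp: dens_def S_gen zeta_def)

lemma dens_mult: "c \<in> dens \<Longrightarrow> d \<in> dens \<Longrightarrow> c \<otimes>\<^bsub>Sm\<^esub> d \<in> dens"
  using monoid.nat_pow_mult[OF ES.monoid, of "S_gen n l H 1 [^]\<^bsub>Sm\<^esub> l"] ES.pow[OF S_gen(1), of l]
  unfolding dens_def by auto

lemma dens_one: "\<one>\<^bsub>Sm\<^esub> \<in> dens"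
  using monoid.nat_pow_0[OF ES.monoid, of "S_gen n l H 1 [^]\<^bsub>Sm\<^esub> l"]
  unfolding dens_def by (intro CollectI exI[of _ 0]) simp

definition frac :: "nat list set \<times> nat list set \<Rightarrow> (int \<times> int \<times> nat) sym" where
  "frac p = embS (fst p) - embS (snd p)"

definition fmul :: "nat list set \<times> nat list set \<Rightarrow> nat list set \<times> nat list set \<Rightarrow> nat list set \<times> nat list set" where
  "fmul p q = (fst p \<otimes>\<^bsub>Sm\<^esub> fst q, snd p \<otimes>\<^bsub>Sm\<^esub> snd q)"

lemma dens_central:
  assumes "c \<in> dens" "s \<in> carrier Sm"
  shows "embS c + embS s = embS s + embS c"
proof -
  obtain k where "embS c = nmult k zeta" using dens assms(1) by blast
  moreover have "embS s \<in> words" using assms(2) embS_image by blast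
  ultimately show ?thesis by (simp add: words_zeta_commute)
qed

interpretation FQ: kernel_quotient "carrier Sm \<times> dens" frac fmul
proof
  fix a b assume "a \<in> carrier Sm \<times> dens" "b \<in> carrier Sm \<times> dens"
  then obtain s z t w where ab: "a = (s, z)" "b = (t, w)" "s \<in> carrier Sm" "t \<in> carrier Sm"
    "z \<in> dens" "w \<in> dens" by (cases a, cases b) auto
  note zw = dens[OF ab(5)] dens[OF ab(6)]
  show "fmul a b \<in> carrier Sm \<times> dens"
    using dens_mult[OF ab(5,6)] ES.closed[OF ab(3,4)] by (simp add: ab(1,2) fmul_def)
  have 1: "- embS z + embS t = embS t - embS z"
    using dens_central[OF ab(5,4)] by (rule uminus_commute)
  have 2: "embS z + embS w = embS w + embS z" using dens_central[OF ab(5)] zw by blast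
  have "frac (fmul a b) = embS s + embS t - (embS z + embS w)"
    using ab(3,4) zw by (simp add: frac_def fmul_def ab(1,2) ES.hom)
  also have "\<dots> = embS s + (embS t - embS z) - embS w"
    unfolding 2 by (simp add: diff_conv_add_uminus minus_add add.assoc del: add_uminus_conv_diff)
  also have "\<dots> = frac a + frac b"
    unfolding 1[symmetric]
    by (simp add: frac_def ab(1,2) diff_conv_add_uminus add.assoc del: add_uminus_conv_diff)
  finally show "frac (fmul a b) = frac a + frac b" .
qed

text \<open>Two fractions are related exactly when their values in the model group agree, because the
  denominators are central there and the factor \<open>u\<close> can be cancelled.\<close>

lemma frac_eq_iff:
  assumes "s \<in> carrier Sm" "t \<in> carrier Sm" "z \<in> dens" "w \<in> dens"
  shows "frac (s, z) = frac (t, w) \<longleftrightarrow> (\<exists>u\<in>dens. s \<otimes>\<^bsub>Sm\<^esub> w \<otimes>\<^bsub>Sm\<^esub> u = t \<otimes>\<^bsub>Sm\<^esub> z \<otimes>\<^bsub>Sm\<^esub> u)"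
proof -
  have zw: "z \<in> carrier Sm" "w \<in> carrier Sm" using dens assms by blast+
  have "s \<otimes>\<^bsub>Sm\<^esub> w \<otimes>\<^bsub>Sm\<^esub> u = t \<otimes>\<^bsub>Sm\<^esub> z \<otimes>\<^bsub>Sm\<^esub> u \<longleftrightarrow> frac (s, z) = frac (t, w)" if u: "u \<in> dens" for u
  proof -
    have uS: "u \<in> carrier Sm" using dens u by blast
    have "s \<otimes>\<^bsub>Sm\<^esub> w \<otimes>\<^bsub>Sm\<^esub> u = t \<otimes>\<^bsub>Sm\<^esub> z \<otimes>\<^bsub>Sm\<^esub> u \<longleftrightarrow> embS s + embS w = embS t + embS z"
      using assms(1,2) zw uS by (simp add: ES.inj_eq[symmetric] ES.closed ES.hom)
    also have "\<dots> \<longleftrightarrow> embS s + embS w - embS w - embS z = embS t + embS z - embS w - embS z"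
      by (simp only: diff_conv_add_uminus add_right_cancel)
    also have "embS s + embS w - embS w - embS z = frac (s, z)" by (simp add: frac_def)
    also have "embS t + embS z - embS w - embS z = frac (t, w)"
    proof -
      have "embS z - embS w = - embS w + embS z"
        using uminus_commute[OF dens_central[OF assms(4) zw(1)]] by simp
      then have "embS t + embS z - embS w - embS z = embS t + (- embS w + embS z) - embS z"
        by (simp add: add_diff_eq[symmetric])
      also have "\<dots> = embS t - embS w"
        by (simp add: diff_conv_add_uminus add.assoc del: add_uminus_conv_diff)
      finally show ?thesis by (simp add: frac_def)
    qed
    finally show ?thesis .
  qed
  then show ?thesis using dens_one by blast
qed

lemma ker_frac: "FQ.ker = fraction_rel Sm dens"
proof -
  have "(p, q) \<in> FQ.ker \<longleftrightarrow> (p, q) \<in> fraction_rel Sm dens" for p q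
  proof -
    obtain s z t w where pq: "p = (s, z)" "q = (t, w)" by (cases p, cases q)
    show ?thesis
      unfolding pq FQ.ker_def fraction_rel_def
      using frac_eq_iff[of s t z w] by auto
  qed
  then show ?thesis by auto
qed

abbreviation Gm :: "(nat list set \<times> nat list set) set monoid" where "Gm \<equiv> fraction_group n l H"

lemma fraction_group_eq: "Gm = central_localization Sm dens"
  by (simp add: fraction_group_def dens_def)

lemma G_carrier: "carrier Gm = (carrier Sm \<times> dens) // FQ.ker"
  by (simp add: fraction_group_eq central_localization_def ker_frac)

lemma G_mult: "A \<otimes>\<^bsub>Gm\<^esub> B = FQ.mul A B"
  by (simp add: fraction_group_eq central_localization_def ker_frac FQ.mul_def fmul_def case_prod_beta)

lemma G_one: "\<one>\<^bsub>Gm\<^esub> = FQ.ker `` {(\<one>\<^bsub>Sm\<^esub>, \<one>\<^bsub>Sm\<^esub>)}"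
  by (simp add: fraction_group_eq central_localization_def ker_frac)

definition embG :: "(nat list set \<times> nat list set) set \<Rightarrow> (int \<times> int \<times> nat) sym" where "embG = FQ.val"

lemma monoid_embedding_G: "monoid_embedding Gm embG"
proof -
  have one: "(\<one>\<^bsub>Sm\<^esub>, \<one>\<^bsub>Sm\<^esub>) \<in> carrier Sm \<times> dens" using ES.one dens_one by blast
  show ?thesis
  proof
    show "\<one>\<^bsub>Gm\<^esub> \<in> carrier Gm" unfolding G_carrier G_one using one by (rule quotientI)
    show "embG \<one>\<^bsub>Gm\<^esub> = 0" unfolding G_one embG_def FQ.val_class[OF one] by (simp add: frac_def)
  qed (simp_all add: G_carrier G_mult embG_def FQ.inj_val FQ.mul_closed FQ.val_mul)
qed

lemma embG_image: "embG ` carrier Gm = fracs"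
proof -
  have "embG ` carrier Gm = frac ` (carrier Sm \<times> dens)"
    by (simp only: G_carrier embG_def FQ.val_image)
  also have "\<dots> = fracs"
  proof (intro equalityI subsetI)
    fix g assume "g \<in> frac ` (carrier Sm \<times> dens)"
    then obtain s z where sz: "s \<in> carrier Sm" "z \<in> dens" "g = embS s - embS z"
      by (auto simp: frac_def)
    obtain k where "embS z = nmult k zeta" using dens sz(2) by blast
    then have "g = embS s - nmult k zeta" by (simp only: sz(3))
    moreover have "embS s \<in> words" using sz(1) embS_image by blast
    ultimately show "g \<in> fracs" unfolding fracs_def by blast
  next
    fix g assume "g \<in> fracs"
    then obtain t k where t: "t \<in> words" "g = t - nmult k zeta" unfolding fracs_def by blast
    obtain s where s: "s \<in> carrier Sm" "t = embS s" using t(1) embS_image by blast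
    obtain z where z: "z \<in> dens" "embS z = nmult k zeta" using dens_image by blast
    have "g = frac (s, z)" by (simp add: frac_def t(2) s(2) z(2))
    then show "g \<in> frac ` (carrier Sm \<times> dens)" using s(1) z(1) by blast
  qed
  finally show ?thesis .
qed

interpretation EG: monoid_embedding Gm embG
  by (rule monoid_embedding_G)

lemma graded: "graded_group fracs deg zeta l"
proof
  show "0 \<in> fracs" by (intro words_fracs words_zero)
  show "zeta \<in> fracs" by (intro words_fracs words_zeta)
  show "g + h = h + g" if gh: "g \<in> fracs" "h \<in> fracs" "deg g = 0" "deg h = 0" for g h
  proof -
    obtain A B where "shape g 0 A" "shape h 0 B"
      using deg_zero_shape[OF gh(1,3)] deg_zero_shape[OF gh(2,4)] by blast
    then show ?thesis by (rule shape_zero_commute)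
  qed
qed (simp_all add: fracs_add fracs_uminus deg_add deg_zeta l_pos fracs_zeta_commute finite_deg_zero)

interpretation gr: graded_group fracs deg zeta l
  by (rule graded)

lemma H_card_pos: "card H > 0"
  using H_finite H_id by (auto simp: card_gt_0_iff)

lemma T_exponent: "g \<in> gr.T \<Longrightarrow> nmult (card H) g = 0"
  using deg_zero_shape shape_zero_exponent by (auto simp: gr.T_def)

text \<open>Torsion elements have degree 0, as the degree is additive with values in \<open>\<int>\<close>; conversely, \<open>T\<close> has
  exponent dividing the order of \<open>H\<close>.\<close>

lemma embG_torsion: "embG ` torsion Gm = gr.T"
proof (intro equalityI subsetI)
  fix g assume "g \<in> embG ` torsion Gm"
  then obtain x m where x: "x \<in> carrier Gm" "g = embG x" "m > 0" "x [^]\<^bsub>Gm\<^esub> (m::nat) = \<one>\<^bsub>Gm\<^esub>"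
    by (auto simp: torsion_def)
  have g: "g \<in> fracs" using x(1,2) embG_image by blast
  have "nmult m g = 0" using EG.pow[OF x(1), of m] EG.hom_one x(2,4) by simp
  then have "int m * deg g = 0" using deg_nmult[OF g, of m] gr.dg_zero by simp
  then show "g \<in> gr.T" using g x(3) by (simp add: gr.T_def)
next
  fix g assume g: "g \<in> gr.T"
  then obtain x where x: "x \<in> carrier Gm" "g = embG x" using embG_image gr.T_sub by blast
  have "embG (x [^]\<^bsub>Gm\<^esub> card H) = embG \<one>\<^bsub>Gm\<^esub>"
    using EG.pow[OF x(1), of "card H"] T_exponent[OF g] x(2) EG.hom_one by simp
  then have "x [^]\<^bsub>Gm\<^esub> card H = \<one>\<^bsub>Gm\<^esub>"
    using EG.inj_eq EG.pow[OF x(1), of "card H"] EG.one by blast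
  then have "x \<in> torsion Gm" using x(1) H_card_pos by (auto simp: torsion_def)
  then show "g \<in> embG ` torsion Gm" using x(2) by blast
qed

section \<open>The radicals of the three algebras\<close>

abbreviation Tm :: "(nat list set \<times> nat list set) set monoid" where
  "Tm \<equiv> Gm\<lparr>carrier := torsion Gm\<rparr>"

lemma torsion_sub: "torsion Gm \<subseteq> carrier Gm"
  by (auto simp: torsion_def)

lemma torsion_iff:
  assumes "x \<in> carrier Gm"
  shows "x \<in> torsion Gm \<longleftrightarrow> embG x \<in> gr.T"
proof
  assume "x \<in> torsion Gm"
  then show "embG x \<in> gr.T" using embG_torsion by blast
next
  assume x: "embG x \<in> gr.T"
  then obtain y where y: "y \<in> torsion Gm" "embG x = embG y" unfolding embG_torsion[symmetric] by blast
  then have "x = y" using EG.inj_eq[of x y] assms torsion_sub by blast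
  then show "x \<in> torsion Gm" using y(1) by simp
qed

lemma monoid_embedding_T: "monoid_embedding Tm embG"
proof
  have sub: "x \<in> carrier Gm" if "x \<in> carrier Tm" for x using that torsion_sub by auto
  show "inj_on embG (carrier Tm)" using EG.inj torsion_sub by (simp add: inj_on_subset)
  show "a \<otimes>\<^bsub>Tm\<^esub> b \<in> carrier Tm" if "a \<in> carrier Tm" "b \<in> carrier Tm" for a b
    using that sub[OF that(1)] sub[OF that(2)] by (simp add: torsion_iff EG.closed EG.hom gr.T_add)
  show "\<one>\<^bsub>Tm\<^esub> \<in> carrier Tm" using EG.one by (simp add: torsion_iff EG.hom_one gr.T_zero)
  show "embG (a \<otimes>\<^bsub>Tm\<^esub> b) = embG a + embG b" if "a \<in> carrier Tm" "b \<in> carrier Tm" for a b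
    using sub[OF that(1)] sub[OF that(2)] by (simp add: EG.hom)
  show "embG \<one>\<^bsub>Tm\<^esub> = 0" by (simp add: EG.hom_one)
qed

interpretation ET: monoid_embedding Tm embG
  by (rule monoid_embedding_T)

lemma radical_G:
  fixes K :: "'k::field itself"
  assumes "f \<in> jacobson_radical (monoid_algebra K Gm)"
  shows "f \<in> alg (carrier Gm)" "EG.\<Phi> f \<in> gr.nil_ideal"
proof -
  interpret R: ring_embedding "monoid_algebra K Gm" EG.\<Phi> by (rule EG.ring_embedding)
  show f: "f \<in> alg (carrier Gm)"
    using assms by (simp add: jacobson_radical_def EG.carrier_algebra)
  have "EG.\<Phi> f \<in> quasi_radical (alg fracs)"
    using assms R.jacobson_radical_iff[of f] f by (simp add: EG.carrier_algebra EG.\<Phi>_image embG_image)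
  then show "EG.\<Phi> f \<in> gr.nil_ideal"
    by (rule gr.quasi_radical_sub_nil_ideal[rotated -1]) (simp_all add: gr.Gr_zero gr.Gr_add)
qed

text \<open>The ideal \<open>N K[G]\<close> bounds the radical of \<open>K[S]\<close>, too, because \<open>S\<close> has all elements of large degree.\<close>

lemma radical_S:
  fixes K :: "'k::field itself"
  assumes "f \<in> jacobson_radical (monoid_algebra K Sm)"
  shows "f \<in> alg (carrier Sm)" "ES.\<Phi> f \<in> gr.nil_ideal"
proof -
  interpret R: ring_embedding "monoid_algebra K Sm" ES.\<Phi> by (rule ES.ring_embedding)
  show f: "f \<in> alg (carrier Sm)"
    using assms by (simp add: jacobson_radical_def ES.carrier_algebra)
  have "ES.\<Phi> f \<in> quasi_radical (alg words)"
    using assms R.jacobson_radical_iff[of f] f by (simp add: ES.carrier_algebra ES.\<Phi>_image embS_image)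
  then show "ES.\<Phi> f \<in> gr.nil_ideal"
  proof (rule gr.quasi_radical_sub_nil_ideal[rotated -1])
    show "words \<subseteq> fracs" using words_fracs by blast
    show "g \<in> words" if "g \<in> fracs" "deg g \<ge> int l" for g
      using high_degree_words[OF that] by (auto simp: words_def)
  qed (simp_all add: words_zero words_add)
qed

text \<open>Each generator \<open>a g\<close> of \<open>N K[G]\<close> is a product of an element \<open>a\<close> of \<open>J(K[T])\<close> and an element of
  \<open>K[G]\<close>.\<close>

lemma nil_ideal_ideal_prod:
  fixes K :: "'k::field itself"
  assumes "F \<in> gr.nil_ideal"
  shows "\<exists>f. f \<in> alg (carrier Gm) \<and> EG.\<Phi> f = F \<and>
    f \<in> jacobson_radical (monoid_algebra K Tm) \<cdot>\<^bsub>monoid_algebra K Gm\<^esub> carrier (monoid_algebra K Gm)"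
  (is "\<exists>f. _ \<and> _ \<and> f \<in> ?P")
  using assms
proof (induction rule: gr.right_span.induct)
  interpret R: ring_embedding "monoid_algebra K Tm" EG.\<Phi>
    by (rule ET.ring_embedding)
  let ?JT = "jacobson_radical (monoid_algebra K Tm)"
  have J0: "0 \<in> ?JT"
    using additive_subgroup.zero_closed[OF ideal.axioms(1)[OF R.jacobson_radical_ideal]]
    by (simp add: ET.zero_algebra)
  case zero
  have "0 \<otimes>\<^bsub>monoid_algebra K Gm\<^esub> 0 \<in> ?P"
    using J0 by (intro ideal_prod.prod) (simp_all add: EG.carrier_algebra)
  moreover have "0 \<otimes>\<^bsub>monoid_algebra K Gm\<^esub> 0 = (0 :: _ \<Rightarrow>\<^sub>0 'k)" by (simp add: monoid_algebra_def)
  ultimately show ?case by (intro exI[of _ 0]) (simp add: EG.\<Phi>_zero)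
next
  interpret R: ring_embedding "monoid_algebra K Tm" EG.\<Phi>
    by (rule ET.ring_embedding)
  case (add a g F)
  then obtain f where f: "f \<in> alg (carrier Gm)" "EG.\<Phi> f = F" "f \<in> ?P" by blast
  have img: "EG.\<Phi> ` alg (torsion Gm) = (alg gr.T :: (_ \<Rightarrow>\<^sub>0 'k) set)"
    using ET.\<Phi>_image by (simp add: embG_torsion)
  have "a \<in> alg gr.T" using add(1) gr.N_alg by blast
  then obtain b where b: "b \<in> alg (torsion Gm)" "a = EG.\<Phi> b" unfolding img[symmetric] by blast
  obtain x where x: "x \<in> carrier Gm" "g = embG x" using add(2) embG_image by blast
  have "b \<in> jacobson_radical (monoid_algebra K Tm)"
    using R.jacobson_radical_iff[of b] b gr.N_quasi_radical[OF add(1)]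
    by (simp add: ET.carrier_algebra img)
  moreover have xs: "single x 1 \<in> alg (carrier Gm)" using x by (intro alg_single)
  ultimately have "b \<otimes>\<^bsub>monoid_algebra K Gm\<^esub> single x 1 \<in> ?P"
    by (intro ideal_prod.prod) (simp_all add: EG.carrier_algebra)
  from ideal_prod.sum[OF this f(3)]
  have "b \<otimes>\<^bsub>monoid_algebra K Gm\<^esub> single x 1 + f \<in> ?P" by (simp only: EG.add_algebra)
  moreover have bG: "b \<in> alg (carrier Gm)" using b(1) torsion_sub alg_mono by blast
  ultimately show ?case
    using f(1,2) EG.mult_algebra_closed[OF bG xs] b(2) x(2)
    by (intro exI[of _ "b \<otimes>\<^bsub>monoid_algebra K Gm\<^esub> single x 1 + f"])
      (simp add: alg_add EG.\<Phi>_add EG.\<Phi>_mult[OF bG xs] EG.\<Phi>_single)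
qed

lemma radical_G_sub:
  fixes K :: "'k::field itself"
  shows "jacobson_radical (monoid_algebra K Gm) \<subseteq>
    jacobson_radical (monoid_algebra K Tm) \<cdot>\<^bsub>monoid_algebra K Gm\<^esub> carrier (monoid_algebra K Gm)"
proof
  interpret R: ring_embedding "monoid_algebra K Gm" EG.\<Phi> by (rule EG.ring_embedding)
  fix f assume f: "f \<in> jacobson_radical (monoid_algebra K Gm)"
  obtain f' where f': "f' \<in> alg (carrier Gm)" "EG.\<Phi> f' = EG.\<Phi> f"
    "f' \<in> jacobson_radical (monoid_algebra K Tm) \<cdot>\<^bsub>monoid_algebra K Gm\<^esub> carrier (monoid_algebra K Gm)"
    using nil_ideal_ideal_prod[OF radical_G(2)[OF f], of K] by blast
  have "f' = f" using R.inj_eq[of f' f] f'(1,2) radical_G(1)[OF f] by (simp add: EG.carrier_algebra)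
  then show "f \<in> jacobson_radical (monoid_algebra K Tm) \<cdot>\<^bsub>monoid_algebra K Gm\<^esub> carrier (monoid_algebra K Gm)"
    using f'(3) by simp
qed

text \<open>The \<open>m\<close>-th power of the radical is inside \<open>N\<^sup>m K[G]\<close>.\<close>

lemma radical_G_nilpotent:
  fixes K :: "'k::field itself"
  shows "nilpotent_ideal (jacobson_radical (monoid_algebra K Gm)) (monoid_algebra K Gm)"
proof -
  interpret R: ring_embedding "monoid_algebra K Gm" EG.\<Phi> by (rule EG.ring_embedding)
  let ?R = "monoid_algebra K Gm"
  let ?J = "jacobson_radical ?R"
  define L where "L m = ((\<lambda>L. L \<cdot>\<^bsub>?R\<^esub> ?J) ^^ m) (carrier ?R)" for m
  have J0: "0 \<in> ?J"
    using additive_subgroup.zero_closed[OF ideal.axioms(1)[OF R.jacobson_radical_ideal]]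
    by (simp add: EG.zero_algebra)
  have sound: "f \<in> alg (carrier Gm) \<and> EG.\<Phi> f \<in> gr.right_span (gr.nil_power m)" if "f \<in> L m" for f m
    using that
  proof (induction m arbitrary: f)
    case 0
    then have f: "f \<in> alg (carrier Gm)" by (simp add: L_def EG.carrier_algebra)
    then have "EG.\<Phi> f \<in> EG.\<Phi> ` alg (carrier Gm)" by (rule imageI)
    then have "EG.\<Phi> f \<in> alg fracs" by (simp only: EG.\<Phi>_image embG_image)
    then show ?case using f gr.alg_right_span_nil_power by blast
  next
    case (Suc m)
    have "f \<in> L m \<cdot>\<^bsub>?R\<^esub> ?J" using Suc.prems by (simp add: L_def)
    then show ?case
    proof (induction rule: ideal_prod.induct)
      case (prod i j)
      note i = Suc.IH[OF prod(1)] and j = radical_G[OF prod(2)]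
      have "EG.\<Phi> (i \<otimes>\<^bsub>?R\<^esub> j) = EG.\<Phi> i * EG.\<Phi> j" using i j by (intro EG.\<Phi>_mult) auto
      then show ?case
        using EG.mult_algebra_closed[of i j K] gr.right_span_nil_power_mult[of "EG.\<Phi> i" m "EG.\<Phi> j"] i j by simp
    next
      case (sum s1 s2)
      then show ?case by (simp add: EG.add_algebra EG.\<Phi>_add alg_add gr.right_span_add del: gr.nil_power.simps)
    qed
  qed
  have zero: "0 \<in> L m" for m
  proof (induction m)
    case 0
    then show ?case by (simp add: L_def EG.carrier_algebra)
  next
    case (Suc m)
    have "0 \<otimes>\<^bsub>?R\<^esub> 0 \<in> L m \<cdot>\<^bsub>?R\<^esub> ?J" using Suc J0 by (rule ideal_prod.prod)
    moreover have "0 \<otimes>\<^bsub>?R\<^esub> 0 = (0 :: _ \<Rightarrow>\<^sub>0 'k)" by (simp add: monoid_algebra_def)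
    ultimately show ?case by (simp add: L_def)
  qed
  obtain m where m: "gr.nil_power m \<subseteq> {0 :: _ \<Rightarrow>\<^sub>0 'k}" using gr.nil_power_eventually_zero by blast
  have "f = 0" if f: "f \<in> L m" for f
  proof -
    have "EG.\<Phi> f = EG.\<Phi> 0"
      using gr.right_span_trivial[OF m] sound[OF f] by (simp add: EG.\<Phi>_zero)
    then show ?thesis
      using R.inj_eq[of f 0] sound[OF f] by (simp add: EG.carrier_algebra)
  qed
  then have "L m = {\<zero>\<^bsub>?R\<^esub>}" using zero by (auto simp: EG.zero_algebra)
  then show ?thesis
    unfolding nilpotent_ideal_def L_def using R.jacobson_radical_ideal by blast
qed

text \<open>By Cauchy's theorem, the primes dividing the order of \<open>T\<close> divide its exponent.\<close>

lemma prime_dvd_card_T: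
  assumes p: "Factorial_Ring.prime p" "p dvd card gr.T"
  shows "p dvd card H"
proof (rule ccontr)
  assume "\<not> p dvd card H"
  then have cop: "coprime p (card H)" using p(1) by (simp add: prime_imp_coprime)
  let ?G = "\<lparr>carrier = gr.T, monoid.mult = (+), one = 0\<rparr>"
  have grp: "group ?G"
  proof (rule groupI)
    show "\<exists>y\<in>carrier ?G. y \<otimes>\<^bsub>?G\<^esub> x = \<one>\<^bsub>?G\<^esub>" if "x \<in> carrier ?G" for x
      using that by (intro bexI[of _ "- x"]) (simp_all add: gr.T_uminus)
  qed (simp_all add: gr.T_add gr.T_zero add.assoc)
  obtain m where m: "card gr.T = p ^ 1 * m" using p(2) by auto
  obtain P where P: "subgroup P ?G" "card P = p ^ 1"
    using sylow_thm[OF p(1) grp, of 1 m] m gr.T_finite by (auto simp: order_def)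
  have PT: "P \<subseteq> gr.T" using subgroup.subset[OF P(1)] by simp
  have "x = 0" if x: "x \<in> P" for x
  proof -
    interpret PG: group "?G\<lparr>carrier := P\<rparr>" by (rule group.subgroup_imp_group[OF grp P(1)])
    have xT: "x \<in> gr.T" using x PT by blast
    have pw: "x [^]\<^bsub>?G\<lparr>carrier := P\<rparr>\<^esub> k = nmult k x" for k :: nat
    proof (induction k)
      case (Suc k)
      then show ?case using nmult_commute[of x x k] by simp
    qed simp
    have "nmult p x = x [^]\<^bsub>?G\<lparr>carrier := P\<rparr>\<^esub> p" by (rule pw[symmetric])
    also have "\<dots> = \<one>\<^bsub>?G\<lparr>carrier := P\<rparr>\<^esub>"
      using PG.pow_order_eq_1[of x] x P(2) by (simp add: order_def)
    finally have "nmult p x = 0" by simp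
    then have kp: "nmult (k * p) x = 0" for k by (induction k) (simp_all add: nmult_add)
    have "nmult (card H) x = 0" using T_exponent[OF xT] .
    then have kh: "nmult (k * card H) x = 0" for k by (induction k) (simp_all add: nmult_add)
    obtain u v where uv: "u * p = v * card H + 1"
      using bezout_nat[of p "card H"] cop prime_gt_0_nat[OF p(1)] by (auto simp: mult.commute)
    have "nmult (u * p) x = nmult (v * card H) x + x" unfolding uv nmult_add by (simp add: One_nat_def)
    then show "x = 0" using kp kh by simp
  qed
  then have "P \<subseteq> {0}" by blast
  then have "card P \<le> 1" using card_mono[of "{0}" P] by simp
  then show False using P(2) prime_gt_1_nat[OF p(1)] by simp
qed

lemma card_T_nonzero:
  assumes "CHAR('k::field) = 0 \<or> (CHAR('k) > 0 \<and> \<not> CHAR('k) dvd card H)"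
  shows "of_nat (card gr.T) \<noteq> (0 :: 'k)"
proof
  assume "of_nat (card gr.T) = (0 :: 'k)"
  then have d: "CHAR('k) dvd card gr.T" by (simp add: of_nat_eq_0_iff_char_dvd)
  have "card gr.T > 0" using gr.T_finite gr.T_zero by (auto simp: card_gt_0_iff)
  then have pos: "CHAR('k) > 0" using d by (cases "CHAR('k) = 0") auto
  then have "Factorial_Ring.prime CHAR('k)" by (rule prime_CHAR_semidom)
  then show False using prime_dvd_card_T[OF _ d] assms pos by auto
qed

lemma radicals_zero:
  fixes K :: "'k::field itself"
  assumes "CHAR('k) = 0 \<or> (CHAR('k) > 0 \<and> \<not> CHAR('k) dvd card H)"
  shows "jacobson_radical (monoid_algebra K Sm) = {\<zero>\<^bsub>monoid_algebra K Sm\<^esub>}"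
    and "jacobson_radical (monoid_algebra K Gm) = {\<zero>\<^bsub>monoid_algebra K Gm\<^esub>}"
proof -
  have N: "gr.N \<subseteq> {0 :: _ \<Rightarrow>\<^sub>0 'k}" using gr.nilpotent_eq_zero[OF card_T_nonzero[OF assms]] by blast
  interpret R: ring_embedding "monoid_algebra K Gm" EG.\<Phi> by (rule EG.ring_embedding)
  interpret Q: ring_embedding "monoid_algebra K Sm" ES.\<Phi> by (rule ES.ring_embedding)
  have "f = 0" if f: "f \<in> jacobson_radical (monoid_algebra K Gm)" for f
  proof -
    have "EG.\<Phi> f = EG.\<Phi> 0" using gr.right_span_trivial[OF N radical_G(2)[OF f]] by (simp add: EG.\<Phi>_zero)
    then show ?thesis using R.inj_eq[of f 0] radical_G(1)[OF f] by (simp add: EG.carrier_algebra)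
  qed
  moreover have "\<zero>\<^bsub>monoid_algebra K Gm\<^esub> \<in> jacobson_radical (monoid_algebra K Gm)"
    using additive_subgroup.zero_closed[OF ideal.axioms(1)[OF R.jacobson_radical_ideal]] .
  ultimately show "jacobson_radical (monoid_algebra K Gm) = {\<zero>\<^bsub>monoid_algebra K Gm\<^esub>}"
    by (auto simp: EG.zero_algebra)
  have "f = 0" if f: "f \<in> jacobson_radical (monoid_algebra K Sm)" for f
  proof -
    have "ES.\<Phi> f = ES.\<Phi> 0" using gr.right_span_trivial[OF N radical_S(2)[OF f]] by (simp add: ES.\<Phi>_zero)
    then show ?thesis using Q.inj_eq[of f 0] radical_S(1)[OF f] by (simp add: ES.carrier_algebra)
  qed
  moreover have "\<zero>\<^bsub>monoid_algebra K Sm\<^esub> \<in> jacobson_radical (monoid_algebra K Sm)"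
    using additive_subgroup.zero_closed[OF ideal.axioms(1)[OF Q.jacobson_radical_ideal]] .
  ultimately show "jacobson_radical (monoid_algebra K Sm) = {\<zero>\<^bsub>monoid_algebra K Sm\<^esub>}"
    by (auto simp: ES.zero_algebra)
qed

end

theorem theorem3p1:
  fixes n l :: nat
    and H :: "(nat \<Rightarrow> nat) set"
    and K :: "'k::field itself"
    and S :: "nat list set monoid"
    and G :: "(nat list set \<times> nat list set) set monoid"
  assumes "n \<ge> 1" and "l \<ge> 2"
    and "subgroup H (sym_group n)"
    and "comm_group ((sym_group n)\<lparr>carrier := H\<rparr>)"
    and "transitive_on {1..n} H"
    and "S = S_monoid n l H"
    and "G = fraction_group n l H"
  shows "jacobson_radical (monoid_algebra K G) \<subseteq>
           jacobson_radical (monoid_algebra K (G\<lparr>carrier := torsion G\<rparr>))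
             \<cdot>\<^bsub>monoid_algebra K G\<^esub> carrier (monoid_algebra K G)
       \<and> nilpotent_ideal (jacobson_radical (monoid_algebra K G)) (monoid_algebra K G)
       \<and> (CHAR('k) = 0 \<or> (CHAR('k) > 0 \<and> \<not> CHAR('k) dvd card H) \<longrightarrow>
            jacobson_radical (monoid_algebra K S) = {\<zero>\<^bsub>monoid_algebra K S\<^esub>} \<and>
            jacobson_radical (monoid_algebra K G) = {\<zero>\<^bsub>monoid_algebra K G\<^esub>})"
proof -
  interpret transitive_abelian n l H
    using assms(2) by (intro transitive_abelian.intro assms(1,3-5)) simp
  show ?thesis
    unfolding assms(6,7) using radical_G_sub radical_G_nilpotent radicals_zero by blast
qed

end
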